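(* Consider the restart-mixture KT process $L_t^{\mathrm R}=\log\widehat M_t^{\mathrm R,J}$ under the change-point law $\mathbb P_\tau$, with calibrated and Ville crossing times $D_{\mathrm C}^{\mathrm R},D_{\mathrm V}^{\mathrm R}$, on the event $\{D_{\mathrm C}^{\mathrm R}<D_{\mathrm V}^{\mathrm R}\}$, and write $d:=D_{\mathrm C}^{\mathrm R}$ and $h_d^{\mathrm R}:=\log\frac1\alpha-L_d^{\mathrm R}$. Let $\eta\in(0,1)$. Conditionally on $\mathcal H_d$, with probability at least $1-\eta$, $$L_{d+m}^{\mathrm R}-L_d^{\mathrm R}\le U_{d,m}^{\mathrm R}(b_d;\eta)$$ simultaneously for every $m\ge1$. Define $$r_d^{\mathrm R}(\eta):=\sup\Big\{r\in\mathbb N_0:\max_{1\le m\le r}U_{d,m}^{\mathrm R}(b_d;\eta)<h_d^{\mathrm R}\Big\}.$$ Then $$\mathbb P_\tau\big(D_{\mathrm V}^{\mathrm R}-D_{\mathrm C}^{\mathrm R}>r_d^{\mathrm R}(\eta)\,\big|\,\mathcal H_d\big)\ge1-\eta .$$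
   Context: Change-point model (law $\mathbb P_\tau$), $\tau\ge1$: $X_1,\ldots,X_\tau$ i.i.d. from $F_0$, $X_{\tau+1},X_{\tau+2},\ldots$ i.i.d. from $F_1$, the two samples independent, $F_0,F_1$ continuous distributions on $\mathbb R$ (with distribution functions also denoted $F_0,F_1$), $U_1,U_2,\ldots$ i.i.d. $\mathrm{Unif}(0,1)$ independent of the $X$'s, and $p_t=t^{-1}\big(\sum_{r=1}^{t-1}\mathbf 1\{X_r>X_t\}+U_t\big)$. Restart mixture: $J\ge2$; $I_j=[(j-1)/J,j/J)$ for $j<J$, $I_J=[(J-1)/J,1]$; $N_{t,j}^{(s)}:=\sum_{i=s+1}^t\mathbf 1\{p_i\in I_j\}$; $\widehat M_t^{(s,J)}:=1$ for $t\le s$ and $\widehat M_t^{(s,J)}:=\prod_{i=s+1}^tJ\,\frac{N^{(s)}_{i-1,j_i}+1/2}{i-s-1+J/2}$ for $t>s$, where $p_i\in I_{j_i}$; $\widehat M_t^{\mathrm R,J}:=\sum_{s=0}^\infty\pi_s\widehat M_t^{(s,J)}$ with deterministic $\pi_s\ge0$, $\sum_s\pi_s=1$. Crossings: $\alpha\in(0,1)$; $(B_t^{\mathrm C})$ is a deterministic positive (calibrated) boundary; $D_{\mathrm C}^{\mathrm R}:=\inf\{t\ge\tau+1:\widehat M_t^{\mathrm R,J}>B_t^{\mathrm C}\}$, $D_{\mathrm V}^{\mathrm R}:=\inf\{t\ge\tau+1:\widehat M_t^{\mathrm R,J}>1/\alpha\}$ ($\inf\varnothing=\infty$). $\mathcal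 H_t:=\sigma(X_1,\ldots,X_t,U_1,\ldots,U_t)$; statements conditional on $\mathcal H_d$ with $d=D_{\mathrm C}^{\mathrm R}$ mean: for each integer $n\ge\tau+1$, conditionally on $\mathcal H_n$, on the event $\{D_{\mathrm C}^{\mathrm R}=n<D_{\mathrm V}^{\mathrm R}\}\in\mathcal H_n$ with $d=n$. Notation: $\boldsymbol u_J=(1/J,\ldots,1/J)$; $b_d:=\sup_x|\frac1d\sum_{\ell=1}^d\mathbf 1\{X_\ell\le x\}-F_1(x)|$; for $s<d$: $n_{d,s}:=d-s$, $\widehat{\boldsymbol\theta}^{(s)}_d:=(N^{(s)}_{d,j}/n_{d,s})_{j\le J}$, $V_{d,s}:=\mathrm{TV}(\widehat{\boldsymbol\theta}^{(s)}_d,\boldsymbol u_J)$ (half the $\ell_1$ distance); for $s\ge0$: $w_{d,s}:=\pi_s\widehat M_d^{(s,J)}/\widehat M_d^{\mathrm R,J}$. $\Phi_J(a):=\sup\{D_{\mathrm{KL}}(\boldsymbol q\|\boldsymbol u_J):\boldsymbol q\in\Delta_J,\|\boldsymbol q-\boldsymbol u_J\|_\infty\le a\}$, $\Delta_J$ the probability simplex. $\lambda_k(\eta):=\sqrt{\frac1{2k}\log\frac{2\pi^2k^2}{3\eta}}$ for $k\ge1$, $\lambda_0(\eta):=0$ (here and below the $\pi$ without subscript is the number $\pi$), $$\delta_{d,i}(b;\eta):=2\Big[\frac d{d+i-1}b+\frac{i-1}{d+i-1}\lambda_{i-1}(\eta)+\frac1{d+i}\Big],$$ $$a^{\mathrm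 R}_{d,r,\ell}(b;\eta):=\frac1\ell\sum_{i=r+1}^{r+\ell}\delta_{d,i}(b;\eta)+\sqrt{\frac1{2\ell}\log\frac{J\pi^4(r+1)^2\ell^2}{9\eta}},\qquad a^{\mathrm R}_{d,m}:=a^{\mathrm R}_{d,0,m}.$$ $a_J:=\frac{J-1}2$; $\kappa_J:=J\log\Gamma(1/2)-\log\Gamma(J/2)+\frac{(1-J)\log(2\pi)}2$; for $n\ge1$, $g_J(n):=\log\Gamma(n+\frac J2)-n\log n+n-a_J\log n-\frac12\log(2\pi)$; $\psi(k):=k\log k-\log\Gamma(k+\frac12)-k+\frac12\log(2\pi)$ for $k\ge1$, $\psi(0):=\frac12\log2$; $\Psi_{d,s}:=\sum_{j=1}^J\psi(N^{(s)}_{d,j})$ for $s<d$. With $[x]_+=\max(x,0)$, for $s<d$, $$G^{(s)}_{d,m}(b;\eta):=m\Phi_J(a^{\mathrm R}_{d,m}(b;\eta))-\frac{2n_{d,s}m}{n_{d,s}+m}\Big[V_{d,s}-\frac J2a^{\mathrm R}_{d,m}(b;\eta)\Big]_+^2-a_J\log\Big(1+\frac m{n_{d,s}}\Big)-\{g_J(n_{d,s}+m)-g_J(n_{d,s})\}+\Psi_{d,s},$$ and for $0\le r<m$ with $\ell:=m-r$, $$H_{d,r,m}(b;\eta):=\ell\,\Phi_J(a^{\mathrm R}_{d,r,\ell}(b;\eta))-a_J\log\ell-\kappa_J-g_J(\ell).$$ Finally $$U^{\mathrm R}_{d,m}(b;\eta):=\log\Big\{\sum_{s=0}^{d-1}w_{d,s}e^{G^{(s)}_{d,m}(b;\eta)}+\sum_{r=0}^{m-1}w_{d,d+r}e^{H_{d,r,m}(b;\eta)}+\sum_{s=d+m}^\infty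 w_{d,s}\Big\}.$$ The maximum over an empty set is $-\infty$ (so $r=0$ always belongs to the set defining $r_d^{\mathrm R}$). *)

theory Defs
  imports "HOL-Probability.Probability"
begin

section \<open>The change-point model\<close>

text \<open>
  All sequences are indexed from 1; the values \<open>X 0\<close> and \<open>U 0\<close> are irrelevant.
  Independence of the whole family \<open>X 1, X 2, \<dots>, U 1, U 2, \<dots>\<close> is expressed over the
  disjoint sum of the two index sets.
\<close>

locale change_point_model = prob_space M
  for M :: "'w measure" +
  fixes \<tau> :: nat
    and F0 F1 :: "real measure"
    and X U :: "nat \<Rightarrow> 'w \<Rightarrow> real"
  assumes tau_ge_1: "\<tau> \<ge> 1"
    and F0_distribution: "real_distribution F0"
    and F1_distribution: "real_distribution F1"
    and F0_continuous: "continuous_on UNIV (cdf F0)"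
    and F1_continuous: "continuous_on UNIV (cdf F1)"
    and independent: "indep_vars (\<lambda>_. borel) (case_sum X U) ({1..} <+> {1..})"
    and pre_change: "\<And>t. 1 \<le> t \<Longrightarrow> t \<le> \<tau> \<Longrightarrow> distr M borel (X t) = F0"
    and post_change: "\<And>t. \<tau> < t \<Longrightarrow> distr M borel (X t) = F1"
    and U_uniform: "\<And>t. 1 \<le> t \<Longrightarrow> distr M borel (U t) = uniform_measure lborel {0<..<1}"

definition history :: "'w measure \<Rightarrow> (nat \<Rightarrow> 'w \<Rightarrow> real) \<Rightarrow> (nat \<Rightarrow> 'w \<Rightarrow> real) \<Rightarrow> nat \<Rightarrow> 'w measure" where
  "history M X U t = sigma (space M)
     ({X i -` A \<inter> space M | i A. i \<in> {1..t} \<and> A \<in> sets borel} \<union>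
      {U i -` A \<inter> space M | i A. i \<in> {1..t} \<and> A \<in> sets borel})"

text \<open>\<open>cond_prob_given M H A\<close> is a version of the conditional probability of \<open>A\<close> given the
  sub-sigma-algebra \<open>H\<close>.\<close>

definition cond_prob_given :: "'w measure \<Rightarrow> 'w measure \<Rightarrow> 'w set \<Rightarrow> 'w \<Rightarrow> real" where
  "cond_prob_given M H A = real_cond_exp M H (indicator A)"

definition pvals :: "(nat \<Rightarrow> 'w \<Rightarrow> real) \<Rightarrow> (nat \<Rightarrow> 'w \<Rightarrow> real) \<Rightarrow> 'w \<Rightarrow> nat \<Rightarrow> real" where
  "pvals X U \<omega> t = ((\<Sum>r = 1..<t. if X r \<omega> > X t \<omega> then 1 else 0) + U t \<omega>) / real t"

section \<open>The restart-mixture KT process\<close>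

text \<open>From here on, \<open>p\<close> is a fixed sequence of p-values (indexed from 1), bins are numbered
  \<open>1, \<dots>, J\<close>, and \<open>\<pi>\<close> is the sequence of prior restart weights (the circle constant is \<open>pi\<close>).\<close>

definition bin :: "nat \<Rightarrow> nat \<Rightarrow> real set" where
  "bin J j = (if j < J then {(real j - 1) / real J ..< real j / real J}
              else {(real J - 1) / real J .. 1})"

text \<open>Only meaningful for \<open>x\<close> in the unit interval, to which all p-values belong almost surely.\<close>

definition bin_index :: "nat \<Rightarrow> real \<Rightarrow> nat" where
  "bin_index J x = (THE j. j \<in> {1..J} \<and> x \<in> bin J j)"

definition bin_count :: "nat \<Rightarrow> (nat \<Rightarrow> real) \<Rightarrow> nat \<Rightarrow> nat \<Rightarrow> nat \<Rightarrow> nat" where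
  "bin_count J p s t j = card {i \<in> {s+1..t}. p i \<in> bin J j}"

definition KT :: "nat \<Rightarrow> (nat \<Rightarrow> real) \<Rightarrow> nat \<Rightarrow> nat \<Rightarrow> real" where
  "KT J p s t = (if t \<le> s then 1 else
     (\<Prod>i = s+1..t. real J *
        ((real (bin_count J p s (i - 1) (bin_index J (p i))) + 1/2) /
         (real (i - s - 1) + real J / 2))))"

definition restart_mix :: "nat \<Rightarrow> (nat \<Rightarrow> real) \<Rightarrow> (nat \<Rightarrow> real) \<Rightarrow> nat \<Rightarrow> real" where
  "restart_mix J \<pi> p t = (\<Sum>s. \<pi> s * KT J p s t)"

definition log_mix :: "nat \<Rightarrow> (nat \<Rightarrow> real) \<Rightarrow> (nat \<Rightarrow> real) \<Rightarrow> nat \<Rightarrow> real" where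
  "log_mix J \<pi> p t = ln (restart_mix J \<pi> p t)"

text \<open>First time after the change at which \<open>M\<close> exceeds the boundary \<open>B\<close>; the infimum of the
  empty set in \<^typ>\<open>enat\<close> is \<open>\<infinity>\<close>.\<close>

definition crossing_time :: "nat \<Rightarrow> (nat \<Rightarrow> real) \<Rightarrow> (nat \<Rightarrow> real) \<Rightarrow> enat" where
  "crossing_time \<tau> M B = Inf {enat t | t. t \<ge> \<tau> + 1 \<and> M t > B t}"

definition restart_weight :: "nat \<Rightarrow> (nat \<Rightarrow> real) \<Rightarrow> (nat \<Rightarrow> real) \<Rightarrow> nat \<Rightarrow> nat \<Rightarrow> real" where
  "restart_weight J \<pi> p d s = \<pi> s * KT J p s d / restart_mix J \<pi> p d"

section \<open>Empirical quantities at the crossing time\<close>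

text \<open>\<open>x\<close> is a fixed sequence of observations (indexed from 1) and \<open>F\<close> a distribution function.\<close>

definition emp_deviation :: "(nat \<Rightarrow> real) \<Rightarrow> (real \<Rightarrow> real) \<Rightarrow> nat \<Rightarrow> real" where
  "emp_deviation x F d =
     (SUP y. \<bar>1 / real d * (\<Sum>l = 1..d. if x l \<le> y then 1 else 0) - F y\<bar>)"

text \<open>Vectors in \<open>J\<close> dimensions are functions on \<^typ>\<open>nat\<close>, read on \<open>{1..J}\<close> only.\<close>

definition uniform_vec :: "nat \<Rightarrow> nat \<Rightarrow> real" where
  "uniform_vec J j = 1 / real J"

definition prob_simplex :: "nat \<Rightarrow> (nat \<Rightarrow> real) set" where
  "prob_simplex J = {q. (\<forall>j \<in> {1..J}. 0 \<le> q j) \<and> (\<Sum>j = 1..J. q j) = 1}"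

definition TV :: "nat \<Rightarrow> (nat \<Rightarrow> real) \<Rightarrow> (nat \<Rightarrow> real) \<Rightarrow> real" where
  "TV J q q' = (1/2) * (\<Sum>j = 1..J. \<bar>q j - q' j\<bar>)"

definition sup_dist :: "nat \<Rightarrow> (nat \<Rightarrow> real) \<Rightarrow> (nat \<Rightarrow> real) \<Rightarrow> real" where
  "sup_dist J q q' = (MAX j \<in> {1..J}. \<bar>q j - q' j\<bar>)"

text \<open>The convention \<open>0 log 0 = 0\<close> is automatic; only strictly positive \<open>q'\<close> are used.\<close>

definition KL :: "nat \<Rightarrow> (nat \<Rightarrow> real) \<Rightarrow> (nat \<Rightarrow> real) \<Rightarrow> real" where
  "KL J q q' = (\<Sum>j = 1..J. q j * ln (q j / q' j))"

definition theta_hat :: "nat \<Rightarrow> (nat \<Rightarrow> real) \<Rightarrow> nat \<Rightarrow> nat \<Rightarrow> nat \<Rightarrow> real" where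
  "theta_hat J p d s j = real (bin_count J p s d j) / real (d - s)"

definition V_dev :: "nat \<Rightarrow> (nat \<Rightarrow> real) \<Rightarrow> nat \<Rightarrow> nat \<Rightarrow> real" where
  "V_dev J p d s = TV J (theta_hat J p d s) (uniform_vec J)"

section \<open>The predictive envelope\<close>

definition Phi :: "nat \<Rightarrow> real \<Rightarrow> real" where
  "Phi J a = Sup {KL J q (uniform_vec J) | q.
     q \<in> prob_simplex J \<and> sup_dist J q (uniform_vec J) \<le> a}"

definition lambda_dev :: "nat \<Rightarrow> real \<Rightarrow> real" where
  "lambda_dev k \<eta> = (if k = 0 then 0 else
     sqrt (1 / (2 * real k) * ln (2 * pi\<^sup>2 * (real k)\<^sup>2 / (3 * \<eta>))))"

definition delta_dev :: "nat \<Rightarrow> nat \<Rightarrow> real \<Rightarrow> real \<Rightarrow> real" where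
  "delta_dev d i b \<eta> = 2 *
     (real d / (real d + real i - 1) * b
      + (real i - 1) / (real d + real i - 1) * lambda_dev (i - 1) \<eta>
      + 1 / (real d + real i))"

definition a_R :: "nat \<Rightarrow> nat \<Rightarrow> nat \<Rightarrow> nat \<Rightarrow> real \<Rightarrow> real \<Rightarrow> real" where
  "a_R J d r l b \<eta> =
     1 / real l * (\<Sum>i = r+1..r+l. delta_dev d i b \<eta>)
     + sqrt (1 / (2 * real l) *
         ln (real J * pi ^ 4 * (real r + 1)\<^sup>2 * (real l)\<^sup>2 / (9 * \<eta>)))"

definition a_J :: "nat \<Rightarrow> real" where
  "a_J J = (real J - 1) / 2"

definition kappa_J :: "nat \<Rightarrow> real" where
  "kappa_J J = real J * ln (Gamma (1/2)) - ln (Gamma (real J / 2))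
     + (1 - real J) * ln (2 * pi) / 2"

definition g_J :: "nat \<Rightarrow> nat \<Rightarrow> real" where
  "g_J J n = ln (Gamma (real n + real J / 2)) - real n * ln (real n) + real n
     - a_J J * ln (real n) - (1/2) * ln (2 * pi)"

definition psi :: "nat \<Rightarrow> real" where
  "psi k = (if k = 0 then (1/2) * ln 2 else
     real k * ln (real k) - ln (Gamma (real k + 1/2)) - real k + (1/2) * ln (2 * pi))"

definition Psi :: "nat \<Rightarrow> (nat \<Rightarrow> real) \<Rightarrow> nat \<Rightarrow> nat \<Rightarrow> real" where
  "Psi J p d s = (\<Sum>j = 1..J. psi (bin_count J p s d j))"

definition G_env :: "nat \<Rightarrow> (nat \<Rightarrow> real) \<Rightarrow> nat \<Rightarrow> nat \<Rightarrow> nat \<Rightarrow> real \<Rightarrow> real \<Rightarrow> real" where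
  "G_env J p d s m b \<eta> =
     real m * Phi J (a_R J d 0 m b \<eta>)
     - 2 * real (d - s) * real m / (real (d - s) + real m)
         * (max (V_dev J p d s - real J / 2 * a_R J d 0 m b \<eta>) 0)\<^sup>2
     - a_J J * ln (1 + real m / real (d - s))
     - (g_J J (d - s + m) - g_J J (d - s))
     + Psi J p d s"

definition H_env :: "nat \<Rightarrow> nat \<Rightarrow> nat \<Rightarrow> nat \<Rightarrow> real \<Rightarrow> real \<Rightarrow> real" where
  "H_env J d r m b \<eta> =
     real (m - r) * Phi J (a_R J d r (m - r) b \<eta>)
     - a_J J * ln (real (m - r)) - kappa_J J - g_J J (m - r)"

definition U_env :: "nat \<Rightarrow> (nat \<Rightarrow> real) \<Rightarrow> (nat \<Rightarrow> real) \<Rightarrow> nat \<Rightarrow> nat \<Rightarrow> real \<Rightarrow> real \<Rightarrow> real" where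
  "U_env J \<pi> p d m b \<eta> = ln
     ((\<Sum>s = 0..<d. restart_weight J \<pi> p d s * exp (G_env J p d s m b \<eta>))
      + (\<Sum>r = 0..<m. restart_weight J \<pi> p d (d + r) * exp (H_env J d r m b \<eta>))
      + (\<Sum>s. restart_weight J \<pi> p d (d + m + s)))"

text \<open>The maximum over \<open>1 \<le> m \<le> r\<close> is taken in \<^typ>\<open>ereal\<close>, so that it is \<open>-\<infinity>\<close> for
  \<open>r = 0\<close>; the outer supremum, in \<^typ>\<open>enat\<close>, is \<open>\<infinity>\<close> if the set is unbounded.\<close>

definition safe_horizon :: "(nat \<Rightarrow> real) \<Rightarrow> real \<Rightarrow> enat" where
  "safe_horizon u h = Sup {enat r | r. (SUP m \<in> {1..r}. ereal (u m)) < ereal h}"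

end

theory Submission
  imports Defs
begin

text \<open>
  Write \<open>R\<^sub>t = (\<Sum>s. \<pi> s * KT\<^sub>s(t))\<close> for the mixture. The ratio of \<open>R\<close> at times \<open>d + m\<close> and \<open>d\<close> is the
  average of \<open>KT\<^sub>s(d+m) / KT\<^sub>s(d)\<close> under the restart weights at \<open>d\<close>, and each KT product is a quotient of
  Gamma functions whose logarithm is a relative entropy plus Stirling remainders. The remainder \<open>psi\<close> is
  nonnegative, and the entropy gap between old and new bin counts is controlled by Pinsker's inequality,
  so it suffices that all bin frequencies over all windows \<open>(d+r, d+r+l]\<close> are within \<open>a_R\<close> of \<open>1/J\<close>.

  A p-value falls into a bin exactly when the new observation falls between two empirical quantiles.
  Hence its conditional bin probability differs from \<open>1/J\<close> by at most the oscillation of the empirical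
  error over an interval, which is where the factor 2 in \<open>delta_dev\<close> comes from. Because twice
  \<open>lambda_dev\<close> is allowed for an oscillation, the sharp constant of the
  Dvoretzky--Kiefer--Wolfowitz--Massart inequality is not needed: Hoeffding's inequality and a union bound
  over a grid of \<open>4 k\<close> quantile levels suffice. The fluctuation of the counts around their
  compensators is bounded by an Azuma--Hoeffding inequality, conditionally on the history.

  The strict delay bound also requires the safe horizon to be finite. It is, because the envelope grows
  at least like \<open>ln m\<close>: \<open>m * Phi J (a_R J d 0 m b \<eta>)\<close> dominates \<open>(a_J J + 1) * ln m\<close>.
\<close>

section \<open>Gamma function estimates\<close>

text \<open>Conditioning at the random time \<open>d\<close> reduces to a fixed \<open>n\<close>,
  because the crossing event lies in the history up to \<open>n\<close>. As \<open>n\<close> exceeds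
  the change time, every later observation has law \<open>F1\<close> and is independent of that
  history; the earlier sample, partly pre-change, is never modelled and enters pathwise through the
  empirical deviation \<open>b\<close>. All conditional bounds take the form
  \<open>prob (B \<inter> Bad) \<le> c * prob B\<close> for every \<open>B\<close> in the history,
  which survives union bounds and countable sums without choosing versions of conditional
  probabilities. The numerical constants form a union-bound budget based on the sum
  \<open>pi^2 / 6\<close> of inverse squares. Half of \<eta> pays for the oscillations over all
  sample sizes \<open>k\<close>, at \<open>3 \<eta> / (pi^2 k^2)\<close> each; the other half pays
  for the bin counts over all offsets \<open>r\<close>, lengths \<open>l\<close> and bins
  \<open>j\<close>, at \<open>18 \<eta> / (J pi^4 (r+1)^2 l^2)\<close> each.\<close>

lemma fact_double_Gamma_half:
  "(fact (2 * k) :: real) * sqrt pi = 4 ^ k * fact k * Gamma (real k + 1/2)"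
proof (induction k)
  case 0
  show ?case by (simp add: Gamma_one_half_real)
next
  case (Suc k)
  have "Gamma (real (Suc k) + 1/2) = Gamma ((real k + 1/2) + 1)"
    by (simp add: algebra_simps)
  also have "\<dots> = (real k + 1/2) * Gamma (real k + 1/2)"
    by (rule Gamma_plus1) (auto dest: nonpos_Ints_nonpos)
  finally have G: "Gamma (real (Suc k) + 1/2) = (real k + 1/2) * Gamma (real k + 1/2)" .
  have "fact (2 * Suc k) * sqrt pi = (2 * real k + 2) * (2 * real k + 1) * (fact (2 * k) * sqrt pi)"
    by (simp add: algebra_simps)
  also have "\<dots> = (2 * real k + 2) * (2 * real k + 1) * (4 ^ k * fact k * Gamma (real k + 1/2))"
    by (simp only: Suc.IH)
  also have "\<dots> = 4 ^ Suc k * fact (Suc k) * Gamma (real (Suc k) + 1/2)"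
    unfolding G by (simp add: algebra_simps)
  finally show ?case .
qed

text \<open>The logarithm of \<open>n! * e^n / n^(n + 1/2)\<close>, the ratio whose limit in
  Stirling's formula is \<open>sqrt (2 * pi)\<close>.\<close>

definition stirling_excess :: "nat \<Rightarrow> real" where
  "stirling_excess n = ln (fact n) - (real n + 1/2) * ln (real n) + real n"

lemma stirling_excess_antimono:
  assumes "1 \<le> m" "m \<le> n"
  shows "stirling_excess n \<le> stirling_excess m"
  using assms(2,1)
proof (induction n rule: dec_induct)
  case (step n)
  then have n: "real n > 0" by simp
  \<comment> \<open>One step changes the sequence by \<open>1 - (n + 1/2) * ln (1 + 1/n)\<close>;
    this midpoint bound on the logarithm is exactly what makes the change nonpositive.\<close>
  have "ln (real n + 1) - ln (real n) \<ge> 2 * (real n + 1 - real n) / (real n + (real n + 1))"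
    using n by (intro ln_inverse_approx_ge) auto
  then have "(ln (real n + 1) - ln (real n)) * (real n + 1/2) \<ge> 1"
    using n by (simp add: field_simps)
  moreover have "ln (fact (Suc n) :: real) = ln (real n + 1) + ln (fact n)"
    using n by (simp add: ln_mult add.commute)
  ultimately have "stirling_excess (Suc n) \<le> stirling_excess n"
    by (simp add: stirling_excess_def algebra_simps)
  with step show ?case by simp
qed simp

text \<open>Legendre's duplication formula, in the form \<open>fact_double_Gamma_half\<close>,
  identifies \<open>psi\<close> with the drop of a decreasing sequence; this is the source of its
  sign.\<close>

lemma stirling_excess_double:
  assumes "k \<ge> 1"
  shows "stirling_excess (2 * k) - stirling_excess k = - psi k"
proof -
  have k: "real k > 0" using assms by simp
  have G: "Gamma (real k + 1/2) > 0" by (intro Gamma_real_pos) simp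
  have "ln ((fact (2 * k) :: real) * sqrt pi) = ln (4 ^ k * fact k * Gamma (real k + 1/2))"
    by (simp only: fact_double_Gamma_half)
  then have "ln (fact (2 * k) :: real) + ln pi / 2
      = real k * ln 4 + ln (fact k) + ln (Gamma (real k + 1/2))"
    using G by (simp add: ln_mult ln_sqrt ln_realpow)
  moreover have "ln (4::real) = 2 * ln 2"
    using ln_realpow[of "2::real" 2] by simp
  moreover have "ln (2 * real k) = ln 2 + ln (real k)" "ln (2 * pi) = ln 2 + ln pi"
    using k by (auto simp: ln_mult)
  ultimately show ?thesis
    using assms by (simp add: stirling_excess_def psi_def algebra_simps)
qed

lemma psi_nonneg: "0 \<le> psi k"
proof (cases "k = 0")
  case False
  then have "stirling_excess (2 * k) \<le> stirling_excess k"
    by (intro stirling_excess_antimono) auto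
  with False stirling_excess_double[of k] show ?thesis by simp
qed (simp add: psi_def)

text \<open>Euler's limit \<open>Gamma_series\<close> controls \<open>ln (Gamma (n + J/2))\<close>
  relative to \<open>ln (fact n)\<close>, and the decreasing Stirling excess controls the latter.
  The bound keeps \<open>g_J\<close> from cancelling the logarithmic growth of the envelope.\<close>

lemma g_J_bounded_above:
  assumes "J \<ge> 1"
  obtains C where "\<And>n. n \<ge> 1 \<Longrightarrow> g_J J n \<le> C"
proof -
  define z where "z = real J / 2"
  have z: "z > 0" "z \<notin> \<int>\<^sub>\<le>\<^sub>0" using assms by (auto simp: z_def dest: nonpos_Ints_nonpos)
  have Gz: "Gamma z > 0" using z by (intro Gamma_real_pos)
  have "(\<lambda>n. ln (Gamma_series z n)) \<longlonglongrightarrow> ln (Gamma z)"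
    using Gz by (intro tendsto_ln Gamma_series_LIMSEQ) simp
  then have "Bseq (\<lambda>n. ln (Gamma_series z n))"
    by (intro convergent_imp_Bseq) (auto simp: convergent_def)
  then obtain K where K: "\<And>n. \<bar>ln (Gamma_series z n)\<bar> \<le> K"
    by (auto simp: Bseq_def)
  define C where "C = ln (Gamma z) + K + stirling_excess 1"
  have "g_J J n \<le> C" if n: "n \<ge> 1" for n
  proof -
    have n0: "real n > 0" using n by simp
    have poch: "pochhammer z (Suc n) = Gamma (z + real (Suc n)) / Gamma z"
      by (rule pochhammer_Gamma[OF z(2)])
    have "z + real (Suc n) = (z + real n) + 1" by simp
    moreover have "z + real n \<notin> \<int>\<^sub>\<le>\<^sub>0"
      using z n0 by (auto dest: nonpos_Ints_nonpos)
    ultimately have G1: "Gamma (z + real (Suc n)) = (z + real n) * Gamma (z + real n)"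
      using Gamma_plus1 by metis
    have Gn: "Gamma (z + real n) > 0" using z n0 by (intro Gamma_real_pos) simp
    have "Gamma_series z n = fact n * exp (z * ln (real n)) * Gamma z / ((z + real n) * Gamma (z + real n))"
      using Gz by (simp add: Gamma_series_def poch G1 del: of_nat_Suc)
    then have "ln (Gamma_series z n) = ln (fact n) + z * ln (real n) + ln (Gamma z)
        - ln (z + real n) - ln (Gamma (z + real n))"
      using z n0 less_imp_neq[OF Gz] less_imp_neq[OF Gn] by (simp add: ln_div ln_mult)
    then have "ln (Gamma (z + real n)) \<le> ln (fact n) + z * ln (real n) + ln (Gamma z) - ln (real n) + K"
      using K[of n] ln_le_cancel_iff[of "real n" "z + real n"] z n0 by linarith
    moreover have "stirling_excess n \<le> stirling_excess 1"
      using n by (intro stirling_excess_antimono) auto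
    ultimately have "g_J J n \<le> C - (1/2) * ln (2 * pi)"
      by (simp add: g_J_def a_J_def C_def stirling_excess_def z_def algebra_simps diff_divide_distrib)
    moreover have "0 \<le> ln (2 * pi)" using pi_gt3 by (intro ln_ge_zero) simp
    ultimately show ?thesis by linarith
  qed
  then show ?thesis using that by blast
qed

section \<open>Relative entropy\<close>

text \<open>The difference of the two sides is convex on the positive axis and vanishes together
  with its derivative at 1; convexity comes from \<open>ln (1/x) \<le> 1/x - 1\<close>. This is the
  pointwise inequality behind Pinsker's.\<close>

lemma xlnx_lower_bound:
  fixes x :: real
  assumes "x > 0"
  shows "3 * (x - 1)\<^sup>2 \<le> (2 * x + 4) * (x * ln x - x + 1)"
proof -
  define f where "f x = (2 * x + 4) * (x * ln x - x + 1) - 3 * (x - 1)\<^sup>2" for x :: real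
  define f' where "f' x = 2 * (x * ln x - x + 1) + (2 * x + 4) * ln x - 6 * (x - 1)" for x :: real
  define f'' where "f'' x = 4 * ln x + 4 / x - 4" for x :: real
  have d1: "(f has_real_derivative f' x) (at x)" if "x > 0" for x
    unfolding f_def f'_def using that
    by (auto intro!: derivative_eq_intros simp: algebra_simps power2_eq_square)
  have d2: "(f' has_real_derivative f'' x) (at x)" if "x > 0" for x
    unfolding f''_def f'_def using that
    by (auto intro!: derivative_eq_intros simp: field_simps)
  have "f'' x \<ge> 0" if "x > 0" for x
    using ln_le_minus_one[of "1/x"] that by (simp add: f''_def ln_div field_simps)
  then have "convex_on {0<..} f"
    using d1 d2 by (intro f''_ge0_imp_convex[where f' = f' and f'' = f'']) auto
  then have "f x \<ge> f 1 + f' 1 * (x - 1)"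
    using convex_on_imp_above_tangent[of "{0<..}" f 1 x "f' 1"] assms
      has_field_derivative_at_within[OF d1, of 1 "{0<..}"]
    by (auto simp: algebra_simps interior_open)
  then show ?thesis by (simp add: f_def f'_def)
qed

text \<open>Cauchy--Schwarz with the weights \<open>u\<close>, of total mass 2, against the
  nonnegative entropy integrands \<open>v\<close>, whose corrections \<open>- p + q\<close> cancel
  in the sum. The hypothesis \<open>ac\<close> matters because division by zero yields 0 here, so
  mass of \<open>p\<close> outside the support of \<open>q\<close> would not be charged as
  infinite.\<close>

lemma pinsker:
  fixes p q :: "'a \<Rightarrow> real"
  assumes fin: "finite A"
    and p: "\<And>j. j \<in> A \<Longrightarrow> 0 \<le> p j" "(\<Sum>j\<in>A. p j) = 1"
    and q: "\<And>j. j \<in> A \<Longrightarrow> 0 \<le> q j" "(\<Sum>j\<in>A. q j) = 1"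
    and ac: "\<And>j. j \<in> A \<Longrightarrow> q j = 0 \<Longrightarrow> p j = 0"
  shows "(\<Sum>j\<in>A. \<bar>p j - q j\<bar>)\<^sup>2 \<le> 2 * (\<Sum>j\<in>A. p j * ln (p j / q j))"
proof -
  define u where "u j = (2 * p j + 4 * q j) / 3" for j
  define v where "v j = p j * ln (p j / q j) - p j + q j" for j
  have u0: "0 \<le> u j" if "j \<in> A" for j
    using p(1)[OF that] q(1)[OF that] by (simp add: u_def)
  have key: "(p j - q j)\<^sup>2 \<le> u j * v j \<and> 0 \<le> v j" if j: "j \<in> A" for j
  proof (cases "q j = 0 \<or> p j = 0")
    case True
    then show ?thesis
      using ac[OF j] q(1)[OF j] by (auto simp: u_def v_def power2_eq_square)
  next
    case False
    then have pos: "p j > 0" "q j > 0" using p(1)[OF j] q(1)[OF j] by auto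
    define x where "x = p j / q j"
    have x: "x > 0" "p j = x * q j" using pos by (auto simp: x_def)
    have v: "v j = q j * (x * ln x - x + 1)" using pos by (simp add: v_def x(2) algebra_simps)
    have b: "3 * (x - 1)\<^sup>2 \<le> (2 * x + 4) * (x * ln x - x + 1)" by (rule xlnx_lower_bound[OF x(1)])
    have "0 \<le> (2 * x + 4) * (x * ln x - x + 1)" using b zero_le_power2[of "x - 1"] by linarith
    then have "0 \<le> x * ln x - x + 1" using x(1) by (simp add: zero_le_mult_iff)
    then have "0 \<le> v j" using pos by (simp add: v)
    moreover have "(q j)\<^sup>2 * (3 * (x - 1)\<^sup>2) \<le> (q j)\<^sup>2 * ((2 * x + 4) * (x * ln x - x + 1))"
      by (rule mult_left_mono[OF b]) simp
    moreover have "(q j)\<^sup>2 * (3 * (x - 1)\<^sup>2) = 3 * (p j - q j)\<^sup>2"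
      by (simp add: x(2) power2_eq_square algebra_simps)
    moreover have "(q j)\<^sup>2 * ((2 * x + 4) * (x * ln x - x + 1)) = 3 * (u j * v j)"
      unfolding v u_def x(2) by (simp add: power2_eq_square algebra_simps)
    ultimately show ?thesis by simp
  qed
  have "(\<Sum>j\<in>A. \<bar>p j - q j\<bar>) \<le> (\<Sum>j\<in>A. sqrt (u j) * sqrt (v j))"
    by (intro sum_mono) (use key in \<open>auto simp: real_sqrt_mult[symmetric] intro!: real_le_rsqrt\<close>)
  then have "(\<Sum>j\<in>A. \<bar>p j - q j\<bar>)\<^sup>2 \<le> (\<Sum>j\<in>A. sqrt (u j) * sqrt (v j))\<^sup>2"
    by (intro power_mono) (auto intro: sum_nonneg)
  also have "\<dots> \<le> (\<Sum>j\<in>A. (sqrt (u j))\<^sup>2) * (\<Sum>j\<in>A. (sqrt (v j))\<^sup>2)"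
    by (rule Cauchy_Schwarz_ineq_sum)
  also have "\<dots> = (\<Sum>j\<in>A. u j) * (\<Sum>j\<in>A. v j)"
    using u0 key by simp
  also have "(\<Sum>j\<in>A. u j) = 2"
    using p(2) q(2) by (simp add: u_def sum.distrib sum_divide_distrib[symmetric] sum_distrib_left[symmetric])
  also have "(\<Sum>j\<in>A. v j) = (\<Sum>j\<in>A. p j * ln (p j / q j))"
    using p(2) q(2) by (simp add: v_def sum.distrib sum_subtractf)
  finally show ?thesis .
qed

lemma prob_simplexD:
  assumes "q \<in> prob_simplex J"
  shows "\<And>j. j \<in> {1..J} \<Longrightarrow> 0 \<le> q j" "(\<Sum>j = 1..J. q j) = 1"
    and "\<And>j. j \<in> {1..J} \<Longrightarrow> q j \<le> 1"
proof -
  show *: "\<And>j. j \<in> {1..J} \<Longrightarrow> 0 \<le> q j" "(\<Sum>j = 1..J. q j) = 1"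
    using assms by (auto simp: prob_simplex_def)
  fix j assume "j \<in> {1..J}"
  then have "q j \<le> (\<Sum>j = 1..J. q j)" using * by (intro member_le_sum) auto
  with * show "q j \<le> 1" by simp
qed

lemma uniform_vec_simplex: "J \<ge> 1 \<Longrightarrow> uniform_vec J \<in> prob_simplex J"
  by (simp add: prob_simplex_def uniform_vec_def)

lemma pinsker_TV:
  assumes "p \<in> prob_simplex J" "q \<in> prob_simplex J"
    and "\<And>j. j \<in> {1..J} \<Longrightarrow> q j = 0 \<Longrightarrow> p j = 0"
  shows "2 * (TV J p q)\<^sup>2 \<le> KL J p q"
proof -
  have "(\<Sum>j\<in>{1..J}. \<bar>p j - q j\<bar>)\<^sup>2 \<le> 2 * (\<Sum>j\<in>{1..J}. p j * ln (p j / q j))"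
    by (rule pinsker) (use assms prob_simplexD in auto)
  then show ?thesis by (simp add: TV_def KL_def power_mult_distrib power2_eq_square)
qed

text \<open>This ceiling makes the set in \<open>Phi\<close> bounded above, so that
  \<open>Sup\<close> on the reals is a genuine least upper bound.\<close>

lemma KL_uniform_le:
  assumes "q \<in> prob_simplex J" "J \<ge> 1"
  shows "KL J q (uniform_vec J) \<le> ln (real J)"
proof -
  have "q j * ln (q j / uniform_vec J j) \<le> q j * ln (real J)" if j: "j \<in> {1..J}" for j
  proof (cases "q j = 0")
    case False
    then have "q j > 0" "q j \<le> 1" using prob_simplexD[OF assms(1)] j by force+
    then show ?thesis using assms(2) by (auto simp: uniform_vec_def intro!: mult_left_mono)
  qed simp
  then have "KL J q (uniform_vec J) \<le> (\<Sum>j = 1..J. q j * ln (real J))"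
    unfolding KL_def by (intro sum_mono) auto
  also have "\<dots> = ln (real J)" using prob_simplexD(2)[OF assms(1)] by (simp add: sum_distrib_right[symmetric])
  finally show ?thesis .
qed

lemma KL_le_Phi:
  assumes "q \<in> prob_simplex J" "J \<ge> 1" "sup_dist J q (uniform_vec J) \<le> a"
  shows "KL J q (uniform_vec J) \<le> Phi J a"
  unfolding Phi_def
proof (rule cSup_upper)
  show "bdd_above {KL J q (uniform_vec J) |q. q \<in> prob_simplex J \<and> sup_dist J q (uniform_vec J) \<le> a}"
    using KL_uniform_le[OF _ assms(2)] by (intro bdd_aboveI[of _ "ln (real J)"]) auto
qed (use assms in auto)

lemma sup_dist_le_iff:
  assumes "J \<ge> 1"
  shows "sup_dist J p q \<le> a \<longleftrightarrow> (\<forall>j\<in>{1..J}. \<bar>p j - q j\<bar> \<le> a)"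
  unfolding sup_dist_def using assms by (subst Max_le_iff) auto

text \<open>The set of admissible vectors grows with the radius; \<open>0 \<le> a\<close> keeps the
  smaller set nonempty, with \<open>uniform_vec J\<close> as a member.\<close>

lemma Phi_mono:
  assumes "J \<ge> 1" "0 \<le> a" "a \<le> a'"
  shows "Phi J a \<le> Phi J a'"
  unfolding Phi_def
proof (rule cSup_subset_mono)
  show "bdd_above {KL J q (uniform_vec J) |q. q \<in> prob_simplex J \<and> sup_dist J q (uniform_vec J) \<le> a'}"
    using KL_uniform_le[OF _ assms(1)] by (intro bdd_aboveI[of _ "ln (real J)"]) auto
  have "sup_dist J (uniform_vec J) (uniform_vec J) \<le> a" using assms by (subst sup_dist_le_iff) auto
  then show "{KL J q (uniform_vec J) |q. q \<in> prob_simplex J \<and> sup_dist J q (uniform_vec J) \<le> a} \<noteq> {}"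
    using uniform_vec_simplex[OF assms(1)] by blast
qed (use assms in auto)

lemma TV_triangle: "TV J p r \<le> TV J p q + TV J q r"
proof -
  have "(\<Sum>j = 1..J. \<bar>p j - r j\<bar>) \<le> (\<Sum>j = 1..J. \<bar>p j - q j\<bar> + \<bar>q j - r j\<bar>)"
    by (intro sum_mono) auto
  then show ?thesis by (simp add: TV_def sum.distrib)
qed

lemma TV_uniform_le:
  assumes "J \<ge> 1" "sup_dist J q (uniform_vec J) \<le> a"
  shows "TV J q (uniform_vec J) \<le> real J / 2 * a"
proof -
  have "(\<Sum>j = 1..J. \<bar>q j - uniform_vec J j\<bar>) \<le> (\<Sum>j = 1..J. a)"
    by (intro sum_mono) (use assms in \<open>auto simp: sup_dist_le_iff\<close>)
  then show ?thesis by (simp add: TV_def)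
qed

text \<open>Jensen--Shannon decomposition: the entropy gap of a mixture is a sum of two relative
  entropies with respect to the mixture, to each of which Pinsker's inequality applies.\<close>

lemma KL_mixture:
  fixes n m :: real
  assumes J: "J \<ge> 1" and n: "n > 0" and m: "m > 0"
    and p: "p \<in> prob_simplex J" and q: "q \<in> prob_simplex J"
    and r: "\<And>j. r j = (n * p j + m * q j) / (n + m)"
  shows "(n + m) * KL J r (uniform_vec J) + 2 * n * m / (n + m) * (TV J p q)\<^sup>2
    \<le> n * KL J p (uniform_vec J) + m * KL J q (uniform_vec J)"
proof -
  note pD = prob_simplexD[OF p] and qD = prob_simplexD[OF q]
  have r0: "0 \<le> r j" if "j \<in> {1..J}" for j
    using pD(1)[OF that] qD(1)[OF that] n m by (simp add: r)
  have "(\<Sum>j = 1..J. r j) = (n * (\<Sum>j = 1..J. p j) + m * (\<Sum>j = 1..J. q j)) / (n + m)"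
    by (simp add: r sum.distrib sum_divide_distrib[symmetric] sum_distrib_left)
  then have r1: "r \<in> prob_simplex J"
    using r0 pD(2) qD(2) n m by (auto simp: prob_simplex_def)
  have ac: "p j = 0 \<and> q j = 0" if "r j = 0" "j \<in> {1..J}" for j
  proof -
    have "n * p j + m * q j = 0" using that n m by (simp add: r)
    moreover have "0 \<le> n * p j" "0 \<le> m * q j" using pD(1)[OF that(2)] qD(1)[OF that(2)] n m by auto
    ultimately have "n * p j = 0" "m * q j = 0" by linarith+
    with n m show ?thesis by auto
  qed
  \<comment> \<open>Chain rule through the mixture \<open>r\<close>; the case \<open>x = 0\<close>
    covers the bins where \<open>r j\<close> vanishes.\<close>
  have split: "x * ln (x / uniform_vec J j) = x * ln (x / r j) + x * ln (r j * real J)"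
    if "j \<in> {1..J}" "0 \<le> x" "r j = 0 \<Longrightarrow> x = 0" for x j
  proof (cases "x = 0")
    case False
    then have "r j \<noteq> 0" "x > 0" using that by auto
    moreover have "r j \<ge> 0" by (rule r0[OF that(1)])
    ultimately have "r j > 0" "x > 0" by auto
    then show ?thesis using J by (simp add: uniform_vec_def ln_mult ln_div algebra_simps)
  qed simp
  have P: "KL J p (uniform_vec J) = KL J p r + (\<Sum>j = 1..J. p j * ln (r j * real J))"
    unfolding KL_def sum.distrib[symmetric]
    by (rule sum.cong[OF refl], rule split) (use pD ac in auto)
  have Q: "KL J q (uniform_vec J) = KL J q r + (\<Sum>j = 1..J. q j * ln (r j * real J))"
    unfolding KL_def sum.distrib[symmetric]
    by (rule sum.cong[OF refl], rule split) (use qD ac in auto)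
  \<comment> \<open>The cross terms left over in \<open>P\<close> and \<open>Q\<close> average
    exactly to the entropy of \<open>r\<close>, so they drop out of the final comparison.\<close>
  have R: "(n + m) * KL J r (uniform_vec J) = n * (\<Sum>j = 1..J. p j * ln (r j * real J))
      + m * (\<Sum>j = 1..J. q j * ln (r j * real J))"
  proof -
    have nm: "(n + m) * r j = n * p j + m * q j" for j using n m by (simp add: r)
    have "(n + m) * KL J r (uniform_vec J) = (\<Sum>j = 1..J. ((n + m) * r j) * ln (r j * real J))"
      by (simp add: KL_def uniform_vec_def sum_distrib_left mult.assoc)
    also have "\<dots> = (\<Sum>j = 1..J. n * (p j * ln (r j * real J)) + m * (q j * ln (r j * real J)))"
      by (simp only: nm) (simp add: algebra_simps)
    finally show ?thesis by (simp add: sum.distrib sum_distrib_left)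
  qed
  have TVp: "TV J p r = m / (n + m) * TV J p q"
  proof -
    have "\<bar>p j - r j\<bar> = m / (n + m) * \<bar>p j - q j\<bar>" for j
    proof -
      have "p j - r j = m / (n + m) * (p j - q j)" using n m by (simp add: r field_simps)
      then show ?thesis using n m by (simp add: abs_mult)
    qed
    then show ?thesis by (simp add: TV_def sum_distrib_left algebra_simps)
  qed
  have TVq: "TV J q r = n / (n + m) * TV J p q"
  proof -
    have "\<bar>q j - r j\<bar> = n / (n + m) * \<bar>p j - q j\<bar>" for j
    proof -
      have "q j - r j = n / (n + m) * (q j - p j)" using n m by (simp add: r field_simps)
      then show ?thesis using n m by (simp add: abs_mult abs_minus_commute)
    qed
    then show ?thesis by (simp add: TV_def sum_distrib_left algebra_simps)
  qed
  have "n * (2 * (TV J p r)\<^sup>2) + m * (2 * (TV J q r)\<^sup>2) \<le> n * KL J p r + m * KL J q r"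
    using n m pinsker_TV[OF p r1] pinsker_TV[OF q r1] ac
    by (intro add_mono mult_left_mono) auto
  moreover have "n * (2 * (TV J p r)\<^sup>2) + m * (2 * (TV J q r)\<^sup>2) = 2 * n * m / (n + m) * (TV J p q)\<^sup>2"
  proof -
    \<comment> \<open>\<open>n * m^2 + m * n^2 = n * m * (n + m)\<close>, which leaves a single
      factor \<open>n + m\<close> in the denominator.\<close>
    have "n * (2 * (m / (n + m) * x)\<^sup>2) + m * (2 * (n / (n + m) * x)\<^sup>2)
        = 2 * n * m * (n + m) / ((n + m) * (n + m)) * x\<^sup>2" for x :: real
      by (simp add: power2_eq_square algebra_simps add_divide_distrib)
    moreover have "2 * n * m * (n + m) / ((n + m) * (n + m)) = 2 * n * m / (n + m)"
      using n m by (intro mult_divide_mult_cancel_right) simp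
    ultimately show ?thesis unfolding TVp TVq by simp
  qed
  ultimately show ?thesis unfolding R P Q by (simp add: algebra_simps)
qed

section \<open>The KT process\<close>

lemma bin_unique:
  assumes "i \<in> {1..J}" "x \<in> bin J i" "j \<in> {1..J}" "x \<in> bin J j"
  shows "i = j"
proof -
  \<comment> \<open>A one-sided comparison of bin numbers; applied in both orders it forces
    equality. The closed right end of bin \<open>J\<close> is harmless because no bin has a larger
    number.\<close>
  have *: "real i - 1 < real j" if "i \<in> {1..J} \<and> x \<in> bin J i" "j \<in> {1..J} \<and> x \<in> bin J j" for i j
  proof -
    have J: "real J > 0" using that by auto
    have "(real i - 1) / real J \<le> x" using that by (auto simp: bin_def split: if_splits)
    then have "real i - 1 \<le> x * real J" using J by (simp add: pos_divide_le_eq)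
    moreover have "x < real j / real J \<or> j = J"
      using that by (auto simp: bin_def split: if_splits)
    then have "x * real J < real j \<or> j = J" using J by (simp add: pos_less_divide_eq)
    ultimately show ?thesis using that by (cases "j = J") auto
  qed
  show ?thesis using *[of i j] *[of j i] assms by simp
qed

lemma bin_borel [measurable]: "bin J j \<in> sets borel"
  by (simp add: bin_def)

lemma ex1_bin:
  assumes J: "J \<ge> 1" and x: "0 \<le> x" "x \<le> 1"
  shows "\<exists>!j. j \<in> {1..J} \<and> x \<in> bin J j"
proof (rule ex_ex1I)
  have J0: "real J > 0" using J by simp
  show "\<exists>j. j \<in> {1..J} \<and> x \<in> bin J j"
  proof (cases "x = 1")
    case True
    then show ?thesis using J by (intro exI[of _ J]) (auto simp: bin_def field_simps)
  next
    case False
    \<comment> \<open>\<open>k\<close> is the number of bins lying entirely to the left of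
      \<open>x\<close>, so the bin sought has number \<open>k + 1\<close>. The point 1 is treated
      apart because only the last bin contains its right end.\<close>
    define k where "k = nat \<lfloor>x * real J\<rfloor>"
    have k: "real k \<le> x * real J" "x * real J < real k + 1"
      using x J0 unfolding k_def by (auto simp: of_nat_nat)
    have "x * real J < 1 * real J" using False x J0 by (intro mult_strict_right_mono) auto
    with k(1) have "k < J" by simp
    moreover have "x \<in> bin J (Suc k)"
      using k x J0 by (auto simp: bin_def field_simps)
    ultimately show ?thesis by (intro exI[of _ "Suc k"]) auto
  qed
next
  fix i j assume "i \<in> {1..J} \<and> x \<in> bin J i" "j \<in> {1..J} \<and> x \<in> bin J j"
  then show "i = j" using bin_unique by blast
qed

lemma bin_index:
  assumes "J \<ge> 1" "0 \<le> x" "x \<le> 1"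
  shows "bin_index J x \<in> {1..J}" "x \<in> bin J (bin_index J x)"
  using theI'[OF ex1_bin[OF assms]] by (auto simp: bin_index_def)

lemma mem_bin_iff:
  assumes "J \<ge> 1" "0 \<le> x" "x \<le> 1" "j \<in> {1..J}"
  shows "x \<in> bin J j \<longleftrightarrow> j = bin_index J x"
  using ex1_bin[OF assms(1-3)] bin_index[OF assms(1-3)] assms(4) by blast

text \<open>The zero-based sum is the form in which the counts meet the martingale sums
  \<open>mart_sum\<close>.\<close>

lemma bin_count_sum_indicator:
  "real (bin_count J p s (s + m) j) = (\<Sum>i<m. indicator (bin J j) (p (s + i + 1)))"
proof -
  have "bin_count J p s (s + m) j = card {i\<in>{..<m}. p (s + i + 1) \<in> bin J j}"
    unfolding bin_count_def
  proof (rule bij_betw_same_card[symmetric])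
    show "bij_betw (\<lambda>i. s + i + 1) {i \<in> {..<m}. p (s + i + 1) \<in> bin J j} {i \<in> {s + 1..s + m}. p i \<in> bin J j}"
      by (rule bij_betw_byWitness[where f' = "\<lambda>i. i - s - 1"]) auto
  qed
  also have "real \<dots> = (\<Sum>i\<in>{i\<in>{..<m}. p (s + i + 1) \<in> bin J j}. 1)" by simp
  also have "\<dots> = (\<Sum>i<m. indicator (bin J j) (p (s + i + 1)))"
    by (intro sum.mono_neutral_cong_left) (auto simp: indicator_def)
  finally show ?thesis .
qed

lemma bin_count_add:
  "bin_count J p s (s + m + k) j = bin_count J p s (s + m) j + bin_count J p (s + m) (s + m + k) j"
proof -
  have "{i \<in> {s+1..s+m+k}. p i \<in> bin J j}
      = {i \<in> {s+1..s+m}. p i \<in> bin J j} \<union> {i \<in> {s+m+1..s+m+k}. p i \<in> bin J j}" by auto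
  then show ?thesis unfolding bin_count_def by (simp, subst card_Un_disjoint) auto
qed

lemma bin_count_same [simp]: "bin_count J p s s j = 0"
  by (simp add: bin_count_def)

lemma bin_count_Suc:
  assumes "J \<ge> 1" "0 \<le> p (s + m + 1)" "p (s + m + 1) \<le> 1" "j \<in> {1..J}"
  shows "bin_count J p s (s + m + 1) j
    = bin_count J p s (s + m) j + (if j = bin_index J (p (s + m + 1)) then 1 else 0)"
proof -
  have "real (bin_count J p (s + m) (s + m + 1) j) = (if j = bin_index J (p (s + m + 1)) then 1 else 0)"
    using mem_bin_iff[OF assms] bin_count_sum_indicator[of J p "s + m" 1 j] by (simp add: indicator_def)
  then have "bin_count J p (s + m) (s + m + 1) j = (if j = bin_index J (p (s + m + 1)) then 1 else 0)"
    by (cases "j = bin_index J (p (s + m + 1))") auto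
  then show ?thesis using bin_count_add[of J p s m 1 j] by simp
qed

lemma sum_bin_count:
  assumes "J \<ge> 1" "\<And>i. i \<in> {s+1..s+m} \<Longrightarrow> 0 \<le> p i \<and> p i \<le> 1"
  shows "(\<Sum>j = 1..J. bin_count J p s (s + m) j) = m"
  using assms(2)
proof (induction m)
  case (Suc m)
  have p: "0 \<le> p (s + m + 1)" "p (s + m + 1) \<le> 1" using Suc.prems[of "s + m + 1"] by auto
  have "(\<Sum>j = 1..J. bin_count J p s (s + Suc m) j)
      = (\<Sum>j = 1..J. bin_count J p s (s + m) j + (if j = bin_index J (p (s + m + 1)) then 1 else 0))"
    using bin_count_Suc[of J p s m, OF assms(1) p] by (intro sum.cong) auto
  also have "\<dots> = m + 1"
    using Suc bin_index[OF assms(1) p] by (simp add: sum.distrib)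
  finally show ?case by simp
qed simp

lemma KT_pos: "J \<ge> 1 \<Longrightarrow> KT J p s t > 0"
  unfolding KT_def by (auto intro!: prod_pos mult_pos_pos divide_pos_pos add_nonneg_pos)

lemma KT_Suc:
  "KT J p s (s + m + 1) = KT J p s (s + m) * (real J *
     ((real (bin_count J p s (s + m) (bin_index J (p (s + m + 1)))) + 1/2) / (real m + real J / 2)))"
proof -
  have "{s+1..s+m+1} = insert (s + m + 1) {s+1..s+m}" by auto
  then show ?thesis by (cases "m = 0") (auto simp: KT_def)
qed

text \<open>By \<open>Gamma (x + 1) = x * Gamma x\<close>, numerator and denominator of every factor
  are ratios of consecutive Gamma values, one for the bin that is hit and one for the total, so the
  product telescopes.\<close>

lemma KT_Gamma:
  assumes J: "J \<ge> 1" and p: "\<And>i. i \<in> {s+1..s+m} \<Longrightarrow> 0 \<le> p i \<and> p i \<le> 1"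
  shows "ln (KT J p s (s + m)) = real m * ln (real J) + ln (Gamma (real J / 2))
    - real J * ln (Gamma (1/2)) + (\<Sum>j = 1..J. ln (Gamma (real (bin_count J p s (s + m) j) + 1/2)))
    - ln (Gamma (real m + real J / 2))"
  using p
proof (induction m)
  case 0
  then show ?case by (simp add: KT_def)
next
  case (Suc m)
  define k where "k = bin_index J (p (s + m + 1))"
  let ?N = "\<lambda>j. bin_count J p s (s + m) j"
  have p: "0 \<le> p (s + m + 1)" "p (s + m + 1) \<le> 1" using Suc.prems[of "s + m + 1"] by auto
  have k: "k \<in> {1..J}" using bin_index[OF J p] by (simp add: k_def)
  have lnG: "ln (Gamma (x + 1)) = ln x + ln (Gamma x)" if "x > 0" for x :: real
  proof -
    have "Gamma (x + 1) = x * Gamma x"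
      by (rule Gamma_plus1) (use that in \<open>auto dest: nonpos_Ints_nonpos\<close>)
    then show ?thesis using that less_imp_neq[OF Gamma_real_pos[OF that]] by (simp add: ln_mult)
  qed
  have "ln (Gamma (real (bin_count J p s (s + m + 1) j) + 1/2))
      = ln (Gamma (real (?N j) + 1/2)) + (if j = k then ln (real (?N j) + 1/2) else 0)"
    if "j \<in> {1..J}" for j
    using bin_count_Suc[of J p s m, OF J p that] lnG[of "real (?N j) + 1/2"] by (auto simp: k_def algebra_simps)
  then have S: "(\<Sum>j = 1..J. ln (Gamma (real (bin_count J p s (s + m + 1) j) + 1/2)))
      = (\<Sum>j = 1..J. ln (Gamma (real (?N j) + 1/2))) + ln (real (?N k) + 1/2)"
    using k by (simp add: sum.distrib)
  have "ln (Gamma (real (m + 1) + real J / 2)) = ln (real m + real J / 2) + ln (Gamma (real m + real J / 2))"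
    using lnG[of "real m + real J / 2"] J by (simp add: algebra_simps)
  moreover have "ln (KT J p s (s + m + 1)) = ln (KT J p s (s + m)) + (ln (real J)
      + (ln (real (?N k) + 1/2) - ln (real m + real J / 2)))"
    unfolding KT_Suc k_def[symmetric] using J KT_pos[OF J, of p s "s + m"]
    by (subst ln_mult ln_div, simp add: add_nonneg_pos)+
  ultimately show ?case using Suc.IH Suc.prems S by (simp add: algebra_simps)
qed

lemma theta_hat_simplex:
  assumes "J \<ge> 1" "m \<ge> 1" "\<And>i. i \<in> {s+1..s+m} \<Longrightarrow> 0 \<le> p i \<and> p i \<le> 1"
  shows "theta_hat J p (s + m) s \<in> prob_simplex J"
proof -
  have "(\<Sum>j = 1..J. theta_hat J p (s + m) s j) = real (\<Sum>j = 1..J. bin_count J p s (s + m) j) / real m"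
    by (simp add: theta_hat_def sum_divide_distrib)
  also have "\<dots> = 1" using assms(2) by (simp only: sum_bin_count[OF assms(1,3)]) simp
  finally show ?thesis by (auto simp: prob_simplex_def theta_hat_def)
qed

lemma ln_KT:
  assumes J: "J \<ge> 1" and m: "m \<ge> 1" and p: "\<And>i. i \<in> {s+1..s+m} \<Longrightarrow> 0 \<le> p i \<and> p i \<le> 1"
  shows "ln (KT J p s (s + m)) = real m * KL J (theta_hat J p (s + m) s) (uniform_vec J)
    - a_J J * ln (real m) - kappa_J J - g_J J m - Psi J p (s + m) s"
proof -
  let ?N = "\<lambda>j. real (bin_count J p s (s + m) j)"
  have N: "(\<Sum>j = 1..J. ?N j) = real m"
    using sum_bin_count[OF J p] by (simp flip: of_nat_sum)
  have m0: "real m > 0" using m by simp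
  have "real m * KL J (theta_hat J p (s + m) s) (uniform_vec J)
      = (\<Sum>j = 1..J. ?N j * ln (?N j) - ?N j * ln (real m) + ?N j * ln (real J))"
    unfolding KL_def sum_distrib_left
  proof (rule sum.cong[OF refl])
    fix j
    show "real m * (theta_hat J p (s + m) s j * ln (theta_hat J p (s + m) s j / uniform_vec J j))
      = ?N j * ln (?N j) - ?N j * ln (real m) + ?N j * ln (real J)"
      using m0 J by (cases "?N j = 0")
        (auto simp: theta_hat_def uniform_vec_def ln_mult ln_div algebra_simps)
  qed
  also have "\<dots> = (\<Sum>j = 1..J. ?N j * ln (?N j)) - real m * ln (real m) + real m * ln (real J)"
    unfolding sum.distrib sum_subtractf sum_distrib_right[symmetric] N ..
  finally have 1: "real m * KL J (theta_hat J p (s + m) s) (uniform_vec J) = \<dots>" .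
  \<comment> \<open>The value \<open>psi 0 = ln 2 / 2\<close> makes the expansion exact for empty
    bins too, as \<open>Gamma (1/2) = sqrt pi\<close>.\<close>
  have "ln (Gamma (real k + 1/2)) = real k * ln (real k) - real k + ln (2 * pi) / 2 - psi k" for k
    using ln_mult[of 2 pi] by (cases "k = 0") (auto simp: psi_def Gamma_one_half_real ln_sqrt field_simps)
  then have "(\<Sum>j = 1..J. ln (Gamma (?N j + 1/2)))
      = (\<Sum>j = 1..J. ?N j * ln (?N j)) - real m + real J * (ln (2 * pi) / 2) - Psi J p (s + m) s"
    using N by (simp add: sum.distrib sum_subtractf Psi_def)
  moreover have "ln (KT J p s (s + m)) = real m * ln (real J) + ln (Gamma (real J / 2))
    - real J * ln (Gamma (1/2)) + (\<Sum>j = 1..J. ln (Gamma (?N j + 1/2)))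
    - ln (Gamma (real m + real J / 2))"
    by (rule KT_Gamma[OF J p])
  moreover have "kappa_J J + g_J J m + a_J J * ln (real m) = real J * ln (Gamma (1/2))
    - ln (Gamma (real J / 2)) - real J * (ln (2 * pi) / 2) + ln (Gamma (real m + real J / 2))
    - real m * ln (real m) + real m"
    by (simp add: kappa_J_def g_J_def algebra_simps diff_divide_distrib)
  ultimately show ?thesis using 1 by linarith
qed

lemma Psi_nonneg: "0 \<le> Psi J p d s"
  unfolding Psi_def by (intro sum_nonneg psi_nonneg)

text \<open>A restart at \<open>d + r\<close> has seen no data from before \<open>d\<close>, so its
  whole entropy is bounded by \<open>Phi\<close>. The Stirling remainder \<open>Psi\<close> at the
  end of the window has the favourable sign and is dropped.\<close>

lemma KT_le_H_env:
  assumes J: "J \<ge> 1" and r: "r < m" and p: "\<And>i. i \<in> {d+r+1..d+m} \<Longrightarrow> 0 \<le> p i \<and> p i \<le> 1"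
    and dev: "\<And>j. j \<in> {1..J} \<Longrightarrow>
      \<bar>theta_hat J p (d + m) (d + r) j - 1 / real J\<bar> \<le> a_R J d r (m - r) b \<eta>"
  shows "KT J p (d + r) (d + m) \<le> exp (H_env J d r m b \<eta>)"
proof -
  let ?q = "theta_hat J p (d + m) (d + r)"
  have e: "d + m = (d + r) + (m - r)" using r by simp
  have q: "?q \<in> prob_simplex J" unfolding e by (rule theta_hat_simplex) (use J r p in auto)
  have "KL J ?q (uniform_vec J) \<le> Phi J (a_R J d r (m - r) b \<eta>)"
    by (rule KL_le_Phi[OF q J]) (use J dev in \<open>auto simp: sup_dist_le_iff uniform_vec_def\<close>)
  then have "real (m - r) * KL J ?q (uniform_vec J) \<le> real (m - r) * Phi J (a_R J d r (m - r) b \<eta>)"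
    by (rule mult_left_mono) simp
  moreover have "ln (KT J p (d + r) (d + m)) = real (m - r) * KL J ?q (uniform_vec J)
    - a_J J * ln (real (m - r)) - kappa_J J - g_J J (m - r) - Psi J p (d + m) (d + r)"
    unfolding e by (subst ln_KT) (use J r p in auto)
  ultimately have "ln (KT J p (d + r) (d + m)) \<le> H_env J d r m b \<eta>"
    using Psi_nonneg[of J p "d + m" "d + r"] by (simp add: H_env_def)
  then show ?thesis using KT_pos[OF J] by (metis exp_le_cancel_iff exp_ln)
qed

text \<open>A restart before \<open>d\<close> pools \<open>n\<close> old observations with
  \<open>m\<close> new ones. \<open>KL_mixture\<close> bounds the pooled entropy; the old entropy
  cancels against \<open>ln (KT J p s d)\<close>, and the Jensen--Shannon loss becomes the squared
  term. \<open>Psi\<close> at \<open>d\<close> enters with a positive sign and stays,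
  \<open>Psi\<close> at \<open>d + m\<close> is dropped.\<close>

lemma KT_le_G_env:
  assumes J: "J \<ge> 1" and s: "s < d" and m: "m \<ge> 1"
    and p: "\<And>i. i \<in> {s+1..d+m} \<Longrightarrow> 0 \<le> p i \<and> p i \<le> 1"
    and dev: "\<And>j. j \<in> {1..J} \<Longrightarrow> \<bar>theta_hat J p (d + m) d j - 1 / real J\<bar> \<le> a_R J d 0 m b \<eta>"
  shows "KT J p s (d + m) \<le> KT J p s d * exp (G_env J p d s m b \<eta>)"
proof -
  define n where "n = d - s"
  define a where "a = a_R J d 0 m b \<eta>"
  have d: "d = s + n" and n: "n \<ge> 1" using s by (auto simp: n_def)
  let ?x = "theta_hat J p d s" and ?y = "theta_hat J p (d + m) d" and ?z = "theta_hat J p (d + m) s"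
  have x: "?x \<in> prob_simplex J" unfolding d by (rule theta_hat_simplex) (use J n p d in auto)
  have y: "?y \<in> prob_simplex J" by (rule theta_hat_simplex) (use J m p s in auto)
  have z: "?z j = (real n * ?x j + real m * ?y j) / (real n + real m)" for j
    using n m by (simp add: theta_hat_def d bin_count_add add.assoc[symmetric])
  have sd: "sup_dist J ?y (uniform_vec J) \<le> a"
    using J dev by (auto simp: sup_dist_le_iff uniform_vec_def a_def)
  have Phi: "real m * KL J ?y (uniform_vec J) \<le> real m * Phi J a"
    by (intro mult_left_mono KL_le_Phi[OF y J sd]) simp
  \<comment> \<open>The new frequencies are close to uniform, so old ones at distance
    \<open>V_dev\<close> from uniform must be nearly as far from the new ones.\<close>
  have "V_dev J p d s - real J / 2 * a \<le> TV J ?x ?y"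
    using TV_triangle[of J ?x "uniform_vec J" ?y] TV_uniform_le[OF J sd] by (simp add: V_dev_def)
  moreover have "0 \<le> TV J ?x ?y" by (simp add: TV_def sum_nonneg)
  ultimately have "(max (V_dev J p d s - real J / 2 * a) 0)\<^sup>2 \<le> (TV J ?x ?y)\<^sup>2"
    by (intro power_mono) auto
  then have "2 * real n * real m / (real n + real m) * (max (V_dev J p d s - real J / 2 * a) 0)\<^sup>2
      \<le> 2 * real n * real m / (real n + real m) * (TV J ?x ?y)\<^sup>2"
    by (intro mult_left_mono) auto
  moreover have "(real n + real m) * KL J ?z (uniform_vec J)
      + 2 * real n * real m / (real n + real m) * (TV J ?x ?y)\<^sup>2
      \<le> real n * KL J ?x (uniform_vec J) + real m * KL J ?y (uniform_vec J)"
    by (rule KL_mixture[OF J _ _ x y z]) (use n m in auto)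
  moreover have "ln (KT J p s d) = real n * KL J ?x (uniform_vec J)
    - a_J J * ln (real n) - kappa_J J - g_J J n - Psi J p d s"
    unfolding d by (rule ln_KT) (use J n p d in auto)
  moreover have "ln (KT J p s (d + m)) = (real n + real m) * KL J ?z (uniform_vec J)
    - a_J J * ln (real (n + m)) - kappa_J J - g_J J (n + m) - Psi J p (d + m) s"
    unfolding d add.assoc by (subst ln_KT) (use J n p d in auto)
  moreover have "ln (1 + real m / real n) = ln (real (n + m)) - ln (real n)"
  proof -
    have "1 + real m / real n = real (n + m) / real n" using n by (simp add: field_simps)
    then show ?thesis using n by (simp add: ln_div)
  qed
  ultimately have "ln (KT J p s (d + m)) \<le> ln (KT J p s d) + G_env J p d s m b \<eta>"
    using Phi Psi_nonneg[of J p "d + m" s]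
    by (simp add: G_env_def n_def[symmetric] a_def[symmetric] right_diff_distrib)
  then have "exp (ln (KT J p s (d + m))) \<le> exp (ln (KT J p s d) + G_env J p d s m b \<eta>)" by simp
  then show ?thesis using KT_pos[OF J] by (simp add: exp_add)
qed

section \<open>The restart mixture\<close>

text \<open>The argument of \<open>ln\<close> in \<open>U_env\<close>, isolated so that single
  summands can be compared with it before taking logarithms.\<close>

definition U_sum :: "nat \<Rightarrow> (nat \<Rightarrow> real) \<Rightarrow> (nat \<Rightarrow> real) \<Rightarrow> nat \<Rightarrow> nat \<Rightarrow> real \<Rightarrow> real \<Rightarrow> real" where
  "U_sum J \<pi> p d m b \<eta> = (\<Sum>s = 0..<d. restart_weight J \<pi> p d s * exp (G_env J p d s m b \<eta>))
      + (\<Sum>r = 0..<m. restart_weight J \<pi> p d (d + r) * exp (H_env J d r m b \<eta>))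
      + (\<Sum>s. restart_weight J \<pi> p d (d + m + s))"

context
  fixes J :: nat and \<pi> :: "nat \<Rightarrow> real"
  assumes J: "J \<ge> 1" and prior: "\<And>s. \<pi> s \<ge> 0" "\<pi> sums 1"
begin

text \<open>Restarts with \<open>s \<ge> t\<close> have \<open>KT = 1\<close>, so from
  \<open>t\<close> on the series agrees with the prior.\<close>

lemma summable_restart: "summable (\<lambda>s. \<pi> s * KT J p s t)"
proof (rule summable_comparison_test_ev[OF _ sums_summable[OF prior(2)]])
  show "\<forall>\<^sub>F s in sequentially. norm (\<pi> s * KT J p s t) \<le> \<pi> s"
    using eventually_ge_at_top[of t] by eventually_elim (simp add: KT_def prior(1))
qed

lemma ex_prior_pos: "\<exists>s. \<pi> s > 0"
proof (rule ccontr)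
  assume "\<not> ?thesis"
  then have "\<pi> = (\<lambda>_. 0)" using prior(1) by (auto simp: fun_eq_iff intro: antisym simp: not_less)
  with prior(2) show False using sums_unique by fastforce
qed

lemma restart_mix_pos: "restart_mix J \<pi> p t > 0"
proof -
  obtain s where "\<pi> s > 0" using ex_prior_pos by blast
  then show ?thesis
    unfolding restart_mix_def using prior(1) KT_pos[OF J] summable_restart
    by (intro suminf_pos2[of _ s]) (auto intro!: mult_nonneg_nonneg less_imp_le[OF KT_pos[OF J]])
qed

lemma restart_weight_nonneg: "restart_weight J \<pi> p d s \<ge> 0"
  unfolding restart_weight_def using prior(1) KT_pos[OF J] restart_mix_pos
  by (simp add: less_imp_le)

lemma restart_weight_pos: "\<pi> s > 0 \<Longrightarrow> restart_weight J \<pi> p d s > 0"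
  unfolding restart_weight_def using KT_pos[OF J] restart_mix_pos by simp

lemma summable_restart_weight: "summable (restart_weight J \<pi> p d)"
  unfolding restart_weight_def by (intro summable_divide summable_restart)

lemma suminf_restart_weight_tail_nonneg: "0 \<le> (\<Sum>s. restart_weight J \<pi> p d (k + s))"
  using summable_ignore_initial_segment[OF summable_restart_weight, of p d k] restart_weight_nonneg
  by (intro suminf_nonneg) (auto simp: add.commute)

lemma U_sum_ge_G:
  assumes "s < d"
  shows "restart_weight J \<pi> p d s * exp (G_env J p d s m b \<eta>) \<le> U_sum J \<pi> p d m b \<eta>"
proof -
  have "restart_weight J \<pi> p d s * exp (G_env J p d s m b \<eta>)
      \<le> (\<Sum>s = 0..<d. restart_weight J \<pi> p d s * exp (G_env J p d s m b \<eta>))"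
    using assms restart_weight_nonneg by (intro member_le_sum) auto
  moreover have "0 \<le> (\<Sum>r = 0..<m. restart_weight J \<pi> p d (d + r) * exp (H_env J d r m b \<eta>))"
    using restart_weight_nonneg by (intro sum_nonneg) auto
  ultimately show ?thesis
    using suminf_restart_weight_tail_nonneg[of p d "d + m"] by (simp add: U_sum_def)
qed

lemma U_sum_ge_H:
  assumes "r < m"
  shows "restart_weight J \<pi> p d (d + r) * exp (H_env J d r m b \<eta>) \<le> U_sum J \<pi> p d m b \<eta>"
proof -
  have "restart_weight J \<pi> p d (d + r) * exp (H_env J d r m b \<eta>)
      \<le> (\<Sum>r = 0..<m. restart_weight J \<pi> p d (d + r) * exp (H_env J d r m b \<eta>))"
    using assms restart_weight_nonneg
    by (intro member_le_sum[of r _ "\<lambda>r. restart_weight J \<pi> p d (d + r) * exp (H_env J d r m b \<eta>)"]) auto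
  moreover have "0 \<le> (\<Sum>s = 0..<d. restart_weight J \<pi> p d s * exp (G_env J p d s m b \<eta>))"
    using restart_weight_nonneg by (intro sum_nonneg) auto
  ultimately show ?thesis
    using suminf_restart_weight_tail_nonneg[of p d "d + m"] by (simp add: U_sum_def)
qed

text \<open>After division by the mixture at \<open>d\<close>, the mixture at \<open>d + m\<close>
  is an average of KT ratios under the restart weights. It splits at \<open>s = d\<close> and
  \<open>s = d + m\<close> into old restarts, restarts inside the window and restarts still to come.
  Only windows ending at \<open>d + m\<close> enter, whence the constraint
  \<open>r + l = m\<close>.\<close>

lemma log_mix_increment_le:
  assumes m: "m \<ge> 1" and p: "\<And>i. i \<in> {1..d+m} \<Longrightarrow> 0 \<le> p i \<and> p i \<le> 1"
    and dev: "\<And>r l j. l \<ge> 1 \<Longrightarrow> r + l = m \<Longrightarrow> j \<in> {1..J} \<Longrightarrow>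
      \<bar>theta_hat J p (d + r + l) (d + r) j - 1 / real J\<bar> \<le> a_R J d r l b \<eta>"
  shows "log_mix J \<pi> p (d + m) - log_mix J \<pi> p d \<le> U_env J \<pi> p d m b \<eta>"
proof -
  define R where "R = restart_mix J \<pi> p d"
  have R: "R > 0" unfolding R_def by (rule restart_mix_pos)
  let ?f = "\<lambda>s. \<pi> s * KT J p s (d + m) / R"
  have sf: "summable ?f" by (intro summable_divide summable_restart)
  have "restart_mix J \<pi> p (d + m) / R = suminf ?f"
    unfolding restart_mix_def by (rule suminf_divide[symmetric, OF summable_restart])
  also have "\<dots> = (\<Sum>s. ?f (s + (d + m))) + (\<Sum>s<d+m. ?f s)"
    by (rule suminf_split_initial_segment[OF sf])
  also have "(\<Sum>s<d+m. ?f s) = (\<Sum>s = 0..<d. ?f s) + (\<Sum>r = 0..<m. ?f (d + r))"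
    using sum.atLeastLessThan_concat[of 0 d "d + m" ?f] sum.shift_bounds_nat_ivl[of ?f 0 d m]
    by (simp add: lessThan_atLeast0 add.commute)
  \<comment> \<open>For these restarts KT equals 1 both at \<open>d\<close> and at
    \<open>d + m\<close>.\<close>
  also have "(\<Sum>s. ?f (s + (d + m))) = (\<Sum>s. restart_weight J \<pi> p d (d + m + s))"
    by (simp add: restart_weight_def R_def KT_def add_ac)
  also have "(\<Sum>s = 0..<d. ?f s) \<le> (\<Sum>s = 0..<d. restart_weight J \<pi> p d s * exp (G_env J p d s m b \<eta>))"
  proof (rule sum_mono)
    fix s assume s: "s \<in> {0..<d}"
    have "KT J p s (d + m) \<le> KT J p s d * exp (G_env J p d s m b \<eta>)"
      by (rule KT_le_G_env) (use J m p s dev[of m 0] in auto)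
    then have "\<pi> s * KT J p s (d + m) \<le> \<pi> s * (KT J p s d * exp (G_env J p d s m b \<eta>))"
      by (intro mult_left_mono prior(1))
    then show "?f s \<le> restart_weight J \<pi> p d s * exp (G_env J p d s m b \<eta>)"
      using R by (simp add: restart_weight_def R_def[symmetric] field_simps)
  qed
  also have "(\<Sum>r = 0..<m. ?f (d + r))
      \<le> (\<Sum>r = 0..<m. restart_weight J \<pi> p d (d + r) * exp (H_env J d r m b \<eta>))"
  proof (rule sum_mono)
    fix r assume r: "r \<in> {0..<m}"
    have "KT J p (d + r) (d + m) \<le> exp (H_env J d r m b \<eta>)"
      by (rule KT_le_H_env) (use J p r dev[of "m - r" r] in auto)
    then have "\<pi> (d + r) * KT J p (d + r) (d + m) \<le> \<pi> (d + r) * exp (H_env J d r m b \<eta>)"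
      by (intro mult_left_mono prior(1))
    \<comment> \<open>\<open>KT J p (d + r) d = 1\<close>, so the restart weight is just
      \<open>\<pi> (d + r)\<close> divided by the mixture.\<close>
    then show "?f (d + r) \<le> restart_weight J \<pi> p d (d + r) * exp (H_env J d r m b \<eta>)"
      using R by (simp add: restart_weight_def R_def[symmetric] KT_def[of J p "d + r" d] field_simps)
  qed
  finally have "restart_mix J \<pi> p (d + m) / R \<le> U_sum J \<pi> p d m b \<eta>" by (simp add: U_sum_def)
  then have "ln (restart_mix J \<pi> p (d + m) / R) \<le> ln (U_sum J \<pi> p d m b \<eta>)"
    using R restart_mix_pos[of p "d + m"] by (intro ln_mono) auto
  then show ?thesis
    using less_imp_neq[OF restart_mix_pos[of p d]] less_imp_neq[OF restart_mix_pos[of p "d + m"]]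
    by (simp add: log_mix_def U_env_def U_sum_def R_def ln_div)
qed

end

section \<open>Finiteness of the safe horizon\<close>

text \<open>Adding \<open>a\<close> to \<open>K = J div 2\<close> bins and removing it from
  \<open>K\<close> others gives an admissible vector at total variation distance
  \<open>K * a\<close> from uniform; Pinsker does the rest. The bound \<open>a \<le> 1 / J\<close>
  keeps the reduced masses nonnegative, and for odd \<open>J\<close> the last bin is left
  alone.\<close>

lemma Phi_ge_quadratic:
  assumes J: "J \<ge> 2" and a: "0 \<le> a" "a \<le> 1 / real J"
  shows "2 * (real (J div 2))\<^sup>2 * a\<^sup>2 \<le> Phi J a"
proof -
  define K where "K = J div 2"
  have K: "2 * K \<le> J" by (simp add: K_def)
  define e where "e j = (if j \<in> {1..K} then a else 0) - (if j \<in> {K+1..2*K} then a else 0)" for j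
  define q where "q j = 1 / real J + e j" for j
  have sum_if: "(\<Sum>j\<in>A. if j \<in> B then a else 0) = real (card B) * a"
    if "finite A" "B \<subseteq> A" for A B :: "nat set"
    using sum.inter_restrict[OF that(1), of "\<lambda>_. a" B] that(2) by (simp add: Int_absorb1)
  have s: "(\<Sum>j\<in>{1..J}. if j \<in> {1..K} then a else 0) = real K * a"
    "(\<Sum>j\<in>{1..J}. if j \<in> {K+1..2*K} then a else 0) = real K * a"
    by (subst sum_if; use K in auto)+
  have e0: "(\<Sum>j = 1..J. e j) = 0" unfolding e_def sum_subtractf s by simp
  have "(\<Sum>j = 1..J. \<bar>e j\<bar>)
      = (\<Sum>j\<in>{1..J}. (if j \<in> {1..K} then a else 0) + (if j \<in> {K+1..2*K} then a else 0))"
    using a by (intro sum.cong) (auto simp: e_def)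
  then have e1: "(\<Sum>j = 1..J. \<bar>e j\<bar>) = 2 * real K * a" unfolding sum.distrib s by simp
  have q: "q \<in> prob_simplex J"
    using a e0 J by (auto simp: prob_simplex_def q_def sum.distrib e_def)
  have "sup_dist J q (uniform_vec J) \<le> a"
    using J a by (subst sup_dist_le_iff) (auto simp: q_def uniform_vec_def e_def)
  then have "KL J q (uniform_vec J) \<le> Phi J a"
    using J by (intro KL_le_Phi[OF q]) auto
  moreover have "2 * (TV J q (uniform_vec J))\<^sup>2 \<le> KL J q (uniform_vec J)"
    using J by (intro pinsker_TV[OF q uniform_vec_simplex]) (auto simp: uniform_vec_def)
  moreover have "TV J q (uniform_vec J) = real K * a"
    by (simp only: TV_def q_def uniform_vec_def add_diff_cancel_left' e1)
  ultimately show ?thesis by (simp add: K_def power_mult_distrib)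
qed

lemma lambda_dev_nonneg:
  assumes "0 < \<eta>" "\<eta> < 1"
  shows "0 \<le> lambda_dev k \<eta>"
proof (cases "k = 0")
  case False
  have "(3::real) \<le> 2 * 9" by simp
  also have "9 \<le> pi\<^sup>2" using pi_gt3 power_mono[of 3 pi 2] by simp
  finally have "3 \<le> 2 * pi\<^sup>2" by simp
  moreover have "1 \<le> (real k)\<^sup>2" using False by (simp add: one_le_power)
  ultimately have "3 * 1 \<le> 2 * pi\<^sup>2 * (real k)\<^sup>2" by (intro mult_mono) auto
  then have "1 \<le> 2 * pi\<^sup>2 * (real k)\<^sup>2 / (3 * \<eta>)"
    using assms by (simp add: field_simps)
  then show ?thesis using False by (simp add: lambda_dev_def ln_ge_zero)
qed (simp add: lambda_dev_def)

lemma delta_dev_nonneg: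
  assumes "0 < \<eta>" "\<eta> < 1" "0 \<le> b" "i \<ge> 1"
  shows "0 \<le> delta_dev d i b \<eta>"
  unfolding delta_dev_def using assms lambda_dev_nonneg
  by (intro mult_nonneg_nonneg add_nonneg_nonneg divide_nonneg_nonneg) auto

text \<open>The square-root term alone is enough:
  \<open>J * pi^4 * (r+1)^2 \<ge> 9 \<ge> 9 * \<eta>\<close>, so the logarithm in it is at least
  \<open>2 * ln l\<close>, while the averaged \<open>delta_dev\<close> is nonnegative.\<close>

lemma a_R_ge:
  assumes "0 < \<eta>" "\<eta> < 1" "0 \<le> b" "l \<ge> 1" "J \<ge> 1"
  shows "sqrt (ln (real l) / real l) \<le> a_R J d r l b \<eta>"
proof -
  have "(9::real) \<le> 3 ^ 4" by simp
  also have "\<dots> \<le> pi ^ 4" using pi_gt3 by (intro power_mono) auto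
  finally have "1 * 9 * 1 \<le> real J * pi ^ 4 * (real r + 1)\<^sup>2"
    using assms by (intro mult_mono) (auto simp: one_le_power)
  then have "(real l)\<^sup>2 * (9 * 1) \<le> (real l)\<^sup>2 * (real J * pi ^ 4 * (real r + 1)\<^sup>2)"
    by (intro mult_left_mono) auto
  moreover have "(real l)\<^sup>2 * (9 * \<eta>) \<le> (real l)\<^sup>2 * (9 * 1)"
    using assms by (intro mult_left_mono) auto
  ultimately have "(real l)\<^sup>2 \<le> real J * pi ^ 4 * (real r + 1)\<^sup>2 * (real l)\<^sup>2 / (9 * \<eta>)"
    using assms by (subst pos_le_divide_eq) (auto simp: mult_ac)
  then have "ln ((real l)\<^sup>2) \<le> ln (real J * pi ^ 4 * (real r + 1)\<^sup>2 * (real l)\<^sup>2 / (9 * \<eta>))"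
    using assms by (intro ln_mono) auto
  then have "1 / (2 * real l) * (2 * ln (real l))
      \<le> 1 / (2 * real l) * ln (real J * pi ^ 4 * (real r + 1)\<^sup>2 * (real l)\<^sup>2 / (9 * \<eta>))"
    using assms by (intro mult_left_mono) (auto simp: ln_realpow)
  then have "sqrt (ln (real l) / real l)
      \<le> sqrt (1 / (2 * real l) * ln (real J * pi ^ 4 * (real r + 1)\<^sup>2 * (real l)\<^sup>2 / (9 * \<eta>)))"
    by (intro real_sqrt_le_mono) (simp add: field_simps)
  moreover have "0 \<le> (\<Sum>i = r+1..r+l. delta_dev d i b \<eta>)"
    using assms by (intro sum_nonneg delta_dev_nonneg) auto
  ultimately show ?thesis unfolding a_R_def
    by (smt (verit) divide_nonneg_nonneg mult_nonneg_nonneg of_nat_0_le_iff)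
qed

lemma a_R_nonneg:
  assumes "0 < \<eta>" "\<eta> < 1" "0 \<le> b" "l \<ge> 1" "J \<ge> 1"
  shows "0 \<le> a_R J d r l b \<eta>"
proof -
  have "0 \<le> sqrt (ln (real l) / real l)" using assms by (simp add: ln_ge_zero)
  also note a_R_ge[OF assms, of d r]
  finally show ?thesis .
qed

text \<open>With \<open>K = J div 2\<close>, the quadratic bound at radius
  \<open>sqrt (ln l / l)\<close> gives \<open>2 * K^2 * ln l\<close>, and
  \<open>2 * K^2 \<ge> a_J J + 1\<close>, with equality at \<open>J = 3\<close>. Passing from
  \<open>a_R\<close> to this smaller radius by \<open>Phi_mono\<close> is what makes
  \<open>Phi_ge_quadratic\<close> applicable, since that is limited to radii up to
  \<open>1 / J\<close>.\<close>

lemma eventually_Phi_a_R_ge: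
  assumes J: "J \<ge> 2" and "0 < \<eta>" "\<eta> < 1" "0 \<le> b"
  shows "\<forall>\<^sub>F l in sequentially. (a_J J + 1) * ln (real l) \<le> real l * Phi J (a_R J d r l b \<eta>)"
proof -
  have "((\<lambda>l::nat. sqrt (ln (real l) / real l)) \<longlongrightarrow> sqrt 0) sequentially"
    by (intro tendsto_real_sqrt lim_ln_over_n)
  then have "\<forall>\<^sub>F l in sequentially. sqrt (ln (real l) / real l) < 1 / real J"
    by (rule order_tendstoD) (use J in auto)
  with eventually_ge_at_top[of 1] show ?thesis
  proof eventually_elim
    case (elim l)
    define e where "e = sqrt (ln (real l) / real l)"
    define K where "K = real (J div 2)"
    have l: "real l > 0" "ln (real l) \<ge> 0" using elim by (auto simp: ln_ge_zero)
    have e: "0 \<le> e" "e\<^sup>2 = ln (real l) / real l" using l by (auto simp: e_def)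
    have "2 * K\<^sup>2 * e\<^sup>2 \<le> Phi J e"
      unfolding K_def using J e elim by (intro Phi_ge_quadratic) (auto simp: e_def)
    also have "\<dots> \<le> Phi J (a_R J d r l b \<eta>)"
      using assms elim e a_R_ge[of \<eta> b l J d r] by (intro Phi_mono) (auto simp: e_def)
    finally have "real l * (2 * K\<^sup>2 * e\<^sup>2) \<le> real l * Phi J (a_R J d r l b \<eta>)"
      using l by (intro mult_left_mono) auto
    moreover have "real l * (2 * K\<^sup>2 * e\<^sup>2) = 2 * K\<^sup>2 * ln (real l)"
      using l unfolding e by simp
    moreover have "(a_J J + 1) * ln (real l) \<le> 2 * K\<^sup>2 * ln (real l)"
    proof (rule mult_right_mono)
      have "J \<le> 2 * (J div 2) + 1" by presburger
      then have "real J \<le> 2 * K + 1" unfolding K_def by linarith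
      moreover have "1 \<le> J div 2" using J by presburger
      then have "1 \<le> K" unfolding K_def by simp
      moreover have "K \<le> K\<^sup>2" using \<open>1 \<le> K\<close> by (simp add: power2_eq_square)
      ultimately show "a_J J + 1 \<le> 2 * K\<^sup>2" by (simp add: a_J_def field_simps)
    qed (use l in simp)
    ultimately show ?case by linarith
  qed
qed

text \<open>Of the \<open>(a_J J + 1) * ln l\<close> supplied by \<open>Phi\<close>, the part
  \<open>a_J J * ln l\<close> is spent and one logarithm survives.\<close>

lemma H_env_ge_ln:
  assumes J: "J \<ge> 2" and "0 < \<eta>" "\<eta> < 1" "0 \<le> b"
  obtains c where "\<forall>\<^sub>F l in sequentially. ln (real l) - c \<le> H_env J d r (r + l) b \<eta>"
proof -
  obtain C where C: "\<And>n. n \<ge> 1 \<Longrightarrow> g_J J n \<le> C" using g_J_bounded_above[of J] J by auto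
  have "\<forall>\<^sub>F l in sequentially. ln (real l) - (kappa_J J + C) \<le> H_env J d r (r + l) b \<eta>"
    using eventually_Phi_a_R_ge[OF assms, of d r] eventually_ge_at_top[of 1]
  proof eventually_elim
    case (elim l)
    then show ?case using C[of l] by (simp add: H_env_def algebra_simps)
  qed
  then show ?thesis using that by blast
qed

lemma G_env_ge_ln:
  assumes J: "J \<ge> 2" and "0 < \<eta>" "\<eta> < 1" "0 \<le> b" and s: "s < d"
  obtains c where "\<forall>\<^sub>F m in sequentially. ln (real m) - c \<le> G_env J p d s m b \<eta>"
proof -
  obtain C where C: "\<And>n. n \<ge> 1 \<Longrightarrow> g_J J n \<le> C" using g_J_bounded_above[of J] J by auto
  define n where "n = d - s"
  have n: "n \<ge> 1" using s by (simp add: n_def)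
  define V where "V = V_dev J p d s"
  have V: "V \<ge> 0" by (simp add: V_def V_dev_def TV_def sum_nonneg)
  define c where "c = 2 * real n * V\<^sup>2 + a_J J * ln 2 + C - g_J J n"
  have aJ: "a_J J \<ge> 0" using J by (simp add: a_J_def)
  have "\<forall>\<^sub>F m in sequentially. ln (real m) - c \<le> G_env J p d s m b \<eta>"
    using eventually_Phi_a_R_ge[OF assms(1-4), of d 0] eventually_ge_at_top[of 1]
  proof eventually_elim
    case (elim m)
    define W where "W = max (V - real J / 2 * a_R J d 0 m b \<eta>) 0"
    have m: "m \<ge> 1" using elim by simp
    have "W \<le> V" "W \<ge> 0"
      using V a_R_nonneg[of \<eta> b m J d 0] assms m by (auto simp: W_def)
    then have "W\<^sup>2 \<le> V\<^sup>2" by (intro power_mono) auto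
    \<comment> \<open>The penalty factor saturates at \<open>2 * n\<close> as \<open>m\<close>
      grows, so it costs only a constant.\<close>
    moreover have "2 * real n * real m / (real n + real m) \<le> 2 * real n"
      using n m by (simp add: field_simps)
    ultimately have "2 * real n * real m / (real n + real m) * W\<^sup>2 \<le> 2 * real n * V\<^sup>2"
      by (intro mult_mono) auto
    moreover have "a_J J * ln (1 + real m / real n) \<le> a_J J * (ln 2 + ln (real m))"
    proof (rule mult_left_mono[OF _ aJ])
      have "real m / real n \<le> real m" using n divide_left_mono[of 1 "real n" "real m"] by simp
      then have "ln (1 + real m / real n) \<le> ln (2 * real m)"
        using n m by (intro ln_mono) (auto intro: add_pos_nonneg)
      then show "ln (1 + real m / real n) \<le> ln 2 + ln (real m)" using m by (simp add: ln_mult)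
    qed
    moreover have "g_J J (n + m) \<le> C" using m by (intro C) simp
    ultimately show ?case using elim Psi_nonneg[of J p d s]
      unfolding G_env_def n_def[symmetric] V_def[symmetric] W_def[symmetric] c_def
      by (simp add: algebra_simps)
  qed
  then show ?thesis using that by blast
qed

text \<open>A single restart with positive prior weight forces the growth: its summand lies in the
  \<open>G_env\<close> or the \<open>H_env\<close> part of \<open>U_sum\<close> according to whether
  it precedes \<open>d\<close>. A restart beyond the current window enters the second part once
  \<open>m\<close> is large.\<close>

lemma U_env_unbounded:
  fixes c :: real
  assumes J: "J \<ge> 2" and prior: "\<And>s. \<pi> s \<ge> 0" "\<pi> sums 1"
    and "0 < \<eta>" "\<eta> < 1" "0 \<le> b"
  obtains m where "m \<ge> 1" "c \<le> U_env J \<pi> p d m b \<eta>"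
proof -
  have J1: "J \<ge> 1" using J by simp
  note prior' = J1 prior
  obtain s where s: "\<pi> s > 0" using ex_prior_pos[OF prior'] by blast
  define w where "w = restart_weight J \<pi> p d s"
  have w: "w > 0" unfolding w_def by (rule restart_weight_pos[OF prior' s])
  have grow: "\<forall>\<^sub>F l in sequentially. exp c \<le> w * exp (f l)"
    if "\<forall>\<^sub>F l in sequentially. ln (real l) - c0 \<le> f l" for f :: "nat \<Rightarrow> real" and c0
  proof -
    have "\<forall>\<^sub>F l in sequentially. exp c * exp c0 / w \<le> real l"
      using filterlim_real_sequentially unfolding filterlim_at_top by blast
    with that eventually_ge_at_top[of 1] show ?thesis
    proof eventually_elim
      case (elim l)
      have "exp c \<le> w * (real l / exp c0)" using elim w by (simp add: field_simps)
      also have "real l / exp c0 = exp (ln (real l) - c0)" using elim by (simp add: exp_diff)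
      also have "w * \<dots> \<le> w * exp (f l)" using w elim by (intro mult_left_mono) auto
      finally show ?case .
    qed
  qed
  have "\<exists>m\<ge>1. exp c \<le> U_sum J \<pi> p d m b \<eta>"
  proof (cases "s < d")
    case True
    obtain c0 where "\<forall>\<^sub>F m in sequentially. ln (real m) - c0 \<le> G_env J p d s m b \<eta>"
      using G_env_ge_ln[OF J assms(4-6) True] by blast
    from eventually_conj[OF grow[OF this] eventually_ge_at_top[of 1]]
    obtain m where "m \<ge> 1" "exp c \<le> w * exp (G_env J p d s m b \<eta>)"
      by (auto dest: eventually_happens)
    then show ?thesis using U_sum_ge_G[OF prior' True, of p m b \<eta>] by (auto simp: w_def intro!: exI[of _ m])
  next
    case False
    define r where "r = s - d"
    have sr: "s = d + r" using False by (simp add: r_def)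
    obtain c0 where "\<forall>\<^sub>F l in sequentially. ln (real l) - c0 \<le> H_env J d r (r + l) b \<eta>"
      using H_env_ge_ln[OF J assms(4-6)] by blast
    from eventually_conj[OF grow[OF this] eventually_ge_at_top[of 1]]
    obtain l where "l \<ge> 1" "exp c \<le> w * exp (H_env J d r (r + l) b \<eta>)"
      by (auto dest: eventually_happens)
    then show ?thesis using U_sum_ge_H[OF prior', of r "r + l" p d b \<eta>]
      by (auto simp: w_def sr intro!: exI[of _ "r + l"])
  qed
  then obtain m where m: "m \<ge> 1" "exp c \<le> U_sum J \<pi> p d m b \<eta>" by blast
  have "ln (exp c) \<le> ln (U_sum J \<pi> p d m b \<eta>)" using m by (intro ln_mono) auto
  then have "c \<le> U_env J \<pi> p d m b \<eta>" by (simp add: U_env_def U_sum_def)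
  with m that show ?thesis by blast
qed

section \<open>Crossing times and the safe horizon\<close>

text \<open>A strict lower bound on the crossing time becomes a finite condition on the path up to
  \<open>n\<close>, which can be checked step by step and is measurable over the history at
  \<open>n\<close>.\<close>

lemma crossing_time_gt_iff:
  "enat n < crossing_time \<tau> M B \<longleftrightarrow> (\<forall>t. \<tau> + 1 \<le> t \<and> t \<le> n \<longrightarrow> M t \<le> B t)"
proof -
  have "enat n < crossing_time \<tau> M B \<longleftrightarrow> enat (Suc n) \<le> crossing_time \<tau> M B"
    using Suc_ile_eq by (metis eSuc_enat ileI1 order_less_le_trans)
  also have "\<dots> \<longleftrightarrow> (\<forall>t. t \<ge> \<tau> + 1 \<and> M t > B t \<longrightarrow> Suc n \<le> t)"
    by (auto simp: crossing_time_def le_Inf_iff)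
  also have "\<dots> \<longleftrightarrow> (\<forall>t. \<tau> + 1 \<le> t \<and> t \<le> n \<longrightarrow> M t \<le> B t)"
    by (meson not_less not_less_eq_eq)
  finally show ?thesis .
qed

text \<open>An infinite horizon could not be exceeded strictly. A point where \<open>u\<close>
  reaches \<open>h\<close> bounds the set of admissible \<open>r\<close>, so its supremum is a
  maximum and the third hypothesis applies to it.\<close>

lemma safe_horizon_less:
  assumes "n < D" "\<exists>m\<ge>1. h \<le> u m"
    and "\<And>r. (\<And>m. 1 \<le> m \<Longrightarrow> m \<le> r \<Longrightarrow> u m < h) \<Longrightarrow> enat (n + r) < D"
  shows "safe_horizon u h < D - enat n"
proof -
  define S where "S = {r. (SUP m \<in> {1..r}. ereal (u m)) < ereal h}"
  have S: "u m < h" if "r \<in> S" "1 \<le> m" "m \<le> r" for r m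
  proof -
    have "ereal (u m) \<le> (SUP m \<in> {1..r}. ereal (u m))" using that by (intro SUP_upper) auto
    also have "\<dots> < ereal h" using that by (simp add: S_def)
    finally show ?thesis by simp
  qed
  obtain m0 where m0: "m0 \<ge> 1" "h \<le> u m0" using assms(2) by blast
  have "r < m0" if "r \<in> S" for r using S[OF that m0(1)] m0(2) by (cases "r < m0") auto
  then have fin: "finite S" by (intro finite_subset[of S "{..<m0}"]) auto
  \<comment> \<open>The supremum over the empty range is \<open>-\<infinity>\<close>, so 0 always
    belongs to \<open>S\<close>.\<close>
  have ne: "S \<noteq> {}" by (auto simp: S_def bot_ereal_def intro!: exI[of _ 0])
  have "safe_horizon u h = Sup (enat ` S)"
    unfolding safe_horizon_def S_def by (rule arg_cong[of _ _ Sup]) auto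
  also have "\<dots> = enat (Max S)"
  proof (rule antisym)
    show "Sup (enat ` S) \<le> enat (Max S)" using fin by (intro Sup_least) auto
    show "enat (Max S) \<le> Sup (enat ` S)" using Max_in[OF fin ne] by (intro Sup_upper) auto
  qed
  finally have eq: "safe_horizon u h = enat (Max S)" .
  have "enat (n + Max S) < D" using S[OF Max_in[OF fin ne]] by (intro assms(3)) auto
  \<comment> \<open>An infinite \<open>D\<close> is harmless, since
    \<open>\<infinity> - enat n\<close> is again \<open>\<infinity>\<close>.\<close>
  then show ?thesis unfolding eq by (cases D) auto
qed

section \<open>Conditioning on the history\<close>

text \<open>The test set is the part of \<open>E\<close> where the conditional probability falls
  below \<open>c\<close>; were it not null, averaging over it would contradict \<open>le\<close>.
  Conditional claims thereby reduce to unconditional inequalities over history events.\<close>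

lemma (in prob_space) cond_prob_given_ge:
  assumes sub: "subalgebra M H" and A: "A \<in> events" and E: "E \<in> sets H"
    and le: "\<And>B. B \<in> sets H \<Longrightarrow> B \<subseteq> E \<Longrightarrow> c * prob B \<le> prob (A \<inter> B)"
  shows "AE \<omega> in M. \<omega> \<in> E \<longrightarrow> c \<le> cond_prob_given M H A \<omega>"
proof -
  interpret finite_measure_subalgebra M H
    by (unfold_locales) (rule sub)
  define f where "f = real_cond_exp M H (indicator A)"
  have fH [measurable]: "f \<in> borel_measurable H" unfolding f_def by simp
  have fM: "f \<in> borel_measurable M" by (rule measurable_from_subalg[OF sub fH])
  have sp: "space H = space M" using sub by (simp add: subalgebra_def)
  define B where "B = {\<omega> \<in> space H. \<omega> \<in> E \<and> f \<omega> < c}"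
  have BH: "B \<in> sets H" unfolding B_def using E by measurable
  then have BM [measurable]: "B \<in> events" using sub by (auto simp: subalgebra_def)
  have iA: "integrable M (indicator A :: _ \<Rightarrow> real)" using A by (simp add: emeasure_eq_measure)
  have if': "integrable M f" unfolding f_def by (rule real_cond_exp_int[OF iA])
  have iB: "integrable M (\<lambda>\<omega>. indicator B \<omega> * f \<omega>)"
    using integrable_mult_indicator[OF BM if'] by simp
  have "(\<integral>\<omega>. indicator B \<omega> * f \<omega> \<partial>M) = (\<integral>\<omega>. indicator B \<omega> * indicator A \<omega> \<partial>M)"
    using real_cond_exp_intA[OF iA BH] by (simp add: set_lebesgue_integral_def f_def)
  also have "\<dots> = prob (A \<inter> B)"
    using A BM by (simp add: indicator_inter_arith[symmetric] Int_commute)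
  finally have "(\<integral>\<omega>. indicator B \<omega> * f \<omega> \<partial>M) = prob (A \<inter> B)" .
  moreover have "c * prob B \<le> prob (A \<inter> B)" by (rule le[OF BH]) (auto simp: B_def)
  moreover have "(\<integral>\<omega>. indicator B \<omega> * (c - f \<omega>) \<partial>M) = c * prob B - (\<integral>\<omega>. indicator B \<omega> * f \<omega> \<partial>M)"
    using iB BM by (simp add: right_diff_distrib emeasure_eq_measure mult.commute)
  ultimately have le0: "(\<integral>\<omega>. indicator B \<omega> * (c - f \<omega>) \<partial>M) \<le> 0" by simp
  have int: "integrable M (\<lambda>\<omega>. indicator B \<omega> * (c - f \<omega>))"
    using iB BM by (simp add: right_diff_distrib emeasure_eq_measure)
  have nn: "AE \<omega> in M. 0 \<le> indicator B \<omega> * (c - f \<omega>)"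
    by (auto simp: B_def indicator_def)
  have "(\<integral>\<omega>. indicator B \<omega> * (c - f \<omega>) \<partial>M) = 0"
    using le0 integral_nonneg_AE[OF nn] by linarith
  then have "AE \<omega> in M. indicator B \<omega> * (c - f \<omega>) = 0"
    using integral_nonneg_eq_0_iff_AE[OF int nn] by simp
  with AE_space show ?thesis
    by eventually_elim (auto simp: B_def indicator_def sp cond_prob_given_def f_def not_less split: if_splits)
qed

section \<open>The law of the next observation given the history\<close>

context change_point_model
begin

abbreviation "hist \<equiv> history M X U"

abbreviation "obs t \<omega> \<equiv> (U t \<omega>, X t \<omega>)"

text \<open>The law of a post-change pair. The randomiser is the first coordinate so that an
  iterated integral fixes it while the observation varies.\<close>

definition obs_law :: "(real \<times> real) measure" where
  "obs_law = uniform_measure lborel {0<..<1} \<Otimes>\<^sub>M F1"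

lemma case_sum_measurable: "i \<in> {1..} <+> {1..} \<Longrightarrow> case_sum X U i \<in> borel_measurable M"
  using independent unfolding indep_vars_def2 by blast

lemma X_measurable: "1 \<le> t \<Longrightarrow> X t \<in> borel_measurable M"
  using case_sum_measurable[OF InlI, of t] by simp

lemma U_measurable: "1 \<le> t \<Longrightarrow> U t \<in> borel_measurable M"
  using case_sum_measurable[OF InrI, of t] by simp

lemma space_hist [simp]: "space (hist n) = space M"
  by (simp add: history_def space_measure_of_conv)

lemma sets_hist: "sets (hist n) = sigma_sets (space M)
   ({X i -` A \<inter> space M | i A. i \<in> {1..n} \<and> A \<in> sets borel} \<union>
    {U i -` A \<inter> space M | i A. i \<in> {1..n} \<and> A \<in> sets borel})"
  unfolding history_def by (rule sets_measure_of) auto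

lemma X_hist: "1 \<le> i \<Longrightarrow> i \<le> n \<Longrightarrow> X i \<in> borel_measurable (hist n)"
  by (rule measurableI) (auto simp: sets_hist intro!: sigma_sets.Basic)

lemma U_hist: "1 \<le> i \<Longrightarrow> i \<le> n \<Longrightarrow> U i \<in> borel_measurable (hist n)"
  by (rule measurableI) (auto simp: sets_hist intro!: sigma_sets.Basic)

lemma sets_hist_subset:
  assumes "\<And>i. i \<in> {1..n} \<Longrightarrow> X i \<in> borel_measurable N" "\<And>i. i \<in> {1..n} \<Longrightarrow> U i \<in> borel_measurable N"
    and "space N = space M"
  shows "sets (hist n) \<subseteq> sets N"
  unfolding sets_hist assms(3)[symmetric]
proof (rule sets.sigma_sets_subset)
  show "{X i -` A \<inter> space N | i A. i \<in> {1..n} \<and> A \<in> sets borel} \<union>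
    {U i -` A \<inter> space N | i A. i \<in> {1..n} \<and> A \<in> sets borel} \<subseteq> sets N"
    using measurable_sets[OF assms(1)] measurable_sets[OF assms(2)] by blast
qed

lemma subalgebra_hist: "subalgebra M (hist n)"
  using sets_hist_subset[of n M] X_measurable U_measurable by (auto simp: subalgebra_def)

lemma subalgebra_hist_mono: "n \<le> m \<Longrightarrow> subalgebra (hist m) (hist n)"
  using sets_hist_subset[of n "hist m"] X_hist[of _ m] U_hist[of _ m] by (auto simp: subalgebra_def)

lemma obs_measurable: "1 \<le> t \<Longrightarrow> obs t \<in> measurable M (borel \<Otimes>\<^sub>M borel)"
  using X_measurable U_measurable by (intro measurable_Pair) auto

lemma obs_hist: "1 \<le> t \<Longrightarrow> t \<le> n \<Longrightarrow> obs t \<in> measurable (hist n) (borel \<Otimes>\<^sub>M borel)"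
  using X_hist U_hist by (intro measurable_Pair) auto

lemma prob_space_F1: "prob_space F1"
  using F1_distribution by (simp add: real_distribution_def)

lemma sets_F1 [simp, measurable_cong]: "sets F1 = sets borel"
  using F1_distribution by (simp add: real_distribution_def real_distribution_axioms_def)

lemma prob_space_unif: "prob_space (uniform_measure lborel {0<..<1::real})"
  by (rule prob_space_uniform_measure) auto

lemma prob_space_obs_law: "prob_space obs_law"
proof -
  interpret F: prob_space F1 by (rule prob_space_F1)
  interpret U: prob_space "uniform_measure lborel {0<..<1::real}" by (rule prob_space_unif)
  interpret pair_prob_space "uniform_measure lborel {0<..<1::real}" F1 ..
  show ?thesis unfolding obs_law_def by unfold_locales
qed

lemma sets_obs_law [simp, measurable_cong]: "sets obs_law = sets (borel \<Otimes>\<^sub>M borel)"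
  unfolding obs_law_def by (rule sets_pair_measure_cong) auto

lemma space_obs_law [simp]: "space obs_law = UNIV"
  using sets_eq_imp_space_eq[OF sets_obs_law] by (simp add: space_pair_measure)

lemma distr_obs:
  assumes "\<tau> < t"
  shows "distr M (borel \<Otimes>\<^sub>M borel) (obs t) = obs_law"
proof -
  have t: "1 \<le> t" using assms by simp
  have "indep_var (PiM {Inr t} (\<lambda>_. borel)) (\<lambda>\<omega>. restrict (\<lambda>i. case_sum X U i \<omega>) {Inr t})
      (PiM {Inl t} (\<lambda>_. borel)) (\<lambda>\<omega>. restrict (\<lambda>i. case_sum X U i \<omega>) {Inl t})"
    by (rule indep_var_restrict[OF independent]) (use t in auto)
  then have "indep_var borel ((\<lambda>f. f (Inr t)) \<circ> (\<lambda>\<omega>. restrict (\<lambda>i. case_sum X U i \<omega>) {Inr t}))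
      borel ((\<lambda>f. f (Inl t)) \<circ> (\<lambda>\<omega>. restrict (\<lambda>i. case_sum X U i \<omega>) {Inl t}))"
    by (rule indep_var_compose) auto
  then have "indep_var borel (U t) borel (X t)" by (simp add: comp_def)
  then show ?thesis
    using U_uniform[OF t] post_change[OF assms] by (simp add: indep_var_distribution_eq obs_law_def)
qed

text \<open>The indices are grouped into past and next; sigma-algebras generated by disjoint groups
  of independent variables are independent, which separates the next pair from the whole history at
  once.\<close>

lemma prob_hist_obs:
  assumes A: "A \<in> sets (hist n)" and C: "C \<in> sets (borel \<Otimes>\<^sub>M borel)"
  shows "prob (A \<inter> (obs (n + 1) -` C \<inter> space M)) = prob A * prob (obs (n + 1) -` C \<inter> space M)"
proof -
  define E where "E i = {case_sum X U i -` A \<inter> space M | A. A \<in> sets borel}" for i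
  define I :: "bool \<Rightarrow> (nat + nat) set" where
    "I b = (if b then Inl ` {1..n} \<union> Inr ` {1..n} else {Inl (n + 1), Inr (n + 1)})" for b
  define S where "S = (\<lambda>b. sigma_sets (space M) (\<Union>i\<in>I b. E i))"
  have E_space: "E i \<subseteq> Pow (space M)" for i by (auto simp: E_def)
  have "indep_sets E ({1..} <+> {1..})" using independent unfolding indep_vars_def2 E_def by blast
  then have "indep_sets E (\<Union>b\<in>UNIV. I b)"
    by (rule indep_sets_mono_index[rotated]) (auto simp: I_def)
  then have "indep_sets (\<lambda>b. sigma_sets (space M) (\<Union>i\<in>I b. E i)) UNIV"
  proof (rule indep_sets_collect_sigma)
    show "disjoint_family_on I UNIV" by (auto simp: disjoint_family_on_def I_def)
    fix i show "Int_stable (E i)"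
    proof (rule Int_stableI)
      fix a b assume "a \<in> E i" "b \<in> E i"
      then obtain A B where "a = case_sum X U i -` A \<inter> space M" "A \<in> sets borel"
        "b = case_sum X U i -` B \<inter> space M" "B \<in> sets borel" by (auto simp: E_def)
      then show "a \<inter> b \<in> E i" unfolding E_def by (intro CollectI exI[of _ "A \<inter> B"]) auto
    qed
  qed
  then have ind: "indep_sets S UNIV" unfolding S_def .
  have prod: "prob (a \<inter> b) = prob a * prob b" if "a \<in> S True" "b \<in> S False" for a b
  proof -
    have "prob (\<Inter>j\<in>UNIV. case_bool a b j) = (\<Prod>j\<in>UNIV. prob (case_bool a b j))"
      by (rule indep_setsD[OF ind]) (use that in \<open>auto split: bool.split\<close>)
    then show ?thesis unfolding UNIV_bool by (simp add: ac_simps)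
  qed
  have H: "sets (hist n) \<subseteq> S True"
    unfolding sets_hist S_def
  proof (rule sigma_sets_mono', safe)
    fix i and A :: "real set" assume i: "i \<in> {1..n}" and A: "A \<in> sets borel"
    have "case_sum X U (Inl i) -` A \<inter> space M \<in> E (Inl i)" "case_sum X U (Inr i) -` A \<inter> space M \<in> E (Inr i)"
      unfolding E_def using A by blast+
    moreover have "Inl i \<in> I True" "Inr i \<in> I True" using i by (auto simp: I_def)
    ultimately show "X i -` A \<inter> space M \<in> (\<Union>i\<in>I True. E i)" "U i -` A \<inter> space M \<in> (\<Union>i\<in>I True. E i)"
      by auto
  qed
  \<comment> \<open>An auxiliary space carrying only the sigma-algebra of the two new variables, so
    that measurability of the pair yields membership in \<open>S False\<close>.\<close>
  define N where "N = sigma (space M) (\<Union>i\<in>I False. E i)"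
  have sN: "space N = space M" "sets N = S False"
    using E_space by (auto simp: N_def S_def space_measure_of_conv intro!: sets_measure_of)
  have m: "case_sum X U i \<in> borel_measurable N" if "i \<in> I False" for i
  proof (rule measurableI)
    fix A :: "real set" assume "A \<in> sets borel"
    then have "case_sum X U i -` A \<inter> space M \<in> (\<Union>i\<in>I False. E i)" using that unfolding E_def by blast
    then show "case_sum X U i -` A \<inter> space N \<in> sets N"
      unfolding sN S_def by (rule sigma_sets.Basic)
  qed simp
  have "U (n + 1) \<in> borel_measurable N" "X (n + 1) \<in> borel_measurable N"
    using m[of "Inr (n + 1)"] m[of "Inl (n + 1)"] unfolding I_def by simp_all
  then have "obs (n + 1) \<in> measurable N (borel \<Otimes>\<^sub>M borel)"
    by (intro measurable_Pair) auto
  then have "obs (n + 1) -` C \<inter> space M \<in> S False"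
    using measurable_sets[of "obs (n + 1)" N, OF _ C] unfolding sN by blast
  with A H show ?thesis by (intro prod) auto
qed

text \<open>Independence makes the joint law of the history and the next pair a product, so
  Tonelli's theorem freezes the history. The pair has law \<open>obs_law\<close> because
  \<open>n + 1\<close> lies after the change.\<close>

lemma nn_integral_hist_obs:
  assumes n: "\<tau> \<le> n" and f: "f \<in> borel_measurable (hist n \<Otimes>\<^sub>M (borel \<Otimes>\<^sub>M borel))"
  shows "(\<integral>\<^sup>+\<omega>. f (\<omega>, obs (n + 1) \<omega>) \<partial>M) = (\<integral>\<^sup>+\<omega>. \<integral>\<^sup>+v. f (\<omega>, v) \<partial>obs_law \<partial>M)"
proof -
  interpret O: prob_space obs_law by (rule prob_space_obs_law)
  have idm: "(\<lambda>\<omega>. \<omega>) \<in> measurable M (hist n)"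
    by (rule measurable_from_subalg[OF subalgebra_hist measurable_ident_sets[OF refl, unfolded id_def]])
  have obsM: "obs (n + 1) \<in> measurable M (borel \<Otimes>\<^sub>M borel)" by (rule obs_measurable) simp
  have D: "distr M (hist n) (\<lambda>\<omega>. \<omega>) \<Otimes>\<^sub>M obs_law
      = distr M (hist n \<Otimes>\<^sub>M (borel \<Otimes>\<^sub>M borel)) (\<lambda>\<omega>. (\<omega>, obs (n + 1) \<omega>))"
  proof (rule pair_measure_eqI)
    show "sigma_finite_measure (distr M (hist n) (\<lambda>\<omega>. \<omega>))"
      using prob_space_distr[OF idm] by (simp add: prob_space_imp_sigma_finite)
    show "sigma_finite_measure obs_law" by unfold_locales
    show "sets (distr M (hist n) (\<lambda>\<omega>. \<omega>) \<Otimes>\<^sub>M obs_law)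
        = sets (distr M (hist n \<Otimes>\<^sub>M (borel \<Otimes>\<^sub>M borel)) (\<lambda>\<omega>. (\<omega>, obs (n + 1) \<omega>)))"
      by (simp cong: sets_pair_measure_cong)
    fix A C assume A: "A \<in> sets (distr M (hist n) (\<lambda>\<omega>. \<omega>))" and "C \<in> sets obs_law"
    then have C: "C \<in> sets (borel \<Otimes>\<^sub>M borel)" and A': "A \<in> sets (hist n)" by auto
    have As: "A \<inter> space M = A" using sets.sets_into_space[OF A'] by auto
    have "obs_law = distr M (borel \<Otimes>\<^sub>M borel) (obs (n + 1))" using n by (simp add: distr_obs)
    then have "emeasure obs_law C = prob (obs (n + 1) -` C \<inter> space M)"
      using obsM C by (simp add: emeasure_distr emeasure_eq_measure)
    moreover have "(\<lambda>\<omega>. (\<omega>, obs (n + 1) \<omega>)) -` (A \<times> C) \<inter> space M = A \<inter> (obs (n + 1) -` C \<inter> space M)"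
      using As by auto
    ultimately show "emeasure (distr M (hist n) (\<lambda>\<omega>. \<omega>)) A * emeasure obs_law C
        = emeasure (distr M (hist n \<Otimes>\<^sub>M (borel \<Otimes>\<^sub>M borel)) (\<lambda>\<omega>. (\<omega>, obs (n + 1) \<omega>))) (A \<times> C)"
      using A' C As idm measurable_Pair[OF idm obsM] prob_hist_obs[OF A' C]
      by (simp add: emeasure_distr emeasure_eq_measure ennreal_mult'')
  qed
  have f': "f \<in> borel_measurable (distr M (hist n) (\<lambda>\<omega>. \<omega>) \<Otimes>\<^sub>M obs_law)"
    unfolding D measurable_distr_eq1 by (rule f)
  have mp: "(\<lambda>\<omega>. (\<omega>, obs (n + 1) \<omega>)) \<in> measurable M (hist n \<Otimes>\<^sub>M (borel \<Otimes>\<^sub>M borel))"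
    by (rule measurable_Pair[OF idm obsM])
  have fd: "f \<in> borel_measurable (distr M (hist n \<Otimes>\<^sub>M (borel \<Otimes>\<^sub>M borel)) (\<lambda>\<omega>. (\<omega>, obs (n + 1) \<omega>)))"
    unfolding measurable_distr_eq1 by (rule f)
  have f'': "f \<in> borel_measurable (hist n \<Otimes>\<^sub>M obs_law)"
    using f measurable_cong_sets[OF sets_pair_measure_cong[OF refl sets_obs_law] refl] by blast
  have "(\<integral>\<^sup>+\<omega>. f (\<omega>, obs (n + 1) \<omega>) \<partial>M)
      = (\<integral>\<^sup>+z. f z \<partial>distr M (hist n \<Otimes>\<^sub>M (borel \<Otimes>\<^sub>M borel)) (\<lambda>\<omega>. (\<omega>, obs (n + 1) \<omega>)))"
    by (rule nn_integral_distr[OF mp fd, symmetric])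
  also have "\<dots> = (\<integral>\<^sup>+\<omega>. \<integral>\<^sup>+v. f (\<omega>, v) \<partial>obs_law \<partial>distr M (hist n) (\<lambda>\<omega>. \<omega>))"
    unfolding D[symmetric] by (rule O.nn_integral_fst[symmetric, OF f'])
  also have "\<dots> = (\<integral>\<^sup>+\<omega>. \<integral>\<^sup>+v. f (\<omega>, v) \<partial>obs_law \<partial>M)"
    by (rule nn_integral_distr[OF idm]) (use O.borel_measurable_nn_integral_fst[OF f''] in simp)
  finally show ?thesis .
qed

section \<open>A conditional Azuma--Hoeffding inequality\<close>

text \<open>From time \<tau> on, an explicit version of the conditional expectation of
  \<open>f\<close> at the next pair given the history, defined at every \<omega> rather than almost
  everywhere.\<close>

definition obs_mean :: "('w \<times> real \<times> real \<Rightarrow> real) \<Rightarrow> 'w \<Rightarrow> real" where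
  "obs_mean f \<omega> = (\<integral>v. f (\<omega>, v) \<partial>obs_law)"

lemma obs_mean_measurable:
  assumes "f \<in> borel_measurable (hist n \<Otimes>\<^sub>M (borel \<Otimes>\<^sub>M borel))"
  shows "obs_mean f \<in> borel_measurable (hist n)"
proof -
  interpret O: prob_space obs_law by (rule prob_space_obs_law)
  have "f \<in> borel_measurable (hist n \<Otimes>\<^sub>M obs_law)"
    using assms measurable_cong_sets[OF sets_pair_measure_cong[OF refl sets_obs_law] refl] by blast
  then show ?thesis unfolding obs_mean_def by (intro O.borel_measurable_lebesgue_integral) simp
qed

text \<open>For a frozen history, Hoeffding's lemma on an interval of length 1 gives the factor
  \<open>exp (\<theta>^2 / 8)\<close>. \<open>Y\<close> stands for whatever was accumulated
  before.\<close>

lemma mgf_step: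
  assumes n: "\<tau> \<le> n" and f [measurable]: "f \<in> borel_measurable (hist n \<Otimes>\<^sub>M (borel \<Otimes>\<^sub>M borel))"
    and bounds: "\<And>z. f z \<in> {0..1}" and Y [measurable]: "Y \<in> borel_measurable (hist n)" and \<theta>: "\<theta> > 0"
  shows "(\<integral>\<^sup>+\<omega>. Y \<omega> * ennreal (exp (\<theta> * (f (\<omega>, obs (n + 1) \<omega>) - obs_mean f \<omega>))) \<partial>M)
    \<le> ennreal (exp (\<theta>\<^sup>2 / 8)) * (\<integral>\<^sup>+\<omega>. Y \<omega> \<partial>M)"
proof -
  interpret O: prob_space obs_law by (rule prob_space_obs_law)
  note [measurable] = obs_mean_measurable[OF f]
  have YM: "Y \<in> borel_measurable M" by (rule measurable_from_subalg[OF subalgebra_hist Y])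
  define g where "g = (\<lambda>(\<omega>, v). Y \<omega> * ennreal (exp (\<theta> * (f (\<omega>, v) - obs_mean f \<omega>))))"
  have g: "g \<in> borel_measurable (hist n \<Otimes>\<^sub>M (borel \<Otimes>\<^sub>M borel))" unfolding g_def by measurable
  have "(\<integral>\<^sup>+\<omega>. g (\<omega>, obs (n + 1) \<omega>) \<partial>M) = (\<integral>\<^sup>+\<omega>. \<integral>\<^sup>+v. g (\<omega>, v) \<partial>obs_law \<partial>M)"
    by (rule nn_integral_hist_obs[OF n g])
  also have "\<dots> \<le> (\<integral>\<^sup>+\<omega>. ennreal (exp (\<theta>\<^sup>2 / 8)) * Y \<omega> \<partial>M)"
  proof (rule nn_integral_mono)
    fix \<omega> assume \<omega>: "\<omega> \<in> space M"
    have fm: "(\<lambda>v. f (\<omega>, v)) \<in> borel_measurable obs_law"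
      using measurable_compose_Pair1[of \<omega> "hist n" f "borel \<Otimes>\<^sub>M borel" borel] \<omega> f
      by (simp cong: measurable_cong_sets)
    interpret I: interval_bounded_random_variable obs_law "\<lambda>v. f (\<omega>, v)" 0 1
      by unfold_locales (use fm bounds in auto)
    have "(\<integral>\<^sup>+v. g (\<omega>, v) \<partial>obs_law) = Y \<omega> * (\<integral>\<^sup>+v. ennreal (exp (\<theta> * (f (\<omega>, v) - obs_mean f \<omega>))) \<partial>obs_law)"
      unfolding g_def prod.case by (rule nn_integral_cmult) (use fm in measurable)
    also have "\<dots> \<le> Y \<omega> * ennreal (exp (\<theta>\<^sup>2 / 8))"
      using I.Hoeffdings_lemma_nn_integral[OF \<theta>] by (intro mult_left_mono) (simp_all add: obs_mean_def)
    finally show "(\<integral>\<^sup>+v. g (\<omega>, v) \<partial>obs_law) \<le> ennreal (exp (\<theta>\<^sup>2 / 8)) * Y \<omega>" by (simp add: mult.commute)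
  qed
  also have "\<dots> = ennreal (exp (\<theta>\<^sup>2 / 8)) * (\<integral>\<^sup>+\<omega>. Y \<omega> \<partial>M)"
    by (rule nn_integral_cmult[OF YM])
  finally show ?thesis by (simp add: g_def)
qed

lemma hist_obs_compose:
  assumes f: "f \<in> borel_measurable (hist s \<Otimes>\<^sub>M (borel \<Otimes>\<^sub>M borel))" and "s + 1 \<le> m"
  shows "(\<lambda>\<omega>. f (\<omega>, obs (s + 1) \<omega>)) \<in> borel_measurable (hist m)"
proof -
  have "(\<lambda>\<omega>. \<omega>) \<in> measurable (hist m) (hist s)"
    by (rule measurable_from_subalg[OF subalgebra_hist_mono measurable_ident_sets[OF refl, unfolded id_def]])
      (use assms in simp)
  then have "(\<lambda>\<omega>. (\<omega>, obs (s + 1) \<omega>)) \<in> measurable (hist m) (hist s \<Otimes>\<^sub>M (borel \<Otimes>\<^sub>M borel))"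
    using assms(2) by (intro measurable_Pair[of "\<lambda>\<omega>. \<omega>"] obs_hist) auto
  from measurable_compose[OF this f] show ?thesis .
qed

text \<open>A sum minus its compensator, hence for \<open>s \<ge> \<tau>\<close> a martingale in
  \<open>l\<close> when summand \<open>q\<close> is a bounded measurable function of the history at
  \<open>s + q\<close> and the next pair.\<close>

definition mart_sum :: "(nat \<Rightarrow> 'w \<times> real \<times> real \<Rightarrow> real) \<Rightarrow> nat \<Rightarrow> nat \<Rightarrow> 'w \<Rightarrow> real" where
  "mart_sum f s l \<omega> = (\<Sum>q<l. f (s + q) (\<omega>, obs (s + q + 1) \<omega>) - obs_mean (f (s + q)) \<omega>)"

lemma mart_sum_measurable:
  assumes f: "\<And>t. f t \<in> borel_measurable (hist t \<Otimes>\<^sub>M (borel \<Otimes>\<^sub>M borel))"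
  shows "mart_sum f s l \<in> borel_measurable (hist (s + l))"
  unfolding mart_sum_def
proof (intro borel_measurable_sum borel_measurable_diff)
  fix q assume q: "q \<in> {..<l}"
  show "(\<lambda>\<omega>. f (s + q) (\<omega>, obs (s + q + 1) \<omega>)) \<in> borel_measurable (hist (s + l))"
    by (rule hist_obs_compose[OF f]) (use q in simp)
  show "obs_mean (f (s + q)) \<in> borel_measurable (hist (s + l))"
    by (rule measurable_from_subalg[OF subalgebra_hist_mono obs_mean_measurable[OF f]]) (use q in simp)
qed

text \<open>The indicator of \<open>B\<close> rides along in the induction; this makes the bound
  conditional on the history at \<open>n\<close> although the sum may start later, at
  \<open>s\<close>.\<close>

lemma mart_sum_mgf:
  assumes n: "\<tau> \<le> n" "n \<le> s" and f: "\<And>t. f t \<in> borel_measurable (hist t \<Otimes>\<^sub>M (borel \<Otimes>\<^sub>M borel))"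
    and bounds: "\<And>t z. f t z \<in> {0..1}" and B: "B \<in> sets (hist n)" and \<theta>: "\<theta> > 0"
  shows "(\<integral>\<^sup>+\<omega>. indicator B \<omega> * ennreal (exp (\<theta> * mart_sum f s l \<omega>)) \<partial>M)
    \<le> ennreal (exp (real l * (\<theta>\<^sup>2 / 8))) * emeasure M B"
proof (induction l)
  case 0
  have "B \<in> events" using B subalgebra_hist[of n] by (auto simp: subalgebra_def)
  then show ?case by (simp add: mart_sum_def)
next
  case (Suc l)
  define Y where "Y \<omega> = indicator B \<omega> * ennreal (exp (\<theta> * mart_sum f s l \<omega>))" for \<omega>
  have B': "B \<in> sets (hist (s + l))"
    using B subalgebra_hist_mono[of n "s + l"] n by (auto simp: subalgebra_def)
  note [measurable] = mart_sum_measurable[OF f] B'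
  have Y: "Y \<in> borel_measurable (hist (s + l))" unfolding Y_def by measurable
  have "(\<integral>\<^sup>+\<omega>. indicator B \<omega> * ennreal (exp (\<theta> * mart_sum f s (Suc l) \<omega>)) \<partial>M)
      = (\<integral>\<^sup>+\<omega>. Y \<omega> * ennreal (exp (\<theta> * (f (s + l) (\<omega>, obs (s + l + 1) \<omega>) - obs_mean (f (s + l)) \<omega>))) \<partial>M)"
    by (simp add: Y_def mart_sum_def distrib_left exp_add ennreal_mult mult.assoc)
  also have "\<dots> \<le> ennreal (exp (\<theta>\<^sup>2 / 8)) * (\<integral>\<^sup>+\<omega>. Y \<omega> \<partial>M)"
    by (rule mgf_step[OF _ f bounds Y \<theta>]) (use n in simp)
  also have "\<dots> \<le> ennreal (exp (\<theta>\<^sup>2 / 8)) * (ennreal (exp (real l * (\<theta>\<^sup>2 / 8))) * emeasure M B)"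
    using Suc unfolding Y_def by (intro mult_left_mono) auto
  also have "\<dots> = ennreal (exp (real (Suc l) * (\<theta>\<^sup>2 / 8))) * emeasure M B"
  proof -
    have "\<theta>\<^sup>2 / 8 + real l * (\<theta>\<^sup>2 / 8) = real (Suc l) * (\<theta>\<^sup>2 / 8)" by (simp add: algebra_simps)
    then show ?thesis
      by (simp only: mult.assoc[symmetric] ennreal_mult'[symmetric] exp_ge_zero exp_add[symmetric])
  qed
  finally show ?case .
qed

lemma azuma_upper:
  assumes n: "\<tau> \<le> n" "n \<le> s" and f: "\<And>t. f t \<in> borel_measurable (hist t \<Otimes>\<^sub>M (borel \<Otimes>\<^sub>M borel))"
    and bounds: "\<And>t z. f t z \<in> {0..1}" and B: "B \<in> sets (hist n)" and c: "c > 0"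
  shows "prob {\<omega> \<in> B. real l * c \<le> mart_sum f s l \<omega>} \<le> exp (- 2 * real l * c\<^sup>2) * prob B"
proof -
  have BM: "B \<in> events" using B subalgebra_hist[of n] by (auto simp: subalgebra_def)
  note [measurable] = BM measurable_from_subalg[OF subalgebra_hist mart_sum_measurable[OF f]]
  \<comment> \<open>The minimiser of the exponent
    \<open>- \<theta> * l * c + l * \<theta>^2 / 8\<close>.\<close>
  define \<theta> where "\<theta> = 4 * c"
  have \<theta>: "\<theta> > 0" using c by (simp add: \<theta>_def)
  let ?u = "\<lambda>\<omega>. ennreal (exp (\<theta> * mart_sum f s l \<omega>))"
  let ?c = "ennreal (exp (- \<theta> * (real l * c)))"
  have "{\<omega> \<in> B. real l * c \<le> mart_sum f s l \<omega>} = {\<omega> \<in> B. 1 \<le> ?c * ?u \<omega>}"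
  proof -
    have "1 \<le> ?c * ?u \<omega> \<longleftrightarrow> real l * c \<le> mart_sum f s l \<omega>" for \<omega>
    proof -
      have "?c * ?u \<omega> = ennreal (exp (\<theta> * (mart_sum f s l \<omega> - real l * c)))"
        by (simp add: ennreal_mult'[symmetric] exp_add[symmetric] algebra_simps)
      then show ?thesis using \<theta> by (simp add: zero_le_mult_iff flip: ennreal_1)
    qed
    then show ?thesis by simp
  qed
  then have "emeasure M {\<omega> \<in> B. real l * c \<le> mart_sum f s l \<omega>} \<le> ?c * (\<integral>\<^sup>+\<omega>. ?u \<omega> * indicator B \<omega> \<partial>M)"
    using nn_integral_Markov_inequality[of ?u B M ?c] by simp
  also have "\<dots> \<le> ?c * (ennreal (exp (real l * (\<theta>\<^sup>2 / 8))) * emeasure M B)"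
    using mart_sum_mgf[OF n f bounds B \<theta>, of l] by (intro mult_left_mono) (simp_all add: mult.commute)
  also have "\<dots> = ennreal (exp (- 2 * real l * c\<^sup>2) * prob B)"
  proof -
    have "- \<theta> * (real l * c) + real l * (\<theta>\<^sup>2 / 8) = - 2 * real l * c\<^sup>2"
      by (simp add: \<theta>_def power2_eq_square)
    then show ?thesis
      by (simp only: emeasure_eq_measure mult.assoc[symmetric] ennreal_mult'[symmetric] exp_ge_zero exp_add[symmetric])
  qed
  finally show ?thesis by (simp add: emeasure_eq_measure)
qed

text \<open>The lower tail is the upper tail for \<open>1 - f\<close>, whose martingale sum is the
  negative of the original one.\<close>

lemma azuma:
  assumes n: "\<tau> \<le> n" "n \<le> s" and f: "\<And>t. f t \<in> borel_measurable (hist t \<Otimes>\<^sub>M (borel \<Otimes>\<^sub>M borel))"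
    and bounds: "\<And>t z. f t z \<in> {0..1}" and B: "B \<in> sets (hist n)" and c: "c > 0"
  shows "prob {\<omega> \<in> B. real l * c \<le> \<bar>mart_sum f s l \<omega>\<bar>} \<le> 2 * exp (- 2 * real l * c\<^sup>2) * prob B"
proof -
  interpret O: prob_space obs_law by (rule prob_space_obs_law)
  define f' where "f' t z = 1 - f t z" for t z
  have f': "f' t \<in> borel_measurable (hist t \<Otimes>\<^sub>M (borel \<Otimes>\<^sub>M borel))" for t
    unfolding f'_def using f by measurable
  have BM: "B \<in> events" using B subalgebra_hist[of n] by (auto simp: subalgebra_def)
  note [measurable] = BM measurable_from_subalg[OF subalgebra_hist mart_sum_measurable[OF f]]
    measurable_from_subalg[OF subalgebra_hist mart_sum_measurable[OF f']]
  have neg: "mart_sum f' s l \<omega> = - mart_sum f s l \<omega>" if "\<omega> \<in> space M" for \<omega>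
  proof -
    have mean: "obs_mean (f' t) \<omega> = 1 - obs_mean (f t) \<omega>" for t
    proof -
      have "(\<lambda>v. f t (\<omega>, v)) \<in> borel_measurable obs_law"
        using measurable_compose_Pair1[of \<omega> "hist t" "f t" "borel \<Otimes>\<^sub>M borel" borel] that f
        by (simp cong: measurable_cong_sets)
      then have "integrable obs_law (\<lambda>v. f t (\<omega>, v))"
        using bounds[of t] by (intro O.integrable_const_bound[of _ 1]) auto
      then show ?thesis using O.prob_space by (simp add: obs_mean_def f'_def)
    qed
    show ?thesis
      unfolding mart_sum_def sum_negf[symmetric] by (intro sum.cong refl) (simp add: mean f'_def)
  qed
  have "prob {\<omega> \<in> B. real l * c \<le> \<bar>mart_sum f s l \<omega>\<bar>}
      \<le> prob ({\<omega> \<in> B. real l * c \<le> mart_sum f s l \<omega>} \<union> {\<omega> \<in> B. real l * c \<le> mart_sum f' s l \<omega>})"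
    using neg sets.sets_into_space[OF BM] by (intro finite_measure_mono) (auto simp: abs_if split: if_splits)
  also have "\<dots> \<le> prob {\<omega> \<in> B. real l * c \<le> mart_sum f s l \<omega>} + prob {\<omega> \<in> B. real l * c \<le> mart_sum f' s l \<omega>}"
    by (rule measure_Un_le) auto
  also have "\<dots> \<le> exp (- 2 * real l * c\<^sup>2) * prob B + exp (- 2 * real l * c\<^sup>2) * prob B"
  proof (rule add_mono)
    show "prob {\<omega> \<in> B. real l * c \<le> mart_sum f' s l \<omega>} \<le> exp (- 2 * real l * c\<^sup>2) * prob B"
      by (rule azuma_upper[OF n f' _ B c]) (use bounds in \<open>auto simp: f'_def\<close>)
  qed (rule azuma_upper[OF n f bounds B c])
  also have "\<dots> = 2 * exp (- 2 * real l * c\<^sup>2) * prob B" by simp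
  finally show ?thesis .
qed

end

section \<open>Continuous distribution functions\<close>

context real_distribution
begin

lemma cdf_attains:
  assumes cont: "continuous_on UNIV (cdf M)" and w: "0 < w" "w < 1"
  obtains y where "cdf M y = w"
proof -
  have "\<forall>\<^sub>F x in at_bot. cdf M x < w" using cdf_lim_at_bot w(1) by (rule order_tendstoD)
  then obtain a where a: "cdf M a < w" by (auto simp: eventually_at_bot_linorder)
  have "\<forall>\<^sub>F x in at_top. cdf M x > w" using cdf_lim_at_top_prob w(2) by (rule order_tendstoD)
  then obtain b where b: "cdf M b > w" by (auto simp: eventually_at_top_linorder)
  have "a \<le> b" using a b cdf_nondecreasing[of b a] by (cases "a \<le> b") auto
  then obtain y where "cdf M y = w"
    using IVT'[of "cdf M" a w b] a b continuous_on_subset[OF cont] by auto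
  then show ?thesis using that by blast
qed

lemma cdf_borel:
  assumes "continuous_on UNIV (cdf M)"
  shows "cdf M \<in> borel_measurable borel"
  by (rule borel_measurable_continuous_onI[OF assms])

context
  assumes cont: "continuous_on UNIV (cdf M)"
begin

lemmas [measurable] = cdf_borel[OF cont]

text \<open>One half of the probability integral transform. Passing to a slightly larger level
  \<open>w\<close>, attained at some \<open>y\<close>, avoids a discussion of flat pieces of the
  distribution function.\<close>

lemma prob_cdf_le:
  assumes v: "0 \<le> v" "v \<le> 1"
  shows "prob {x. cdf M x \<le> v} \<le> v"
proof (cases "v = 1")
  case False
  show ?thesis
  proof (rule dense_ge_bounded[of v 1])
    fix w assume w: "v < w" "w < 1"
    then obtain y where y: "cdf M y = w" using cdf_attains[OF cont, of w] v by auto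
    have "{x. cdf M x \<le> v} \<subseteq> {..y}"
    proof
      fix x assume "x \<in> {x. cdf M x \<le> v}"
      then show "x \<in> {..y}" using cdf_nondecreasing[of y x] w y by (cases "x \<le> y") auto
    qed
    then have "prob {x. cdf M x \<le> v} \<le> prob {..y}" by (intro finite_measure_mono) auto
    then show "prob {x. cdf M x \<le> v} \<le> w" using y by (simp add: cdf_def)
  qed (use v False in simp)
qed simp

lemma prob_cdf_less:
  assumes v: "0 \<le> v" "v \<le> 1"
  shows "v \<le> prob {x. cdf M x < v}"
proof (cases "v = 0")
  case False
  show ?thesis
  proof (rule dense_le_bounded[of 0 v])
    fix w assume w: "0 < w" "w < v"
    then obtain y where y: "cdf M y = w" using cdf_attains[OF cont, of w] v by auto
    have "{..y} \<subseteq> {x. cdf M x < v}"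
    proof
      fix x assume "x \<in> {..y}"
      then have "cdf M x \<le> w" using cdf_nondecreasing[of x y] y by simp
      then show "x \<in> {x. cdf M x < v}" using w by simp
    qed
    then have "prob {..y} \<le> prob {x. cdf M x < v}" by (intro finite_measure_mono) auto
    then show "w \<le> prob {x. cdf M x < v}" using y by (simp add: cdf_def)
  qed (use v False in simp)
qed simp

lemma prob_cdf_interval:
  assumes "0 \<le> a" "a \<le> b" "b \<le> 1"
  shows "prob {x. a \<le> cdf M x \<and> cdf M x \<le> b} = b - a"
    and "prob {x. a < cdf M x \<and> cdf M x < b} = b - a"
proof -
  have "{x. a \<le> cdf M x \<and> cdf M x \<le> b} = {x. cdf M x \<le> b} - {x. cdf M x < a}" by auto
  moreover have "prob ({x. cdf M x \<le> b} - {x. cdf M x < a}) = prob {x. cdf M x \<le> b} - prob {x. cdf M x < a}"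
    by (rule finite_measure_Diff) (use assms in auto)
  ultimately have up: "prob {x. a \<le> cdf M x \<and> cdf M x \<le> b} \<le> b - a"
    using prob_cdf_le[of b] prob_cdf_less[of a] assms by simp
  \<comment> \<open>The open band lies in the closed one, so a lower bound for the former and an
    upper bound for the latter settle both equalities.\<close>
  have lo: "b - a \<le> prob {x. a < cdf M x \<and> cdf M x < b}"
  proof (cases "a = b")
    case False
    have "{x. a < cdf M x \<and> cdf M x < b} = {x. cdf M x < b} - {x. cdf M x \<le> a}" by auto
    moreover have "prob ({x. cdf M x < b} - {x. cdf M x \<le> a}) = prob {x. cdf M x < b} - prob {x. cdf M x \<le> a}"
      by (rule finite_measure_Diff) (use assms False in auto)
    ultimately show ?thesis using prob_cdf_le[of a] prob_cdf_less[of b] assms by simp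
  qed simp
  have "prob {x. a < cdf M x \<and> cdf M x < b} \<le> prob {x. a \<le> cdf M x \<and> cdf M x \<le> b}"
    by (rule finite_measure_mono) auto
  with up lo show "prob {x. a \<le> cdf M x \<and> cdf M x \<le> b} = b - a"
    "prob {x. a < cdf M x \<and> cdf M x < b} = b - a" by auto
qed

text \<open>The set need not be an interval: it lies in a closed band of levels that starts at the
  infimum of the distribution function on \<open>S\<close>.\<close>

lemma prob_le_cdf_spread:
  assumes "S \<in> events" "\<And>x y. x \<in> S \<Longrightarrow> y \<in> S \<Longrightarrow> cdf M y - cdf M x \<le> c" "0 \<le> c"
  shows "prob S \<le> c"
proof (cases "S = {}")
  case False
  define \<alpha> where "\<alpha> = Inf (cdf M ` S)"
  have bdd: "bdd_below (cdf M ` S)" by (intro bdd_belowI[of _ 0]) (auto simp: cdf_nonneg)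
  have \<alpha>0: "0 \<le> \<alpha>" unfolding \<alpha>_def using False by (intro cInf_greatest) (auto simp: cdf_nonneg)
  obtain x0 where "x0 \<in> S" using False by blast
  then have \<alpha>1: "\<alpha> \<le> 1" unfolding \<alpha>_def
    using cInf_lower[OF _ bdd, of "cdf M x0"] cdf_bounded_prob[of x0] by auto
  have "S \<subseteq> {x. \<alpha> \<le> cdf M x \<and> cdf M x \<le> min 1 (\<alpha> + c)}"
  proof safe
    fix x assume x: "x \<in> S"
    then show "\<alpha> \<le> cdf M x" unfolding \<alpha>_def by (intro cInf_lower bdd) auto
    have "cdf M x - c \<le> \<alpha>" unfolding \<alpha>_def
      using False assms(2)[OF _ x] by (intro cInf_greatest) (auto simp: algebra_simps)
    then show "cdf M x \<le> min 1 (\<alpha> + c)" using cdf_bounded_prob[of x] by auto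
  qed
  then have "prob S \<le> prob {x. \<alpha> \<le> cdf M x \<and> cdf M x \<le> min 1 (\<alpha> + c)}"
    by (intro finite_measure_mono) auto
  also have "\<dots> = min 1 (\<alpha> + c) - \<alpha>"
    by (rule prob_cdf_interval(1)) (use \<alpha>0 \<alpha>1 assms in auto)
  finally show ?thesis by linarith
qed (use assms in simp)

text \<open>The complement of \<open>S\<close> is covered by a low part \<open>A\<close> and a high
  part \<open>B\<close>; every point with a level strictly between the supremum over
  \<open>A\<close> and the infimum over \<open>B\<close> is in \<open>S\<close>. The inserted values
  0 and 1 stand in for an empty side and account for the hypotheses about \<open>A\<close> or
  \<open>B\<close> alone.\<close>

lemma prob_ge_cdf_gap:
  assumes "S \<in> events" "UNIV - S \<subseteq> A \<union> B"
    and "c \<le> 1" "\<And>x. x \<in> A \<Longrightarrow> cdf M x + c \<le> 1" "\<And>y. y \<in> B \<Longrightarrow> c \<le> cdf M y"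
    and "\<And>x y. x \<in> A \<Longrightarrow> y \<in> B \<Longrightarrow> cdf M x + c \<le> cdf M y"
  shows "c \<le> prob S"
proof (cases "c \<le> 0")
  case False
  define \<alpha> where "\<alpha> = Sup (insert 0 (cdf M ` A))"
  define \<beta> where "\<beta> = Inf (insert 1 (cdf M ` B))"
  have A: "cdf M x \<le> \<alpha>" if "x \<in> A" for x unfolding \<alpha>_def
    by (rule cSup_upper) (use that cdf_bounded_prob in \<open>auto intro!: bdd_aboveI[of _ 1]\<close>)
  have B: "\<beta> \<le> cdf M y" if "y \<in> B" for y unfolding \<beta>_def
    by (rule cInf_lower) (use that cdf_nonneg in \<open>auto intro!: bdd_belowI[of _ 0]\<close>)
  have \<alpha>0: "0 \<le> \<alpha>" unfolding \<alpha>_def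
    by (rule cSup_upper) (use cdf_bounded_prob in \<open>auto intro!: bdd_aboveI[of _ 1]\<close>)
  have \<beta>1: "\<beta> \<le> 1" unfolding \<beta>_def
    by (rule cInf_lower) (use cdf_nonneg in \<open>auto intro!: bdd_belowI[of _ 0]\<close>)
  have ubd: "u + c \<le> \<beta>" if u: "u \<in> insert 0 (cdf M ` A)" for u unfolding \<beta>_def
  proof (rule cInf_greatest)
    fix v assume v: "v \<in> insert 1 (cdf M ` B)"
    consider "u = 0" "v = 1" | y where "u = 0" "y \<in> B" "v = cdf M y"
      | x where "x \<in> A" "u = cdf M x" "v = 1" | x y where "x \<in> A" "u = cdf M x" "y \<in> B" "v = cdf M y"
      using u v by blast
    then show "u + c \<le> v" by cases (simp_all add: assms(3-6))
  qed simp
  have gap: "\<alpha> \<le> \<beta> - c" unfolding \<alpha>_def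
  proof (rule cSup_least)
    fix u assume "u \<in> insert 0 (cdf M ` A)"
    from ubd[OF this] show "u \<le> \<beta> - c" by simp
  qed simp
  have "{x. \<alpha> < cdf M x \<and> cdf M x < \<beta>} \<subseteq> S"
  proof
    fix x assume x: "x \<in> {x. \<alpha> < cdf M x \<and> cdf M x < \<beta>}"
    then have "x \<notin> A" "x \<notin> B" using A[of x] B[of x] by auto
    then show "x \<in> S" using assms(2) by blast
  qed
  then have "prob {x. \<alpha> < cdf M x \<and> cdf M x < \<beta>} \<le> prob S"
    by (intro finite_measure_mono assms(1))
  moreover have "prob {x. \<alpha> < cdf M x \<and> cdf M x < \<beta>} = \<beta> - \<alpha>"
    by (rule prob_cdf_interval(2)) (use \<alpha>0 \<beta>1 gap False in auto)
  ultimately show ?thesis using gap by linarith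
qed (use measure_nonneg[of M S] in linarith)

end

end

section \<open>Empirical distributions and the probability of a bin\<close>

lemma (in real_distribution) emp_deviation_bdd:
  "bdd_above (range (\<lambda>y. \<bar>1 / real d * (\<Sum>l = 1..d. if x l \<le> y then 1 else 0) - cdf M y\<bar>))"
proof (rule bdd_aboveI2)
  fix y
  have "0 \<le> (\<Sum>l = 1..d. if x l \<le> y then 1 else 0 :: real)" by (intro sum_nonneg) auto
  moreover have "(\<Sum>l = 1..d. if x l \<le> y then 1 else 0 :: real) \<le> (\<Sum>l = 1..d. 1)" by (intro sum_mono) auto
  ultimately have "0 \<le> 1 / real d * (\<Sum>l = 1..d. if x l \<le> y then 1 else 0)"
    "1 / real d * (\<Sum>l = 1..d. if x l \<le> y then 1 else 0) \<le> 1"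
    by (auto simp: divide_le_eq)
  then show "\<bar>1 / real d * (\<Sum>l = 1..d. if x l \<le> y then 1 else 0) - cdf M y\<bar> \<le> 1"
    using cdf_nonneg[of y] cdf_bounded_prob[of y] by linarith
qed

lemma (in real_distribution) emp_deviation_upper:
  "\<bar>1 / real d * (\<Sum>l = 1..d. if x l \<le> y then 1 else 0) - cdf M y\<bar> \<le> emp_deviation x (cdf M) d"
  unfolding emp_deviation_def by (rule cSUP_upper[OF _ emp_deviation_bdd]) simp

lemma (in real_distribution) emp_deviation_nonneg: "0 \<le> emp_deviation x (cdf M) d"
  by (rule order_trans[OF abs_ge_zero emp_deviation_upper])

text \<open>The half-open range matches the sum in \<open>pvals\<close> at time
  \<open>N + 1\<close>.\<close>

definition exceed_count :: "(nat \<Rightarrow> real) \<Rightarrow> nat \<Rightarrow> real \<Rightarrow> real" where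
  "exceed_count x N y = (\<Sum>r = 1..<N+1. if x r > y then 1 else 0)"

lemma exceed_count_bounds: "0 \<le> exceed_count x N y" "exceed_count x N y \<le> real N"
proof -
  show "0 \<le> exceed_count x N y" unfolding exceed_count_def by (intro sum_nonneg) auto
  have "exceed_count x N y \<le> (\<Sum>r = 1..<N+1. 1)" unfolding exceed_count_def by (intro sum_mono) auto
  then show "exceed_count x N y \<le> real N" by simp
qed

lemma exceed_count_antimono: "y \<le> z \<Longrightarrow> exceed_count x N z \<le> exceed_count x N y"
  unfolding exceed_count_def by (intro sum_mono) auto

lemma exceed_count_diff:
  "y \<le> z \<Longrightarrow> exceed_count x N y - exceed_count x N z = (\<Sum>r = 1..<N+1. indicator {y<..z} (x r))"
  unfolding exceed_count_def sum_subtractf[symmetric] by (intro sum.cong) (auto simp: indicator_def)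

lemma exceed_count_borel [measurable]: "exceed_count x N \<in> borel_measurable borel"
  unfolding exceed_count_def[abs_def] by measurable

text \<open>As \<open>u < 1\<close>, the p-value stays strictly below 1, so the closed right end of
  the last bin is never reached and every bin becomes a half-open window for
  \<open>c\<close>.\<close>

lemma mem_bin_shift_iff:
  assumes J: "J \<ge> 1" and j: "j \<in> {1..J}" and c: "0 \<le> c" "c \<le> real N" and u: "0 < u" "u < 1"
  shows "(c + u) / real (N + 1) \<in> bin J j \<longleftrightarrow>
    real (N + 1) * (real j - 1) / real J - u \<le> c \<and> c < real (N + 1) * real j / real J - u"
proof (cases "j < J")
  case True
  then show ?thesis using J by (auto simp: bin_def field_simps)
next
  case False
  with j have [simp]: "j = J" by simp
  have "(c + u) / real (N + 1) \<le> 1" using c u by (simp add: field_simps)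
  moreover have "c < real (N + 1) * real J / real J - u" using c u J by simp
  ultimately show ?thesis using J by (auto simp: bin_def field_simps)
qed

text \<open>For a fixed randomiser \<open>u\<close>, a bin is hit when the number of exceedances lies in a window of
  length \<open>(N + 1) / J\<close>; the oscillation hypothesis converts this into a spread of \<open>cdf M\<close>.\<close>

lemma (in real_distribution) prob_bin_near_uniform:
  assumes cont: "continuous_on UNIV (cdf M)" and J: "J \<ge> 1" and j: "j \<in> {1..J}"
    and N: "N \<ge> 1" and u: "0 < u" "u < 1"
    and osc: "\<And>y z. y \<le> z \<Longrightarrow>
      \<bar>(cdf M z - cdf M y) - (exceed_count x N y - exceed_count x N z) / real N\<bar> \<le> D"
  shows "\<bar>prob {y. (exceed_count x N y + u) / real (N + 1) \<in> bin J j} - 1 / real J\<bar>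
    \<le> D + 2 / real (N + 1)"
proof -
  let ?F = "cdf M" and ?C = "exceed_count x N"
  define t where "t = real (N + 1)"
  define c1 where "c1 = t * (real j - 1) / real J - u"
  define c2 where "c2 = t * real j / real J - u"
  define S where "S = {y. (?C y + u) / t \<in> bin J j}"
  note [measurable] = cdf_borel[OF cont]
  have N0: "real N > 0" and J0: "real J > 0" and t: "t = real N + 1" using N J by (auto simp: t_def)
  have S: "S = {y. c1 \<le> ?C y \<and> ?C y < c2}"
    unfolding S_def c1_def c2_def t_def
    using mem_bin_shift_iff[OF J j _ _ u, of _ N] exceed_count_bounds by auto
  have Sm: "S \<in> events" unfolding S by measurable
  have D0: "0 \<le> D" using osc[of 0 0] by simp
  have cc: "c2 - c1 = t / real J" using J0 by (simp add: c1_def c2_def field_simps)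
  have c2t: "c2 \<le> t" and c1u: "- 1 \<le> c1"
  proof -
    have "t * real j \<le> t * real J" using j by (intro mult_left_mono) (auto simp: t_def)
    then have "t * real j / real J \<le> t" using J0 by (simp add: field_simps)
    then show "c2 \<le> t" using u by (simp add: c2_def)
    have "0 \<le> t * (real j - 1) / real J" using j J0 by (auto simp: t_def)
    then show "- 1 \<le> c1" using u by (simp add: c1_def)
  qed
  \<comment> \<open>Letting \<open>y\<close> tend to \<open>-\<infinity>\<close> in the oscillation
    bound gives a one-sided version, needed when one side of the window contains no point.\<close>
  have one: "\<bar>?F z - (real N - ?C z) / real N\<bar> \<le> D" for z
  proof (rule tendsto_upperbound[where F = at_bot and
      f = "\<lambda>y. \<bar>(?F z - ?F y) - (?C y - ?C z) / real N\<bar>"])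
    have "(?C \<longlongrightarrow> (\<Sum>r = 1..<N+1. 1)) at_bot"
      unfolding exceed_count_def[abs_def]
    proof (intro tendsto_sum)
      fix r
      have "\<forall>\<^sub>F y in at_bot. (if x r > y then 1 else 0) = (1::real)"
        using eventually_gt_at_bot[of "x r"] by eventually_elim auto
      then show "((\<lambda>y. if x r > y then 1 else 0) \<longlongrightarrow> (1::real)) at_bot"
        by (rule tendsto_eventually)
    qed
    then have "(?C \<longlongrightarrow> real N) at_bot" by simp
    then have "((\<lambda>y. \<bar>(?F z - ?F y) - (?C y - ?C z) / real N\<bar>) \<longlongrightarrow> \<bar>(?F z - 0) - (real N - ?C z) / real N\<bar>) at_bot"
      using N0 by (intro tendsto_intros cdf_lim_at_bot) auto
    then show "((\<lambda>y. \<bar>(?F z - ?F y) - (?C y - ?C z) / real N\<bar>) \<longlongrightarrow> \<bar>?F z - (real N - ?C z) / real N\<bar>) at_bot"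
      by simp
    show "\<forall>\<^sub>F y in at_bot. \<bar>(?F z - ?F y) - (?C y - ?C z) / real N\<bar> \<le> D"
      using eventually_le_at_bot[of z] by eventually_elim (rule osc)
  qed simp
  \<comment> \<open>The window has length \<open>(N + 1) / J\<close> while counts are normalised by
    \<open>N\<close>; the mismatch \<open>1 / (J * N)\<close> is absorbed by
    \<open>2 / t\<close>.\<close>
  have step: "1 / real J \<le> t / (real J * real N)" "t / (real J * real N) \<le> 1 / real J + 2 / t"
  proof -
    show "1 / real J \<le> t / (real J * real N)" using N0 J0 by (simp add: t field_simps)
    have "1 / (real J * real N) \<le> 1 / real N" using N0 J0 J by (simp add: field_simps)
    also have "1 / real N \<le> 2 / t" using N N0 by (simp add: t field_simps)
    finally have "1 / (real J * real N) \<le> 2 / t" .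
    moreover have "t / (real J * real N) = 1 / real J + 1 / (real J * real N)"
      using N0 J0 by (simp add: t field_simps)
    ultimately show "t / (real J * real N) \<le> 1 / real J + 2 / t" by simp
  qed
  have "prob S \<le> t / (real J * real N) + D"
  proof (rule prob_le_cdf_spread[OF cont Sm])
    fix y z assume yz: "y \<in> S" "z \<in> S"
    show "?F z - ?F y \<le> t / (real J * real N) + D"
    proof (cases "y \<le> z")
      case True
      have "?C y - ?C z \<le> t / real J" using yz cc by (auto simp: S)
      then have "(?C y - ?C z) / real N \<le> t / real J / real N" using N0 by (intro divide_right_mono) auto
      then show ?thesis using osc[OF True] by simp
    next
      case False
      then have "?F z \<le> ?F y" by (intro cdf_nondecreasing) simp
      moreover have "0 \<le> t / (real J * real N)" using N0 J0 by (simp add: t)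
      ultimately show ?thesis using D0 by linarith
    qed
  next
    show "0 \<le> t / (real J * real N) + D" using N0 J0 D0 by (simp add: t)
  qed
  moreover have "1 / real J - 2 / t - D \<le> prob S"
  \<comment> \<open>Counts decrease in \<open>y\<close>, so large counts form the low part
    \<open>A\<close> and small counts the high part \<open>B\<close>.\<close>
  proof (rule prob_ge_cdf_gap[OF cont Sm])
    let ?c = "1 / real J - 2 / t - D"
    \<comment> \<open>At either end of the range up to one count may be lost; the loss of at most
      \<open>1 / N\<close> again fits into \<open>2 / t\<close>.\<close>
    have edge: "?c \<le> (t / real J - 1) / real N - D"
    proof -
      have "(t / real J - 1) / real N = 1 / real J - (1 - 1 / real J) / real N"
        using N0 J0 by (simp add: t field_simps)
      moreover have "(1 - 1 / real J) / real N \<le> 1 / real N" using N0 J0 by (intro divide_right_mono) auto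
      moreover have "1 / real N \<le> 2 / t" using N N0 by (simp add: t field_simps)
      ultimately show ?thesis by linarith
    qed
    show "UNIV - S \<subseteq> {y. c2 \<le> ?C y} \<union> {y. ?C y < c1}" by (auto simp: S)
    have "1 / real J \<le> 1" using J J0 by simp
    moreover have "0 \<le> 2 / t" using N0 by (simp add: t)
    ultimately show "?c \<le> 1" using D0 by linarith
    show "?F y + ?c \<le> 1" if "y \<in> {y. c2 \<le> ?C y}" for y
    proof -
      have "t / real J - 1 \<le> ?C y" using that cc c1u by simp
      then have "(t / real J - 1) / real N \<le> ?C y / real N" using N0 by (intro divide_right_mono) auto
      moreover have "(real N - ?C y) / real N = 1 - ?C y / real N" using N0 by (simp add: field_simps)
      ultimately show ?thesis using one[of y] edge by linarith
    qed
    show "?c \<le> ?F z" if "z \<in> {y. ?C y < c1}" for z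
    proof -
      have "t / real J - 1 \<le> real N - ?C z" using that cc c2t by (simp add: t)
      then have "(t / real J - 1) / real N \<le> (real N - ?C z) / real N" using N0 by (intro divide_right_mono) auto
      then show ?thesis using one[of z] edge by linarith
    qed
    show "?F y + ?c \<le> ?F z" if "y \<in> {y. c2 \<le> ?C y}" "z \<in> {y. ?C y < c1}" for y z
    proof -
      have d: "t / real J \<le> ?C y - ?C z" using that cc by simp
      moreover have "0 < t / real J" using J0 by (simp add: t)
      ultimately have "y \<le> z" using exceed_count_antimono[of z y x N] by (cases "y \<le> z") auto
      from d have "t / real J / real N \<le> (?C y - ?C z) / real N" using N0 by (intro divide_right_mono) auto
      then have "1 / real J \<le> (?C y - ?C z) / real N" using step(1) by simp
      moreover have "0 \<le> 2 / t" using N0 by (simp add: t)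
      ultimately show ?thesis using osc[OF \<open>y \<le> z\<close>] by linarith
    qed
  qed
  ultimately show ?thesis using step(2) unfolding S_def[symmetric] t_def[symmetric] by linarith
qed

text \<open>Discretising the range of the distribution function into \<open>g\<close> levels: closed level bands bound
  the number of hits of an interval from above, open ones from below.\<close>

lemma (in real_distribution) oscillation_from_grid:
  fixes x :: "nat \<Rightarrow> real" and g k :: nat
  assumes g: "g \<ge> 1"
    and closed: "\<And>a b. a \<le> b \<Longrightarrow> b \<le> g \<Longrightarrow>
      (\<Sum>q<k. indicator {y. real a / real g \<le> cdf M y \<and> cdf M y \<le> real b / real g} (x q))
        \<le> real k * ((real b - real a) / real g + c)"
    and opn: "\<And>a b. a \<le> b \<Longrightarrow> b \<le> g \<Longrightarrow>
      real k * ((real b - real a) / real g - c)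
        \<le> (\<Sum>q<k. indicator {y. real a / real g < cdf M y \<and> cdf M y < real b / real g} (x q))"
    and c: "0 \<le> c" and yz: "y \<le> z"
  shows "\<bar>(\<Sum>q<k. indicator {y<..z} (x q)) - real k * (cdf M z - cdf M y)\<bar> \<le> real k * (c + 2 / real g)"
proof -
  let ?F = "cdf M" and ?h = "(\<Sum>q<k. indicator {y<..z} (x q)) :: real"
  have g0: "real g > 0" using g by simp
  have F: "0 \<le> ?F y" "?F y \<le> ?F z" "?F z \<le> 1"
    using cdf_nonneg cdf_nondecreasing[OF yz] cdf_bounded_prob by auto
  define Y where "Y = real g * ?F y"
  define Z where "Z = real g * ?F z"
  have Y0: "0 \<le> Y" and YZ: "Y \<le> Z" and Zg: "Z \<le> real g"
    using F g0 by (auto simp: Y_def Z_def mult_left_mono mult_left_le)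
  have hi: "?h \<le> real k * (?F z - ?F y + (c + 2 / real g))"
  proof -
    \<comment> \<open>Rounding outward: the band contains the interval and overshoots by less than
      one level on each side.\<close>
    define a b where "a = nat \<lfloor>Y\<rfloor>" and "b = nat \<lceil>Z\<rceil>"
    have a: "real a \<le> Y" "Y < real a + 1" using Y0 by (auto simp: a_def of_nat_nat)
    have b: "Z \<le> real b" "real b < Z + 1" using Y0 YZ by (auto simp: b_def of_nat_nat) linarith+
    have ab: "a \<le> b" "b \<le> g" using a b YZ Zg by linarith+
    have "?h \<le> (\<Sum>q<k. indicator {w. real a / real g \<le> ?F w \<and> ?F w \<le> real b / real g} (x q))"
    proof (rule sum_mono)
      fix q
      have "real a / real g \<le> ?F y" "?F z \<le> real b / real g"
        using a b g0 by (auto simp: Y_def Z_def field_simps)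
      then have "{y<..z} \<subseteq> {w. real a / real g \<le> ?F w \<and> ?F w \<le> real b / real g}"
        using order_trans[OF _ cdf_nondecreasing[OF less_imp_le]] order_trans[OF cdf_nondecreasing] by auto
      then show "indicator {y<..z} (x q)
          \<le> (indicator {w. real a / real g \<le> ?F w \<and> ?F w \<le> real b / real g} (x q) :: real)"
        by (auto simp: indicator_def)
    qed
    also have "\<dots> \<le> real k * ((real b - real a) / real g + c)" by (rule closed[OF ab])
    also have "\<dots> \<le> real k * (?F z - ?F y + (c + 2 / real g))"
    proof (rule mult_left_mono)
      have "real b - real a \<le> real g * (?F z - ?F y) + 2"
        using a b by (simp add: Y_def Z_def right_diff_distrib)
      then have "(real b - real a) / real g \<le> (real g * (?F z - ?F y) + 2) / real g"
        using g0 by (intro divide_right_mono) auto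
      then show "(real b - real a) / real g + c \<le> ?F z - ?F y + (c + 2 / real g)"
        using g0 by (simp add: add_divide_distrib)
    qed simp
    finally show ?thesis .
  qed
  have lo: "real k * (?F z - ?F y - (c + 2 / real g)) \<le> ?h"
  proof -
    \<comment> \<open>Rounding inward; if the rounded ends cross, the interval spans at most two
      levels and the lower bound is trivial.\<close>
    define a b where "a = nat \<lceil>Y\<rceil>" and "b = nat \<lfloor>Z\<rfloor>"
    have a: "Y \<le> real a" "real a < Y + 1" using Y0 by (auto simp: a_def of_nat_nat) linarith+
    have b: "real b \<le> Z" "Z < real b + 1" using Y0 YZ by (auto simp: b_def of_nat_nat)
    have diff: "real g * (?F z - ?F y) \<le> real b - real a + 2"
      using a b by (simp add: Y_def Z_def right_diff_distrib)
    show ?thesis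
    proof (cases "a \<le> b")
      case True
      have bg: "b \<le> g" using b Zg by linarith
      have "real g * (?F z - ?F y) / real g \<le> (real b - real a + 2) / real g"
        using diff g0 by (intro divide_right_mono) auto
      then have Fd: "?F z - ?F y \<le> (real b - real a) / real g + 2 / real g"
        using g0 by (simp add: add_divide_distrib)
      have "real k * (?F z - ?F y - (c + 2 / real g)) \<le> real k * ((real b - real a) / real g - c)"
        by (rule mult_left_mono) (use Fd in simp_all)
      also have "\<dots> \<le> (\<Sum>q<k. indicator {w. real a / real g < ?F w \<and> ?F w < real b / real g} (x q))"
        by (rule opn[OF True bg])
      also have "\<dots> \<le> ?h"
      proof (rule sum_mono)
        fix q
        have "?F y \<le> real a / real g" "real b / real g \<le> ?F z"
          using a b g0 by (auto simp: Y_def Z_def field_simps)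
        then have "{w. real a / real g < ?F w \<and> ?F w < real b / real g} \<subseteq> {y<..z}"
        proof safe
          fix w assume w: "real a / real g < ?F w" "?F w < real b / real g"
            and "?F y \<le> real a / real g" "real b / real g \<le> ?F z"
          then have "?F y < ?F w" "?F w < ?F z" by auto
          then show "w \<in> {y<..z}" using cdf_nondecreasing[of w y] cdf_nondecreasing[of z w]
            by (cases "w \<le> y"; cases "z \<le> w") auto
        qed
        then show "(indicator {w. real a / real g < ?F w \<and> ?F w < real b / real g} (x q) :: real)
            \<le> indicator {y<..z} (x q)" by (auto simp: indicator_def)
      qed
      finally show ?thesis .
    next
      case False
      then have "real b - real a \<le> 0" by simp
      then have "real g * (?F z - ?F y) \<le> 2" using diff by linarith
      then have "?F z - ?F y \<le> 2 / real g" using g0 by (simp add: field_simps)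
      then have "real k * (?F z - ?F y - (c + 2 / real g)) \<le> 0"
        using c by (intro mult_nonneg_nonpos) auto
      also have "0 \<le> ?h" by (intro sum_nonneg) auto
      finally show ?thesis .
    qed
  qed
  show ?thesis using hi lo by (simp add: abs_le_iff right_diff_distrib distrib_left)
qed

text \<open>The term \<open>1 / (2 * k)\<close> is the discretisation loss \<open>2 / g\<close> of a
  grid with \<open>g = 4 * k\<close>, and \<open>4 * (4 * k + 1)^2\<close> counts pairs of levels,
  open and closed bands, and two tails. With \<open>Q\<close> the argument of the logarithm, the
  doubled \<open>lambda_dev\<close> has exponent \<open>- 4 * ln Q\<close>, so three powers of
  \<open>Q\<close> beyond the required \<open>2 / Q\<close> pay for the grid. The hypothesis
  \<open>small\<close> limits the cross term in \<open>c^2\<close>.\<close>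

lemma grid_union_bound:
  assumes k: "k \<ge> 1" and \<eta>: "0 < \<eta>" "\<eta> < 1" and small: "lambda_dev k \<eta> < 1/2"
  defines "c \<equiv> 2 * lambda_dev k \<eta> - 1 / (2 * real k)"
  shows "0 < c" "4 * (4 * real k + 1)\<^sup>2 * exp (- 2 * real k * c\<^sup>2) \<le> 3 * \<eta> / (pi\<^sup>2 * (real k)\<^sup>2)"
proof -
  define \<Lambda> where "\<Lambda> = lambda_dev k \<eta>"
  define Q where "Q = 2 * pi\<^sup>2 * (real k)\<^sup>2 / (3 * \<eta>)"
  have k0: "real k > 0" using k by simp
  have "9 \<le> pi\<^sup>2" using pi_gt3 power_mono[of 3 pi 2] by simp
  then have "18 * (real k)\<^sup>2 \<le> 2 * pi\<^sup>2 * (real k)\<^sup>2" by (intro mult_right_mono) auto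
  also have "\<dots> \<le> 2 * pi\<^sup>2 * (real k)\<^sup>2 / \<eta>" using \<eta> by (simp add: pos_le_divide_eq mult_left_le)
  also have "\<dots> = 3 * Q" by (simp add: Q_def)
  finally have Q6: "6 * (real k)\<^sup>2 \<le> Q" by simp
  have k1: "1 \<le> (real k)\<^sup>2" using k by (simp add: one_le_power)
  have Q0: "Q \<ge> 6" using Q6 k1 by linarith
  have lnQ: "1 \<le> ln Q"
  proof -
    have "exp 1 \<le> Q" using exp_le Q0 by linarith
    then show ?thesis using Q0 by (simp add: ln_ge_iff)
  qed
  have \<Lambda>: "\<Lambda> = sqrt (ln Q / (2 * real k))" using k by (simp add: \<Lambda>_def lambda_dev_def Q_def)
  have \<Lambda>0: "0 \<le> \<Lambda>" and \<Lambda>2: "\<Lambda>\<^sup>2 = ln Q / (2 * real k)" using lnQ k0 by (auto simp: \<Lambda>)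
  have c: "c = 2 * \<Lambda> - 1 / (2 * real k)" by (simp add: c_def \<Lambda>_def)
  show "0 < c"
  proof -
    have "(1 / (4 * real k))\<^sup>2 < \<Lambda>\<^sup>2"
    proof -
      have "1 * 1 \<le> ln Q * real k" using lnQ k by (intro mult_mono) auto
      then show ?thesis unfolding \<Lambda>2 using k0 by (simp add: power2_eq_square field_simps)
    qed
    then have "1 / (4 * real k) < \<Lambda>" by (rule power2_less_imp_less[OF _ \<Lambda>0])
    then show ?thesis by (simp add: c field_simps)
  qed
  \<comment> \<open>For \<open>k = 1\<close> the bound \<open>ln Q \<ge> 1\<close> would give
    \<open>\<Lambda>^2 \<ge> 1/2\<close>, against \<open>small\<close>. What remains is
    \<open>k \<ge> 2\<close>, hence \<open>Q \<ge> 24\<close> below.\<close>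
  have "k \<noteq> 1"
  proof
    assume "k = 1"
    then have "\<Lambda>\<^sup>2 \<ge> 1/2" using lnQ by (simp add: \<Lambda>2)
    moreover have "\<Lambda>\<^sup>2 < (1/2)\<^sup>2" using small \<Lambda>0 unfolding \<Lambda>_def[symmetric] by (intro power_strict_mono) auto
    ultimately show False by (simp add: power2_eq_square)
  qed
  then have k2: "2 \<le> real k" using k by simp
  have "- 2 * real k * c\<^sup>2 \<le> 2 - 4 * ln Q"
  proof -
    have "2 * real k * c\<^sup>2 = 8 * real k * \<Lambda>\<^sup>2 - 4 * \<Lambda> + 1 / (2 * real k)"
      using k0 unfolding c by (simp add: power2_eq_square field_simps)
    moreover have "8 * real k * \<Lambda>\<^sup>2 = 4 * ln Q" unfolding \<Lambda>2 using k0 by simp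
    moreover have "4 * \<Lambda> \<le> 2" using small by (simp add: \<Lambda>_def)
    moreover have "0 \<le> 1 / (2 * real k)" using k0 by simp
    ultimately show ?thesis by linarith
  qed
  then have "exp (- 2 * real k * c\<^sup>2) \<le> exp (2 - 4 * ln Q)" by simp
  also have "\<dots> = exp 1 * exp 1 / Q ^ 4"
  proof -
    have "exp (4 * ln Q) = Q ^ 4" using Q0 exp_of_nat_mult[of 4 "ln Q"] by simp
    then show ?thesis by (simp add: exp_diff flip: exp_add)
  qed
  also have "\<dots> \<le> 9 / Q ^ 4"
    using exp_le mult_mono[OF exp_le exp_le] Q0 by (intro divide_right_mono) auto
  finally have e: "exp (- 2 * real k * c\<^sup>2) \<le> 9 / Q ^ 4" .
  have "4 * real k + 1 \<le> 5 * real k" using k by simp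
  then have "(4 * real k + 1)\<^sup>2 \<le> (5 * real k)\<^sup>2" by (intro power_mono) auto
  then have "4 * (4 * real k + 1)\<^sup>2 \<le> 100 * (real k)\<^sup>2" by (simp add: power_mult_distrib)
  then have "4 * (4 * real k + 1)\<^sup>2 * exp (- 2 * real k * c\<^sup>2) \<le> 100 * (real k)\<^sup>2 * (9 / Q ^ 4)"
    by (rule mult_mono) (use e in auto)
  also have "\<dots> \<le> 2 / Q"
  proof -
    have "4 \<le> (real k)\<^sup>2" using k2 power_mono[of 2 "real k" 2] by simp
    then have "24 \<le> Q" "24 * (real k)\<^sup>2 \<le> Q * (real k)\<^sup>2" using Q6 by (linarith, intro mult_right_mono) auto
    have "450 * (real k)\<^sup>2 \<le> 75 * Q" using Q6 by simp
    also have "\<dots> \<le> Q\<^sup>2 * Q"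
    proof (rule mult_right_mono)
      have "24 * 24 \<le> Q * Q" using \<open>24 \<le> Q\<close> by (intro mult_mono) auto
      then show "75 \<le> Q\<^sup>2" by (simp add: power2_eq_square)
    qed (use Q0 in simp)
    finally have "450 * (real k)\<^sup>2 \<le> Q\<^sup>2 * Q" .
    then show ?thesis using Q0 by (simp add: field_simps power4_eq_xxxx power2_eq_square)
  qed
  also have "2 / Q = 3 * \<eta> / (pi\<^sup>2 * (real k)\<^sup>2)" using \<eta> k0 by (simp add: Q_def field_simps)
  finally show "4 * (4 * real k + 1)\<^sup>2 * exp (- 2 * real k * c\<^sup>2) \<le> 3 * \<eta> / (pi\<^sup>2 * (real k)\<^sup>2)" .
qed

section \<open>The good event\<close>

context change_point_model
begin

lemma integral_obs_law:
  assumes f: "f \<in> borel_measurable (borel \<Otimes>\<^sub>M borel)" and bounds: "\<And>v. f v \<in> {0..1::real}"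
  shows "(\<integral>v. f v \<partial>obs_law) = (\<integral>u. (\<integral>x. f (u, x) \<partial>F1) \<partial>uniform_measure lborel {0<..<1})"
    and "integrable (uniform_measure lborel {0<..<1}) (\<lambda>u. (\<integral>x. f (u, x) \<partial>F1))"
proof -
  interpret F: prob_space F1 by (rule prob_space_F1)
  interpret V: prob_space "uniform_measure lborel {0<..<1::real}" by (rule prob_space_unif)
  interpret P: pair_prob_space "uniform_measure lborel {0<..<1::real}" F1 ..
  have fm: "f \<in> borel_measurable obs_law" using f by (simp cong: measurable_cong_sets)
  have int: "integrable obs_law f"
    using fm bounds prob_space.finite_measure[OF prob_space_obs_law]
    by (intro finite_measure.integrable_const_bound[of _ _ 1]) auto
  then show "(\<integral>v. f v \<partial>obs_law) = (\<integral>u. (\<integral>x. f (u, x) \<partial>F1) \<partial>uniform_measure lborel {0<..<1})"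
    unfolding obs_law_def by (rule P.integral_fst'[symmetric])
  show "integrable (uniform_measure lborel {0<..<1}) (\<lambda>u. (\<integral>x. f (u, x) \<partial>F1))"
    using int unfolding obs_law_def by (rule P.integrable_fst')
qed

lemma AE_unif: "AE u in uniform_measure lborel {0<..<1::real}. 0 < u \<and> u < 1"
  by (rule AE_uniform_measureI) auto

lemma obs_mean_indicator:
  assumes "T \<in> sets borel"
  shows "obs_mean (\<lambda>(\<omega>, u, x). indicator T x) \<omega> = measure F1 T"
proof -
  interpret F: real_distribution F1 by (rule F1_distribution)
  interpret V: prob_space "uniform_measure lborel {0<..<1::real}" by (rule prob_space_unif)
  have m: "(\<lambda>v. indicator T (snd v) :: real) \<in> borel_measurable (borel \<Otimes>\<^sub>M borel)"
    using assms by measurable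
  have b: "indicator T (snd v) \<in> {0..1::real}" for v :: "real \<times> real"
    by (auto simp: indicator_def)
  show ?thesis
    using integral_obs_law(1)[OF m b] V.prob_space by (simp add: obs_mean_def case_prod_beta)
qed

text \<open>Uncountably many intervals are reduced to finitely many level bands, each controlled by
  \<open>azuma\<close> given the history. A measurable \<open>Bad\<close> that covers the failures
  avoids the question whether the supremum over intervals is measurable.\<close>

lemma exists_oscillation_event:
  assumes n: "\<tau> \<le> n" and k: "k \<ge> 1" and \<eta>: "0 < \<eta>" "\<eta> < 1"
  obtains Bad where "Bad \<in> events"
    and "\<And>\<omega> y z. \<omega> \<in> space M - Bad \<Longrightarrow> y \<le> z \<Longrightarrow>
      \<bar>(\<Sum>q<k. indicator {y<..z} (X (n + q + 1) \<omega>)) - real k * (cdf F1 z - cdf F1 y)\<bar>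
        \<le> real k * (2 * lambda_dev k \<eta>)"
    and "\<And>B. B \<in> sets (hist n) \<Longrightarrow> prob (B \<inter> Bad) \<le> 3 * \<eta> / (pi\<^sup>2 * (real k)\<^sup>2) * prob B"
proof (cases "lambda_dev k \<eta> < 1/2")
  case False
  interpret F: real_distribution F1 by (rule F1_distribution)
  show ?thesis
  \<comment> \<open>With \<open>lambda_dev\<close> at least 1/2 the allowed oscillation is at least
    1 per observation, so nothing can fail.\<close>
  proof (rule that[of "{}"])
    fix \<omega> and y z :: real assume yz: "y \<le> z"
    have k0: "0 \<le> real k" by simp
    have "(\<Sum>q<k. indicator {y<..z} (X (n + q + 1) \<omega>)) \<le> (\<Sum>q<k. 1 :: real)"
      by (intro sum_mono) (auto simp: indicator_def)
    then have h1: "(\<Sum>q<k. indicator {y<..z} (X (n + q + 1) \<omega>)) \<le> real k" by simp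
    have h0: "0 \<le> (\<Sum>q<k. indicator {y<..z} (X (n + q + 1) \<omega>) :: real)" by (intro sum_nonneg) auto
    have "cdf F1 z - cdf F1 y \<in> {0..1}"
      using F.cdf_nondecreasing[OF yz] F.cdf_nonneg[of y] F.cdf_bounded_prob[of z] by auto
    then have "0 \<le> real k * (cdf F1 z - cdf F1 y)" "real k * (cdf F1 z - cdf F1 y) \<le> real k * 1"
      using mult_left_mono[of "cdf F1 z - cdf F1 y" 1 "real k"] by auto
    moreover have "real k * 1 \<le> real k * (2 * lambda_dev k \<eta>)" using False by (intro mult_left_mono) auto
    ultimately show "\<bar>(\<Sum>q<k. indicator {y<..z} (X (n + q + 1) \<omega>)) - real k * (cdf F1 z - cdf F1 y)\<bar>
        \<le> real k * (2 * lambda_dev k \<eta>)" using h0 h1 by linarith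
  qed (use \<eta> in auto)
next
  case True
  interpret F: real_distribution F1 by (rule F1_distribution)
  define g where "g = 4 * k"
  define c where "c = 2 * lambda_dev k \<eta> - 1 / (2 * real k)"
  note c = grid_union_bound[OF k \<eta> True, folded c_def]
  note [measurable] = F.cdf_borel[OF F1_continuous]
  define T where "T s a b = (if s then {y. real a / real g \<le> cdf F1 y \<and> cdf F1 y \<le> real b / real g}
      else {y. real a / real g < cdf F1 y \<and> cdf F1 y < real b / real g})" for s :: bool and a b :: nat
  have Tm: "T s a b \<in> sets borel" for s a b
  proof (cases s)
    case True
    have "{y. real a / real g \<le> cdf F1 y \<and> cdf F1 y \<le> real b / real g} \<in> sets borel" by measurable
    then show ?thesis by (simp add: T_def True)
  next
    case False
    have "{y. real a / real g < cdf F1 y \<and> cdf F1 y < real b / real g} \<in> sets borel" by measurable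
    then show ?thesis by (simp add: T_def False)
  qed
  have g0: "real g > 0" using k by (simp add: g_def)
  have T: "measure F1 (T s a b) = (real b - real a) / real g" if "a \<le> b" "b \<le> g" for s a b
    unfolding T_def using F.prob_cdf_interval[OF F1_continuous, of "real a / real g" "real b / real g"] that g0
    by (auto simp: diff_divide_distrib divide_right_mono)
  \<comment> \<open>The summands ignore the history, so their compensator is constant and
    \<open>mart_sum\<close> is a centred count.\<close>
  define f where "f s a b = (\<lambda>t::nat. \<lambda>(\<omega>::'w, u::real, x::real). indicator (T s a b) x :: real)" for s a b
  have fm: "f s a b t \<in> borel_measurable (hist t \<Otimes>\<^sub>M (borel \<Otimes>\<^sub>M borel))" for s a b t
    unfolding f_def case_prod_beta using Tm[of s a b] by measurable
  have fb: "f s a b t z \<in> {0..1}" for s a b t z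
    by (auto simp: f_def case_prod_beta indicator_def)
  have ms: "mart_sum (f s a b) n k \<omega> = (\<Sum>q<k. indicator (T s a b) (X (n + q + 1) \<omega>)) - real k * measure F1 (T s a b)"
    for s a b \<omega>
    using obs_mean_indicator[OF Tm[of s a b], of \<omega>] by (simp add: mart_sum_def f_def sum_subtractf)
  define I :: "(bool \<times> nat \<times> nat) set" where "I = UNIV \<times> {0..g} \<times> {0..g}"
  have I: "finite I" "card I = 2 * (g + 1)\<^sup>2" by (auto simp: I_def power2_eq_square)
  define E where "E = (\<lambda>(s, a, b). {\<omega> \<in> space M. real k * c \<le> \<bar>mart_sum (f s a b) n k \<omega>\<bar>})"
  define Bad where "Bad = (\<Union>i\<in>I. E i)"
  have msm: "mart_sum (f s a b) n k \<in> borel_measurable M" for s a b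
    by (rule measurable_from_subalg[OF subalgebra_hist mart_sum_measurable[OF fm]])
  have Em: "E i \<in> events" for i unfolding E_def using msm by (cases i) simp
  show ?thesis
  proof (rule that[of Bad])
    show "Bad \<in> events" unfolding Bad_def using I(1) Em by blast
    fix \<omega> and y z :: real assume \<omega>: "\<omega> \<in> space M - Bad" and yz: "y \<le> z"
    have small: "\<bar>(\<Sum>q<k. indicator (T s a b) (X (n + q + 1) \<omega>)) - real k * ((real b - real a) / real g)\<bar> < real k * c"
      if "a \<le> b" "b \<le> g" for s a b
    proof -
      have "(s, a, b) \<in> I" using that by (auto simp: I_def)
      then have "\<not> real k * c \<le> \<bar>mart_sum (f s a b) n k \<omega>\<bar>" using \<omega> by (force simp: Bad_def E_def)
      then show ?thesis using T[OF that, of s] by (simp add: ms)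
    qed
    have "\<bar>(\<Sum>q<k. indicator {y<..z} (X (n + q + 1) \<omega>)) - real k * (cdf F1 z - cdf F1 y)\<bar>
        \<le> real k * (c + 2 / real g)"
    proof (rule F.oscillation_from_grid)
      fix a b assume ab: "a \<le> b" "b \<le> g"
      show "(\<Sum>q<k. indicator {y. real a / real g \<le> cdf F1 y \<and> cdf F1 y \<le> real b / real g} (X (n + q + 1) \<omega>))
        \<le> real k * ((real b - real a) / real g + c)"
        using small[OF ab, of True] by (simp add: T_def distrib_left abs_less_iff)
      show "real k * ((real b - real a) / real g - c)
        \<le> (\<Sum>q<k. indicator {y. real a / real g < cdf F1 y \<and> cdf F1 y < real b / real g} (X (n + q + 1) \<omega>))"
        using small[OF ab, of False] by (simp add: T_def right_diff_distrib abs_less_iff)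
    qed (use c k yz in \<open>auto simp: g_def\<close>)
    also have "c + 2 / real g = 2 * lambda_dev k \<eta>" using k by (simp add: c_def g_def)
    finally show "\<bar>(\<Sum>q<k. indicator {y<..z} (X (n + q + 1) \<omega>)) - real k * (cdf F1 z - cdf F1 y)\<bar>
        \<le> real k * (2 * lambda_dev k \<eta>)" .
  next
    fix B assume B: "B \<in> sets (hist n)"
    have BM: "B \<in> events" using B subalgebra_hist[of n] by (auto simp: subalgebra_def)
    have "prob (B \<inter> Bad) = prob (\<Union>i\<in>I. B \<inter> E i)" by (simp add: Bad_def)
    also have "\<dots> \<le> (\<Sum>i\<in>I. prob (B \<inter> E i))"
      by (rule measure_UNION_le[OF I(1)]) (use BM Em in auto)
    also have "\<dots> \<le> (\<Sum>i\<in>I. 2 * exp (- 2 * real k * c\<^sup>2) * prob B)"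
    proof (rule sum_mono)
      fix i assume "i \<in> I"
      obtain s a b where i: "i = (s, a, b)" by (cases i)
      have "B \<inter> E i = {\<omega> \<in> B. real k * c \<le> \<bar>mart_sum (f s a b) n k \<omega>\<bar>}"
        using sets.sets_into_space[OF BM] by (auto simp: E_def i)
      then show "prob (B \<inter> E i) \<le> 2 * exp (- 2 * real k * c\<^sup>2) * prob B"
        using azuma[where f = "f s a b" and l = k, OF n order_refl fm fb B c(1)] by simp
    qed
    also have "\<dots> = 4 * (4 * real k + 1)\<^sup>2 * exp (- 2 * real k * c\<^sup>2) * prob B"
      by (simp add: I(2) g_def)
    also have "\<dots> \<le> 3 * \<eta> / (pi\<^sup>2 * (real k)\<^sup>2) * prob B"
      by (rule mult_right_mono[OF c(2)]) simp
    finally show "prob (B \<inter> Bad) \<le> 3 * \<eta> / (pi\<^sup>2 * (real k)\<^sup>2) * prob B" .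
  qed
qed

text \<open>The new pair is kept as separate arguments, to be integrated out by
  \<open>obs_mean\<close>; \<omega> matters only through \<open>X 1\<close> to \<open>X t\<close>,
  hence measurability over the history at \<open>t\<close>.\<close>

definition bin_hit :: "nat \<Rightarrow> nat \<Rightarrow> nat \<Rightarrow> 'w \<times> real \<times> real \<Rightarrow> real" where
  "bin_hit J j t = (\<lambda>(\<omega>, u, x). indicator (bin J j)
     ((exceed_count (\<lambda>r. X r \<omega>) t x + u) / real (t + 1)))"

lemma bin_hit_measurable: "bin_hit J j t \<in> borel_measurable (hist t \<Otimes>\<^sub>M (borel \<Otimes>\<^sub>M borel))"
proof -
  have "(\<lambda>z. exceed_count (\<lambda>r. X r (fst z)) t (snd (snd z))) \<in> borel_measurable (hist t \<Otimes>\<^sub>M (borel \<Otimes>\<^sub>M borel))"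
    unfolding exceed_count_def
  proof (rule borel_measurable_sum)
    fix r assume r: "r \<in> {1..<t+1}"
    show "(\<lambda>z. if snd (snd z) < X r (fst z) then 1 else 0 :: real) \<in> borel_measurable (hist t \<Otimes>\<^sub>M (borel \<Otimes>\<^sub>M borel))"
    proof -
      have [measurable]: "X r \<in> borel_measurable (hist t)" using r by (intro X_hist) auto
      show ?thesis by measurable
    qed
  qed
  note [measurable] = this
  show ?thesis unfolding bin_hit_def case_prod_beta by measurable
qed

lemma bin_hit_bounds: "bin_hit J j t z \<in> {0..1}"
  by (auto simp: bin_hit_def case_prod_beta indicator_def)

lemma bin_hit_obs: "bin_hit J j t (\<omega>, obs (t + 1) \<omega>) = indicator (bin J j) (pvals X U \<omega> (t + 1))"
  by (simp add: bin_hit_def pvals_def exceed_count_def)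

text \<open>The first \<open>d\<close> observations contribute an oscillation of at most
  \<open>2 * b\<close>, pathwise and whatever their law; the \<open>k\<close> later ones contribute
  \<open>2 * lambda_dev k\<close>. Weighted by sample size these give \<open>D\<close>, and the
  rounding loss \<open>2 / (N + 1)\<close> completes \<open>delta_dev\<close> at index
  \<open>k + 1\<close>.\<close>

lemma obs_mean_bin_hit:
  assumes d: "d \<ge> 1" and J: "J \<ge> 1" and j: "j \<in> {1..J}"
    and osc: "\<And>y z. k \<ge> 1 \<Longrightarrow> y \<le> z \<Longrightarrow>
      \<bar>(\<Sum>q<k. indicator {y<..z} (X (d + q + 1) \<omega>)) - real k * (cdf F1 z - cdf F1 y)\<bar>
        \<le> real k * (2 * lambda_dev k \<eta>)"
  shows "\<bar>obs_mean (bin_hit J j (d + k)) \<omega> - 1 / real J\<bar>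
    \<le> delta_dev d (k + 1) (emp_deviation (\<lambda>t. X t \<omega>) (cdf F1) d) \<eta>"
proof -
  interpret F: real_distribution F1 by (rule F1_distribution)
  interpret V: prob_space "uniform_measure lborel {0<..<1::real}" by (rule prob_space_unif)
  let ?F = "cdf F1" and ?x = "\<lambda>r. X r \<omega>"
  define b where "b = emp_deviation ?x ?F d"
  define N where "N = d + k"
  define D where "D = real d / real N * (2 * b) + real k / real N * (2 * lambda_dev k \<eta>)"
  have d0: "real d > 0" and N0: "real N > 0" using d by (auto simp: N_def)
  have old: "\<bar>real d * (?F z - ?F y) - (\<Sum>r = 1..<d+1. indicator {y<..z} (?x r))\<bar> \<le> real d * (2 * b)"
    if "y \<le> z" for y z
  proof -
    let ?S = "\<lambda>y. (\<Sum>l = 1..d. if ?x l \<le> y then 1 else 0 :: real)"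
    have "\<bar>1 / real d * ?S y - ?F y\<bar> \<le> b" "\<bar>1 / real d * ?S z - ?F z\<bar> \<le> b"
      unfolding b_def by (rule F.emp_deviation_upper)+
    then have "\<bar>(?F z - ?F y) - (?S z - ?S y) / real d\<bar> \<le> 2 * b"
      by (simp add: diff_divide_distrib)
    then have "real d * \<bar>(?F z - ?F y) - (?S z - ?S y) / real d\<bar> \<le> real d * (2 * b)"
      using d0 by (intro mult_left_mono) auto
    moreover have "real d * \<bar>(?F z - ?F y) - (?S z - ?S y) / real d\<bar> = \<bar>real d * ((?F z - ?F y) - (?S z - ?S y) / real d)\<bar>"
      using d0 by (simp add: abs_mult)
    moreover have "real d * ((?F z - ?F y) - (?S z - ?S y) / real d) = real d * (?F z - ?F y) - (?S z - ?S y)"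
    proof -
      have "x * (u - v / x) = x * u - v" if "x > 0" for x u v :: real
        using that by (simp add: field_simps)
      from this[OF d0] show ?thesis .
    qed
    moreover have "?S z - ?S y = (\<Sum>r = 1..<d+1. indicator {y<..z} (?x r))"
      unfolding sum_subtractf[symmetric] using that
      by (intro sum.cong) (auto simp: indicator_def)
    ultimately show ?thesis by simp
  qed
  have oscN: "\<bar>(?F z - ?F y) - (exceed_count ?x N y - exceed_count ?x N z) / real N\<bar> \<le> D"
    if yz: "y \<le> z" for y z
  proof -
    have split: "(\<Sum>r = 1..<N+1. indicator {y<..z} (?x r))
        = (\<Sum>r = 1..<d+1. indicator {y<..z} (?x r)) + (\<Sum>q<k. indicator {y<..z} (X (d + q + 1) \<omega>) :: real)"
    proof -
      have "(\<Sum>r = d+1..<N+1. indicator {y<..z} (?x r) :: real)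
          = (\<Sum>q = 0..<k. indicator {y<..z} (?x (q + (d + 1))))"
        using sum.shift_bounds_nat_ivl[of "\<lambda>r. indicator {y<..z} (?x r) :: real" 0 "d + 1" k]
        by (simp add: N_def add_ac)
      then show ?thesis
        using sum.atLeastLessThan_concat[of 1 "d + 1" "N + 1" "\<lambda>r. indicator {y<..z} (?x r) :: real"]
        by (simp add: N_def lessThan_atLeast0 add_ac)
    qed
    let ?A = "\<Sum>r = 1..<d+1. indicator {y<..z} (?x r) :: real"
    let ?B = "\<Sum>q<k. indicator {y<..z} (X (d + q + 1) \<omega>) :: real"
    have new: "\<bar>?B - real k * (?F z - ?F y)\<bar> \<le> real k * (2 * lambda_dev k \<eta>)"
      using osc[OF _ yz] by (cases "k = 0") auto
    have "\<bar>real N * (?F z - ?F y) - (?A + ?B)\<bar> \<le> real d * (2 * b) + real k * (2 * lambda_dev k \<eta>)"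
      using old[OF yz] new by (simp add: N_def distrib_right)
    then have "\<bar>real N * (?F z - ?F y) - (?A + ?B)\<bar> / real N
        \<le> (real d * (2 * b) + real k * (2 * lambda_dev k \<eta>)) / real N"
      using N0 by (intro divide_right_mono) auto
    also have "\<dots> = D" by (simp add: D_def add_divide_distrib)
    also have "\<bar>real N * (?F z - ?F y) - (?A + ?B)\<bar> / real N
        = \<bar>(?F z - ?F y) - (?A + ?B) / real N\<bar>"
    proof -
      have "(?F z - ?F y) - (?A + ?B) / real N = (real N * (?F z - ?F y) - (?A + ?B)) / real N"
        using N0 by (simp add: diff_divide_distrib)
      then show ?thesis using N0 by (simp add: abs_divide)
    qed
    finally show ?thesis unfolding exceed_count_diff[OF yz] split .
  qed
  \<comment> \<open>The hit probability for a fixed randomiser; its bound is uniform over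
    \<open>0 < u < 1\<close> and survives averaging over \<open>u\<close>.\<close>
  define G where "G u = measure F1 {y. (exceed_count ?x N y + u) / real (N + 1) \<in> bin J j}" for u
  have Gb: "\<bar>G u - 1 / real J\<bar> \<le> D + 2 / real (N + 1)" if "0 < u \<and> u < 1" for u
    unfolding G_def by (rule F.prob_bin_near_uniform[OF F1_continuous J j _ _ _ oscN]) (use that d N_def in auto)
  define f where "f = (\<lambda>(u, y). indicator (bin J j) ((exceed_count ?x N y + u) / real (N + 1)) :: real)"
  have fm: "f \<in> borel_measurable (borel \<Otimes>\<^sub>M borel)"
    unfolding f_def case_prod_beta by measurable
  have fb: "f v \<in> {0..1}" for v by (auto simp: f_def case_prod_beta indicator_def)
  have inner: "(\<integral>y. f (u, y) \<partial>F1) = G u" for u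
  proof -
    have "(\<integral>y. f (u, y) \<partial>F1) = (\<integral>y. indicator {y. (exceed_count ?x N y + u) / real (N + 1) \<in> bin J j} y \<partial>F1)"
      by (rule Bochner_Integration.integral_cong) (auto simp: f_def indicator_def)
    also have "\<dots> = G u" by (simp add: G_def)
    finally show ?thesis .
  qed
  have iG: "integrable (uniform_measure lborel {0<..<1}) G"
    using integral_obs_law(2)[OF fm fb] by (simp add: inner)
  have "obs_mean (bin_hit J j N) \<omega> = (\<integral>v. f v \<partial>obs_law)"
    by (simp add: obs_mean_def bin_hit_def f_def case_prod_beta)
  also have "\<dots> = (\<integral>u. G u \<partial>uniform_measure lborel {0<..<1})"
    using integral_obs_law(1)[OF fm fb] by (simp only: inner)
  finally have "obs_mean (bin_hit J j N) \<omega> = (\<integral>u. G u \<partial>uniform_measure lborel {0<..<1})" .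
  then have "obs_mean (bin_hit J j N) \<omega> - 1 / real J = (\<integral>u. G u - 1 / real J \<partial>uniform_measure lborel {0<..<1})"
    using iG V.prob_space by simp
  also have "\<bar>\<dots>\<bar> \<le> (\<integral>u. \<bar>G u - 1 / real J\<bar> \<partial>uniform_measure lborel {0<..<1})"
    by (rule integral_abs_bound)
  also have "\<dots> \<le> (\<integral>u. D + 2 / real (N + 1) \<partial>uniform_measure lborel {0<..<1::real})"
  proof (rule integral_mono_AE)
    show "integrable (uniform_measure lborel {0<..<1}) (\<lambda>u. \<bar>G u - 1 / real J\<bar>)" using iG by simp
    show "AE u in uniform_measure lborel {0<..<1}. \<bar>G u - 1 / real J\<bar> \<le> D + 2 / real (N + 1)"
      using AE_unif by (rule eventually_mono) (rule Gb)
  qed simp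
  also have "\<dots> = D + 2 / real (N + 1)" using V.prob_space by simp
  also have "\<dots> = delta_dev d (k + 1) b \<eta>"
    by (simp add: D_def delta_dev_def N_def add_ac mult_ac distrib_left)
  finally show ?thesis by (simp add: b_def N_def)
qed

end

lemma (in finite_measure) measure_Int_UN_le:
  assumes A: "\<And>k::nat. A k \<in> sets M" and B: "B \<in> sets M"
    and le: "\<And>k. measure M (B \<inter> A k) \<le> c k * P" and c: "c sums C"
  shows "measure M (B \<inter> (\<Union>k. A k)) \<le> C * P"
proof -
  have cP: "(\<lambda>k. c k * P) sums (C * P)" by (rule sums_mult2[OF c])
  have sm: "summable (\<lambda>k. measure M (B \<inter> A k))"
    by (rule summable_comparison_test[OF _ sums_summable[OF cP]]) (use le in auto)
  have "measure M (B \<inter> (\<Union>k. A k)) = measure M (\<Union>k. B \<inter> A k)" by simp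
  also have "\<dots> \<le> (\<Sum>k. measure M (B \<inter> A k))"
    by (rule finite_measure_subadditive_countably) (use A B sm in auto)
  also have "\<dots> \<le> (\<Sum>k. c k * P)"
    by (rule suminf_le[OF le sm sums_summable[OF cP]])
  also have "\<dots> = C * P" using sums_unique[OF cP] by simp
  finally show ?thesis .
qed

lemma sums_inverse_squares_scaled:
  "(\<lambda>k. c / (real (Suc k))\<^sup>2) sums (c * (pi\<^sup>2 / 6))"
  using sums_mult[OF inverse_squares_sums, of c] by (simp add: add.commute)

context change_point_model
begin

lemma pvals_in_unit_interval:
  assumes "1 \<le> t" "0 < U t \<omega>" "U t \<omega> < 1"
  shows "0 \<le> pvals X U \<omega> t \<and> pvals X U \<omega> t \<le> 1"
proof -
  have e: "(\<Sum>r = 1..<t. if X r \<omega> > X t \<omega> then 1 else 0) = exceed_count (\<lambda>r. X r \<omega>) (t - 1) (X t \<omega>)"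
    using assms(1) by (simp add: exceed_count_def)
  show ?thesis
    unfolding pvals_def e
    using exceed_count_bounds[of "\<lambda>r. X r \<omega>" "t - 1" "X t \<omega>"] assms by (simp add: of_nat_diff field_simps)
qed

lemma AE_U: "1 \<le> t \<Longrightarrow> AE \<omega> in M. 0 < U t \<omega> \<and> U t \<omega> < 1"
  using AE_unif U_uniform[of t] U_measurable[of t]
  by (subst (asm) U_uniform[symmetric, of t]) (auto simp: AE_distr_iff)

text \<open>Three kinds of failure are removed: randomisers outside the open unit interval (a null
  set), oscillations \<open>Osc\<close> for each sample size, and count deviations
  \<open>Dev\<close> for each window. What remains is pathwise, for every window and bin at once,
  and the last clause makes its probability bound conditional on the history at
  \<open>n\<close>.\<close>

lemma exists_good_event:
  assumes n: "\<tau> + 1 \<le> n" and J: "J \<ge> 2" and \<eta>: "0 < \<eta>" "\<eta> < 1"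
  obtains Good where "Good \<in> events"
    and "\<And>\<omega> t. \<omega> \<in> Good \<Longrightarrow> 1 \<le> t \<Longrightarrow> 0 \<le> pvals X U \<omega> t \<and> pvals X U \<omega> t \<le> 1"
    and "\<And>\<omega> r l j. \<omega> \<in> Good \<Longrightarrow> l \<ge> 1 \<Longrightarrow> j \<in> {1..J} \<Longrightarrow>
      \<bar>theta_hat J (pvals X U \<omega>) (n + r + l) (n + r) j - 1 / real J\<bar>
        \<le> a_R J n r l (emp_deviation (\<lambda>t. X t \<omega>) (cdf F1) n) \<eta>"
    and "\<And>B. B \<in> sets (hist n) \<Longrightarrow> (1 - \<eta>) * prob B \<le> prob (Good \<inter> B)"
proof -
  have n1: "\<tau> \<le> n" "1 \<le> n" using n by auto
  have J0: "real J > 0" using J by simp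
  define Z where "Z = {\<omega> \<in> space M. \<forall>k. 0 < U (Suc k) \<omega> \<and> U (Suc k) \<omega> < 1}"
  have Zm: "Z \<in> events"
  proof -
    have [measurable]: "U (Suc k) \<in> borel_measurable M" for k by (rule U_measurable) simp
    show ?thesis unfolding Z_def by measurable
  qed
  have "AE \<omega> in M. \<forall>k. 0 < U (Suc k) \<omega> \<and> U (Suc k) \<omega> < 1"
    unfolding AE_all_countable by (intro allI AE_U) simp
  then have Z1: "prob (space M - Z) = 0"
    using prob_compl[OF Zm] prob_eq_1[OF Zm] by (simp add: Z_def)

  define oscP where "oscP k \<omega> \<longleftrightarrow> (\<forall>y z. y \<le> z \<longrightarrow>
      \<bar>(\<Sum>q<k. indicator {y<..z} (X (n + q + 1) \<omega>)) - real k * (cdf F1 z - cdf F1 y)\<bar>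
        \<le> real k * (2 * lambda_dev k \<eta>))" for k \<omega>
  \<comment> \<open>Indices are shifted: the event chosen for \<open>k\<close> handles samples of
    size \<open>k + 1\<close>, which matches the form of the inverse-square series.\<close>
  have "\<forall>k. \<exists>Bad. Bad \<in> events \<and> (\<forall>\<omega>\<in>space M - Bad. oscP (Suc k) \<omega>) \<and>
      (\<forall>B\<in>sets (hist n). prob (B \<inter> Bad) \<le> (3 * \<eta> / pi\<^sup>2) / (real (Suc k))\<^sup>2 * prob B)"
  proof
    fix k
    obtain Bad where "Bad \<in> events"
      "\<And>\<omega> y z. \<omega> \<in> space M - Bad \<Longrightarrow> y \<le> z \<Longrightarrow>
        \<bar>(\<Sum>q<Suc k. indicator {y<..z} (X (n + q + 1) \<omega>)) - real (Suc k) * (cdf F1 z - cdf F1 y)\<bar>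
          \<le> real (Suc k) * (2 * lambda_dev (Suc k) \<eta>)"
      "\<And>B. B \<in> sets (hist n) \<Longrightarrow> prob (B \<inter> Bad) \<le> 3 * \<eta> / (pi\<^sup>2 * (real (Suc k))\<^sup>2) * prob B"
      using exists_oscillation_event[OF n1(1) _ \<eta>, of "Suc k"] by auto
    then show "\<exists>Bad. Bad \<in> events \<and> (\<forall>\<omega>\<in>space M - Bad. oscP (Suc k) \<omega>) \<and>
      (\<forall>B\<in>sets (hist n). prob (B \<inter> Bad) \<le> (3 * \<eta> / pi\<^sup>2) / (real (Suc k))\<^sup>2 * prob B)"
      by (intro exI[of _ Bad]) (simp add: oscP_def)
  qed
  from choice[OF this] obtain Osc where
    Osc: "\<And>k. Osc k \<in> events" "\<And>k \<omega>. \<omega> \<in> space M - Osc k \<Longrightarrow> oscP (Suc k) \<omega>"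
      "\<And>k B. B \<in> sets (hist n) \<Longrightarrow> prob (B \<inter> Osc k) \<le> (3 * \<eta> / pi\<^sup>2) / (real (Suc k))\<^sup>2 * prob B"
    by blast

  \<comment> \<open>The square-root part of \<open>a_R\<close>, tuned so that the two-sided tails
    over the \<open>J\<close> bins sum to
    \<open>18 * \<eta> / (pi^4 * (r+1)^2 * l^2)\<close>.\<close>
  define c where "c r l = sqrt (1 / (2 * real l) *
      ln (real J * pi ^ 4 * (real r + 1)\<^sup>2 * (real l)\<^sup>2 / (9 * \<eta>)))" for r l
  have c: "c r l > 0 \<and> 2 * exp (- 2 * real l * (c r l)\<^sup>2) = 18 * \<eta> / (real J * pi ^ 4 * (real r + 1)\<^sup>2 * (real l)\<^sup>2)"
    if l: "l \<ge> 1" for r l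
  proof -
    define W where "W = real J * pi ^ 4 * (real r + 1)\<^sup>2 * (real l)\<^sup>2 / (9 * \<eta>)"
    have "(9::real) < 3 ^ 4" by simp
    also have "\<dots> \<le> pi ^ 4" using pi_gt3 by (intro power_mono) auto
    finally have pi9: "9 < pi ^ 4" .
    have "1 * 9 * 1 * 1 \<le> real J * pi ^ 4 * (real r + 1)\<^sup>2 * (real l)\<^sup>2"
      using pi9 J l by (intro mult_mono) (auto simp: one_le_power)
    moreover have "9 * \<eta> < 9" using \<eta> by simp
    ultimately have W1: "W > 1" unfolding W_def using \<eta> by (subst less_divide_eq_1_pos) auto
    then have lnW: "ln W > 0" by simp
    have c2: "(c r l)\<^sup>2 = 1 / (2 * real l) * ln W"
      unfolding c_def W_def[symmetric] using lnW l by simp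
    have "c r l > 0" unfolding c_def W_def[symmetric] using lnW l by simp
    moreover have "- 2 * real l * (c r l)\<^sup>2 = - ln W" unfolding c2 using l by simp
    then have "exp (- 2 * real l * (c r l)\<^sup>2) = 1 / W" using W1 by (simp add: exp_minus inverse_eq_divide)
    moreover have "2 * (1 / W) = 18 * \<eta> / (real J * pi ^ 4 * (real r + 1)\<^sup>2 * (real l)\<^sup>2)"
      using \<eta> by (simp add: W_def)
    ultimately show ?thesis by simp
  qed
  have ms_m: "mart_sum (bin_hit J j) s l \<in> borel_measurable M" for j s l
    by (rule measurable_from_subalg[OF subalgebra_hist mart_sum_measurable[OF bin_hit_measurable]])
  define Dev where "Dev r k = (\<Union>j\<in>{1..J}. {\<omega> \<in> space M.
      real (Suc k) * c r (Suc k) \<le> \<bar>mart_sum (bin_hit J j) (n + r) (Suc k) \<omega>\<bar>})" for r k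
  have Devm: "Dev r k \<in> events" for r k unfolding Dev_def using ms_m by simp
  have Devp: "prob (B \<inter> Dev r k) \<le> (18 * \<eta> / (pi ^ 4 * (real (Suc r))\<^sup>2)) / (real (Suc k))\<^sup>2 * prob B"
    if B: "B \<in> sets (hist n)" for B r k
  proof -
    have BM: "B \<in> events" using B subalgebra_hist[of n] by (auto simp: subalgebra_def)
    define E where "E j = {\<omega> \<in> B. real (Suc k) * c r (Suc k) \<le> \<bar>mart_sum (bin_hit J j) (n + r) (Suc k) \<omega>\<bar>}" for j
    have Em: "E j \<in> events" for j
    proof -
      have "E j = B \<inter> {\<omega> \<in> space M. real (Suc k) * c r (Suc k) \<le> \<bar>mart_sum (bin_hit J j) (n + r) (Suc k) \<omega>\<bar>}"
        using sets.sets_into_space[OF BM] by (auto simp: E_def)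
      then show ?thesis using BM ms_m by simp
    qed
    have "B \<inter> Dev r k = (\<Union>j\<in>{1..J}. E j)"
      using sets.sets_into_space[OF BM] by (auto simp: Dev_def E_def)
    then have "prob (B \<inter> Dev r k) \<le> (\<Sum>j = 1..J. prob (E j))"
      using measure_UNION_le[of "{1..J}" E M] Em by simp
    also have "\<dots> \<le> (\<Sum>j = 1..J. 2 * exp (- 2 * real (Suc k) * (c r (Suc k))\<^sup>2) * prob B)"
    proof (rule sum_mono)
      fix j
      show "prob (E j) \<le> 2 * exp (- 2 * real (Suc k) * (c r (Suc k))\<^sup>2) * prob B"
        unfolding E_def
        by (rule azuma[OF n1(1) _ bin_hit_measurable bin_hit_bounds B]) (use c[of "Suc k" r] in auto)
    qed
    also have "\<dots> = real J * (18 * \<eta> / (real J * pi ^ 4 * (real r + 1)\<^sup>2 * (real (Suc k))\<^sup>2)) * prob B"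
      using c[of "Suc k" r] by simp
    also have "\<dots> = (18 * \<eta> / (pi ^ 4 * (real (Suc r))\<^sup>2)) / (real (Suc k))\<^sup>2 * prob B"
      using J0 by (simp add: add.commute)
    finally show ?thesis .
  qed

  define Good where "Good = Z - (\<Union>k. Osc k) - (\<Union>r. \<Union>k. Dev r k)"
  show ?thesis
  proof (rule that[of Good])
    show Gm: "Good \<in> events" unfolding Good_def using Zm Osc(1) Devm by blast
    show "0 \<le> pvals X U \<omega> t \<and> pvals X U \<omega> t \<le> 1" if "\<omega> \<in> Good" "1 \<le> t" for \<omega> t
      using that by (cases t; intro pvals_in_unit_interval) (auto simp: Good_def Z_def)
  next
    fix \<omega> and r l j :: nat assume \<omega>: "\<omega> \<in> Good" and l: "l \<ge> 1" and j: "j \<in> {1..J}"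
    let ?b = "emp_deviation (\<lambda>t. X t \<omega>) (cdf F1) n"
    have sp: "\<omega> \<in> space M" using \<omega> by (auto simp: Good_def Z_def)
    have l0: "real l > 0" using l by simp
    obtain k where k: "l = Suc k" using l by (cases l) auto
    have mart: "\<bar>mart_sum (bin_hit J j) (n + r) l \<omega>\<bar> < real l * c r l"
    proof -
      have "\<omega> \<notin> Dev r k" using \<omega> by (auto simp: Good_def)
      then show ?thesis using j sp by (force simp: Dev_def k)
    qed
    have mean: "\<bar>obs_mean (bin_hit J j (n + r + q)) \<omega> - 1 / real J\<bar> \<le> delta_dev n (r + q + 1) ?b \<eta>" for q
    proof -
      have osc: "oscP m \<omega>" if "m \<ge> 1" for m
        using Osc(2)[of \<omega> "m - 1"] that \<omega> sp by (auto simp: Good_def)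
      have "\<bar>obs_mean (bin_hit J j (n + (r + q))) \<omega> - 1 / real J\<bar> \<le> delta_dev n (r + q + 1) ?b \<eta>"
      proof (rule obs_mean_bin_hit[OF n1(2) _ j])
        fix y z :: real assume "r + q \<ge> 1" and yz: "y \<le> z"
        from osc[OF this(1)] show "\<bar>(\<Sum>q'<r + q. indicator {y<..z} (X (n + q' + 1) \<omega>))
            - real (r + q) * (cdf F1 z - cdf F1 y)\<bar> \<le> real (r + q) * (2 * lambda_dev (r + q) \<eta>)"
          unfolding oscP_def using yz by blast
      qed (use J in simp)
      then show ?thesis by (simp only: add.assoc)
    qed
    \<comment> \<open>Doob decomposition of the count into a martingale part and a compensator; the
      two parts yield the two terms of \<open>a_R\<close>.\<close>
    have N: "real (bin_count J (pvals X U \<omega>) (n + r) (n + r + l) j)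
        = mart_sum (bin_hit J j) (n + r) l \<omega> + (\<Sum>q<l. obs_mean (bin_hit J j (n + r + q)) \<omega>)"
      by (simp add: bin_count_sum_indicator mart_sum_def sum_subtractf bin_hit_obs[simplified])
    have "\<bar>(\<Sum>q<l. obs_mean (bin_hit J j (n + r + q)) \<omega>) - real l * (1 / real J)\<bar>
        = \<bar>\<Sum>q<l. obs_mean (bin_hit J j (n + r + q)) \<omega> - 1 / real J\<bar>"
      by (simp add: sum_subtractf)
    also have "\<dots> \<le> (\<Sum>q<l. \<bar>obs_mean (bin_hit J j (n + r + q)) \<omega> - 1 / real J\<bar>)" by (rule sum_abs)
    also have "\<dots> \<le> (\<Sum>q<l. delta_dev n (r + q + 1) ?b \<eta>)" by (intro sum_mono mean)
    also have "\<dots> = (\<Sum>i = r+1..r+l. delta_dev n i ?b \<eta>)"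
      by (rule sum.reindex_bij_witness[of _ "\<lambda>i. i - r - 1" "\<lambda>q. r + q + 1"]) auto
    finally have S: "\<bar>(\<Sum>q<l. obs_mean (bin_hit J j (n + r + q)) \<omega>) - real l * (1 / real J)\<bar>
        \<le> (\<Sum>i = r+1..r+l. delta_dev n i ?b \<eta>)" .
    have "\<bar>real (bin_count J (pvals X U \<omega>) (n + r) (n + r + l) j) - real l * (1 / real J)\<bar>
        \<le> (\<Sum>i = r+1..r+l. delta_dev n i ?b \<eta>) + real l * c r l"
      using S mart unfolding N by linarith
    then have "\<bar>real (bin_count J (pvals X U \<omega>) (n + r) (n + r + l) j) - real l * (1 / real J)\<bar> / real l
        \<le> ((\<Sum>i = r+1..r+l. delta_dev n i ?b \<eta>) + real l * c r l) / real l"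
      using l0 by (intro divide_right_mono) auto
    also have "\<dots> = a_R J n r l ?b \<eta>" using l0 by (simp add: a_R_def c_def add_divide_distrib)
    also have "\<bar>real (bin_count J (pvals X U \<omega>) (n + r) (n + r + l) j) - real l * (1 / real J)\<bar> / real l
        = \<bar>theta_hat J (pvals X U \<omega>) (n + r + l) (n + r) j - 1 / real J\<bar>"
    proof -
      have "theta_hat J (pvals X U \<omega>) (n + r + l) (n + r) j - 1 / real J
          = (real (bin_count J (pvals X U \<omega>) (n + r) (n + r + l) j) - real l * (1 / real J)) / real l"
        using l0 by (simp add: theta_hat_def diff_divide_distrib)
      then show ?thesis using l0 by (simp add: abs_divide)
    qed
    finally show "\<bar>theta_hat J (pvals X U \<omega>) (n + r + l) (n + r) j - 1 / real J\<bar> \<le> a_R J n r l ?b \<eta>" .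
  next
    fix B assume B: "B \<in> sets (hist n)"
    have BM: "B \<in> events" using B subalgebra_hist[of n] by (auto simp: subalgebra_def)
    have Gm: "Good \<in> events" unfolding Good_def using Zm Osc(1) Devm by blast
    have 1: "prob (B \<inter> (\<Union>k. Osc k)) \<le> (3 * \<eta> / pi\<^sup>2) * (pi\<^sup>2 / 6) * prob B"
      by (rule measure_Int_UN_le[OF Osc(1) BM Osc(3)[OF B] sums_inverse_squares_scaled])
    have "prob (B \<inter> (\<Union>k. Dev r k)) \<le> (18 * \<eta> / (pi ^ 4 * (real (Suc r))\<^sup>2)) * (pi\<^sup>2 / 6) * prob B" for r
      by (rule measure_Int_UN_le[OF Devm BM Devp[OF B] sums_inverse_squares_scaled])
    \<comment> \<open>Summing over the lengths turns \<open>pi^4\<close> into \<open>pi^2\<close>;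
      the result has the shape of the oscillation bound, and summing over \<open>r\<close> again
      yields \<open>\<eta> / 2\<close>.\<close>
    moreover have "(18 * \<eta> / (pi ^ 4 * (real (Suc r))\<^sup>2)) * (pi\<^sup>2 / 6) = (3 * \<eta> / pi\<^sup>2) / (real (Suc r))\<^sup>2" for r
      by (simp add: power4_eq_xxxx power2_eq_square del: of_nat_Suc)
    ultimately have "prob (B \<inter> (\<Union>k. Dev r k)) \<le> (3 * \<eta> / pi\<^sup>2) / (real (Suc r))\<^sup>2 * prob B" for r
      by metis
    then have 2: "prob (B \<inter> (\<Union>r. \<Union>k. Dev r k)) \<le> (3 * \<eta> / pi\<^sup>2) * (pi\<^sup>2 / 6) * prob B"
      by (intro measure_Int_UN_le[OF _ BM _ sums_inverse_squares_scaled]) (use Devm in auto)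
    define B1 where "B1 = B \<inter> (\<Union>k. Osc k)"
    define B2 where "B2 = B \<inter> (\<Union>r. \<Union>k. Dev r k)"
    have m: "B1 \<in> events" "B2 \<in> events" "space M - Z \<in> events" "Good \<inter> B \<in> events"
      unfolding B1_def B2_def using BM Osc(1) Devm Zm Gm by auto
    have "B \<subseteq> (Good \<inter> B) \<union> (space M - Z) \<union> B1 \<union> B2"
      using sets.sets_into_space[OF BM] by (auto simp: Good_def B1_def B2_def)
    then have "prob B \<le> prob ((Good \<inter> B) \<union> (space M - Z) \<union> B1 \<union> B2)"
      using m by (intro finite_measure_mono) auto
    also have "\<dots> \<le> prob (Good \<inter> B) + prob (space M - Z) + prob B1 + prob B2"
      using m measure_Un_le[of "(Good \<inter> B) \<union> (space M - Z) \<union> B1" M B2]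
        measure_Un_le[of "(Good \<inter> B) \<union> (space M - Z)" M B1] measure_Un_le[of "Good \<inter> B" M "space M - Z"]
      by force
    finally have "prob B \<le> prob (Good \<inter> B) + prob B1 + prob B2" using Z1 by simp
    moreover have "(3 * \<eta> / pi\<^sup>2) * (pi\<^sup>2 / 6) = \<eta> / 2" by simp
    ultimately show "(1 - \<eta>) * prob B \<le> prob (Good \<inter> B)"
      using 1 2 unfolding B1_def[symmetric] B2_def[symmetric] by (simp add: left_diff_distrib)
  qed
qed

end

section \<open>Measurability\<close>

text \<open>On points outside every bin \<open>THE\<close> returns one fixed value, so uniqueness of
  the bin together with measurable bins suffices.\<close>

lemma bin_index_measurable [measurable]: "bin_index J \<in> measurable borel (count_space UNIV)"
  unfolding bin_index_def[abs_def]
proof (rule measurable_THE)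
  show "Measurable.pred borel (\<lambda>x. i \<in> {1..J} \<and> x \<in> bin J i)" for i by measurable
qed (auto intro: bin_unique)

text \<open>The empirical and the true distribution function are both right-continuous, so the
  supremum may be tested at rationals; this yields measurability of
  \<open>emp_deviation\<close>.\<close>

lemma emp_deviation_le_iff:
  assumes F: "real_distribution F" and cont: "continuous_on UNIV (cdf F)"
  shows "emp_deviation x (cdf F) d \<le> c \<longleftrightarrow>
    (\<forall>q::rat. \<bar>1 / real d * (\<Sum>l = 1..d. if x l \<le> of_rat q then 1 else 0) - cdf F (of_rat q)\<bar> \<le> c)"
proof
  let ?f = "\<lambda>y. \<bar>1 / real d * (\<Sum>l = 1..d. if x l \<le> y then 1 else 0) - cdf F y\<bar>"
  interpret F: real_distribution F by (rule F)
  {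
    assume le: "emp_deviation x (cdf F) d \<le> c"
    show "\<forall>q::rat. ?f (of_rat q) \<le> c"
    proof
      fix q :: rat
      have "?f (of_rat q) \<le> emp_deviation x (cdf F) d"
        unfolding emp_deviation_def by (rule cSUP_upper[OF UNIV_I F.emp_deviation_bdd])
      with le show "?f (of_rat q) \<le> c" by (rule order_trans[rotated])
    qed
  }
  assume rat: "\<forall>q::rat. ?f (of_rat q) \<le> c"
  have "?f y \<le> c" for y
  proof (rule ccontr)
    assume "\<not> ?f y \<le> c"
    then have gt: "c < ?f y" by simp
    have step: "((\<lambda>z. if x l \<le> z then 1 else 0 :: real) \<longlongrightarrow> (if x l \<le> y then 1 else 0)) (at_right y)" for l
    proof (rule tendsto_eventually)
      show "\<forall>\<^sub>F z in at_right y. (if x l \<le> z then 1 else 0 :: real) = (if x l \<le> y then 1 else 0)"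
      proof (cases "x l \<le> y")
        case True
        show ?thesis using eventually_at_right_less[of y]
          by (rule eventually_mono) (use True in simp)
      next
        case False
        then show ?thesis unfolding eventually_at_right_field by (intro exI[of _ "x l"] conjI allI impI) simp_all
      qed
    qed
    have "(cdf F \<longlongrightarrow> cdf F y) (at y within UNIV)"
      using cont by (simp only: continuous_on_def UNIV_I ball_UNIV)
    then have "(cdf F \<longlongrightarrow> cdf F y) (at_right y)" by (rule tendsto_within_subset) simp
    then have "(?f \<longlongrightarrow> ?f y) (at_right y)"
      by (intro tendsto_rabs tendsto_diff tendsto_mult tendsto_const tendsto_sum step)
    then have "\<forall>\<^sub>F z in at_right y. c < ?f z" using gt by (rule order_tendstoD)
    then obtain z where z: "z > y" "\<And>w. y < w \<Longrightarrow> w < z \<Longrightarrow> c < ?f w"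
      unfolding eventually_at_right_field by blast
    obtain q :: rat where "y < of_rat q" "of_rat q < z" using of_rat_dense[OF z(1)] by blast
    from z(2)[OF this] rat show False by (simp add: not_le[symmetric])
  qed
  then show "emp_deviation x (cdf F) d \<le> c" unfolding emp_deviation_def by (intro cSUP_least) auto
qed

text \<open>Monotone functions are Borel, but \<open>Phi_mono\<close> covers only nonnegative radii,
  hence the truncation at 0.\<close>

lemma Phi_max_measurable: "J \<ge> 1 \<Longrightarrow> (\<lambda>a. Phi J (max a 0)) \<in> borel_measurable borel"
  by (intro borel_measurable_mono monoI Phi_mono) auto

text \<open>The set under the infimum varies with the path; inserting the neutral value \<infinity>
  gives a countable infimum of measurable functions over a fixed index set.\<close>

lemma crossing_time_conv_INF:
  "crossing_time \<tau> R B = (INF t. if \<tau> + 1 \<le> t \<and> R t > B t then enat t else \<infinity>)"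
proof (rule antisym)
  show "crossing_time \<tau> R B \<le> (INF t. if \<tau> + 1 \<le> t \<and> R t > B t then enat t else \<infinity>)"
    unfolding crossing_time_def by (rule INF_greatest) (auto intro: Inf_lower)
  show "(INF t. if \<tau> + 1 \<le> t \<and> R t > B t then enat t else \<infinity>) \<le> crossing_time \<tau> R B"
    unfolding crossing_time_def
  proof (rule Inf_greatest)
    fix e assume "e \<in> {enat t |t. \<tau> + 1 \<le> t \<and> B t < R t}"
    then obtain t where "e = enat t" "\<tau> + 1 \<le> t" "B t < R t" by auto
    then show "(INF t. if \<tau> + 1 \<le> t \<and> R t > B t then enat t else \<infinity>) \<le> e"
      by (intro INF_lower2[of t]) auto
  qed
qed

text \<open>The same device for a supremum, with the bottom element 0 as neutral value.\<close>

lemma safe_horizon_conv_SUP: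
  "safe_horizon u h = (SUP r. if (SUP m \<in> {1..r}. ereal (u m)) < ereal h then enat r else 0)"
proof (rule antisym)
  show "safe_horizon u h \<le> (SUP r. if (SUP m \<in> {1..r}. ereal (u m)) < ereal h then enat r else 0)"
    unfolding safe_horizon_def
  proof (rule Sup_least)
    fix e assume "e \<in> {enat r |r. (SUP m\<in>{1..r}. ereal (u m)) < ereal h}"
    then obtain r where "e = enat r" "(SUP m\<in>{1..r}. ereal (u m)) < ereal h" by auto
    then show "e \<le> (SUP r. if (SUP m \<in> {1..r}. ereal (u m)) < ereal h then enat r else 0)"
      by (intro SUP_upper2[of r]) auto
  qed
  show "(SUP r. if (SUP m \<in> {1..r}. ereal (u m)) < ereal h then enat r else 0) \<le> safe_horizon u h"
    unfolding safe_horizon_def by (rule SUP_least) (auto intro: Sup_upper)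
qed

context
  fixes N :: "'a measure" and p :: "'a \<Rightarrow> nat \<Rightarrow> real"
begin

lemma bin_count_measurable:
  assumes [measurable]: "\<And>i. i \<in> {1..t} \<Longrightarrow> (\<lambda>\<omega>. p \<omega> i) \<in> borel_measurable N"
  shows "(\<lambda>\<omega>. bin_count J (p \<omega>) s t j) \<in> measurable N (count_space UNIV)"
  unfolding bin_count_def
proof (rule measurable_card)
  fix i
  show "{\<omega> \<in> space N. i \<in> {i \<in> {s + 1..t}. p \<omega> i \<in> bin J j}} \<in> sets N"
  proof (cases "i \<in> {s + 1..t}")
    case True
    then have [measurable]: "(\<lambda>\<omega>. p \<omega> i) \<in> borel_measurable N" using assms[of i] by auto
    have "{\<omega> \<in> space N. p \<omega> i \<in> bin J j} \<in> sets N" by measurable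
    with True show ?thesis by simp
  qed auto
qed

lemma KT_measurable:
  assumes p: "\<And>i. i \<in> {1..t} \<Longrightarrow> (\<lambda>\<omega>. p \<omega> i) \<in> borel_measurable N"
  shows "(\<lambda>\<omega>. KT J (p \<omega>) s t) \<in> borel_measurable N"
proof (cases "t \<le> s")
  case False
  have "(\<lambda>\<omega>. real (bin_count J (p \<omega>) s (i - 1) (bin_index J (p \<omega> i)))) \<in> borel_measurable N"
    if i: "i \<in> {s+1..t}" for i
  proof (rule measurable_compose_countable[where f = "\<lambda>j \<omega>. real (bin_count J (p \<omega>) s (i - 1) j)"])
    show "(\<lambda>\<omega>. real (bin_count J (p \<omega>) s (i - 1) j)) \<in> borel_measurable N" for j
      by (rule measurable_compose[OF bin_count_measurable]) (use i p in auto)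
    show "(\<lambda>\<omega>. bin_index J (p \<omega> i)) \<in> measurable N (count_space UNIV)"
      by (rule measurable_compose[OF p bin_index_measurable]) (use i in auto)
  qed
  note [measurable] = this
  have "(\<lambda>\<omega>. \<Prod>i = s+1..t. real J *
        ((real (bin_count J (p \<omega>) s (i - 1) (bin_index J (p \<omega> i))) + 1/2) /
         (real (i - s - 1) + real J / 2))) \<in> borel_measurable N"
    by (rule borel_measurable_prod) measurable
  with False show ?thesis by (simp add: KT_def)
qed (simp add: KT_def)

lemma restart_mix_measurable:
  assumes "\<And>i. i \<in> {1..t} \<Longrightarrow> (\<lambda>\<omega>. p \<omega> i) \<in> borel_measurable N"
  shows "(\<lambda>\<omega>. restart_mix J \<pi> (p \<omega>) t) \<in> borel_measurable N"
  unfolding restart_mix_def by (intro borel_measurable_suminf borel_measurable_times KT_measurable assms) auto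

lemma U_env_measurable:
  assumes J: "J \<ge> 1" and \<eta>: "0 < \<eta>" "\<eta> < 1"
    and p: "\<And>i. 1 \<le> i \<Longrightarrow> (\<lambda>\<omega>. p \<omega> i) \<in> borel_measurable N"
    and b: "b \<in> borel_measurable N" "\<And>\<omega>. 0 \<le> b \<omega>" and m: "m \<ge> 1"
  shows "(\<lambda>\<omega>. U_env J \<pi> (p \<omega>) d m (b \<omega>) \<eta>) \<in> borel_measurable N"
proof -
  have rw: "(\<lambda>\<omega>. restart_weight J \<pi> (p \<omega>) d s) \<in> borel_measurable N" for s
    unfolding restart_weight_def
    by (intro borel_measurable_divide borel_measurable_times KT_measurable restart_mix_measurable p) auto
  have bc: "(\<lambda>\<omega>. bin_count J (p \<omega>) s d j) \<in> measurable N (count_space UNIV)" for s j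
    by (rule bin_count_measurable) (use p in auto)
  have aR: "(\<lambda>\<omega>. a_R J d r l (b \<omega>) \<eta>) \<in> borel_measurable N" for r l
    unfolding a_R_def delta_dev_def
    by (intro borel_measurable_add borel_measurable_times borel_measurable_sum borel_measurable_const b(1))
  have Phi: "(\<lambda>\<omega>. Phi J (a_R J d r l (b \<omega>) \<eta>)) \<in> borel_measurable N" if "l \<ge> 1" for r l
  proof -
    have "(\<lambda>\<omega>. Phi J (max (a_R J d r l (b \<omega>) \<eta>) 0)) \<in> borel_measurable N"
      by (rule measurable_compose[OF aR Phi_max_measurable[OF J]])
    moreover have "max (a_R J d r l (b \<omega>) \<eta>) 0 = a_R J d r l (b \<omega>) \<eta>" for \<omega>
      using a_R_nonneg[OF \<eta> b(2) that J] by simp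
    ultimately show ?thesis by simp
  qed
  have V: "(\<lambda>\<omega>. V_dev J (p \<omega>) d s) \<in> borel_measurable N" for s
    unfolding V_dev_def TV_def theta_hat_def
    by (intro borel_measurable_times borel_measurable_sum borel_measurable_abs borel_measurable_diff
        borel_measurable_divide borel_measurable_const measurable_compose[OF bc]) simp_all
  have Psi: "(\<lambda>\<omega>. Psi J (p \<omega>) d s) \<in> borel_measurable N" for s
    unfolding Psi_def by (intro borel_measurable_sum measurable_compose[OF bc]) simp
  have G: "(\<lambda>\<omega>. G_env J (p \<omega>) d s m (b \<omega>) \<eta>) \<in> borel_measurable N" for s
    unfolding G_env_def
    by (intro borel_measurable_add borel_measurable_diff borel_measurable_times borel_measurable_power
        borel_measurable_max borel_measurable_const Phi[OF m] V aR Psi)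
  have H: "(\<lambda>\<omega>. H_env J d r m (b \<omega>) \<eta>) \<in> borel_measurable N" if "r \<in> {0..<m}" for r
    unfolding H_env_def using that
    by (intro borel_measurable_diff borel_measurable_times borel_measurable_const Phi) simp
  show ?thesis unfolding U_env_def
    by (intro borel_measurable_ln borel_measurable_add borel_measurable_sum borel_measurable_suminf
        borel_measurable_times rw measurable_compose[OF G borel_measurable_exp]
        measurable_compose[OF H borel_measurable_exp])
qed

end

lemma crossing_time_measurable:
  assumes [measurable]: "\<And>t. (\<lambda>\<omega>. R \<omega> t) \<in> borel_measurable N"
  shows "(\<lambda>\<omega>. crossing_time \<tau> (R \<omega>) B) \<in> measurable N (count_space UNIV)"
  unfolding crossing_time_conv_INF by measurable

lemma safe_horizon_measurable:
  assumes u: "\<And>m. m \<ge> 1 \<Longrightarrow> (\<lambda>\<omega>. u \<omega> m) \<in> borel_measurable N" and [measurable]: "h \<in> borel_measurable N"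
  shows "(\<lambda>\<omega>. safe_horizon (u \<omega>) (h \<omega>)) \<in> measurable N (count_space UNIV)"
proof -
  have "(\<lambda>\<omega>. SUP m \<in> {1..r}. ereal (u \<omega> m)) \<in> borel_measurable N" for r :: nat
    by (rule borel_measurable_SUP) (use u in auto)
  note [measurable] = this
  show ?thesis unfolding safe_horizon_conv_SUP by measurable
qed

text \<open>Meant for \<open>enat\<close>-valued times and horizons: with countably many values, any
  relation between them is measurable, including one that involves subtraction.\<close>

lemma sets_Collect_countable3:
  fixes f g h :: "'a \<Rightarrow> 'b::countable"
  assumes f: "f \<in> measurable N (count_space UNIV)" and g: "g \<in> measurable N (count_space UNIV)"
    and h: "h \<in> measurable N (count_space UNIV)"
  shows "{\<omega> \<in> space N. P (f \<omega>) (g \<omega>) (h \<omega>)} \<in> sets N"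
proof -
  have "Measurable.pred N (\<lambda>\<omega>. P (f \<omega>) (g \<omega>) (h \<omega>))"
  proof (rule measurable_compose_countable[OF _ f])
    fix a show "Measurable.pred N (\<lambda>\<omega>. P a (g \<omega>) (h \<omega>))"
    proof (rule measurable_compose_countable[OF _ g])
      fix b show "Measurable.pred N (\<lambda>\<omega>. P a b (h \<omega>))"
        by (rule measurable_compose[OF h]) simp
    qed
  qed
  then show ?thesis by (simp add: pred_def)
qed

context change_point_model
begin

lemma pvals_measurable:
  assumes "\<And>i. i \<in> {1..t} \<Longrightarrow> X i \<in> borel_measurable N" "U t \<in> borel_measurable N" "1 \<le> t"
  shows "(\<lambda>\<omega>. pvals X U \<omega> t) \<in> borel_measurable N"
proof -
  have "(\<lambda>\<omega>. \<Sum>r = 1..<t. if X r \<omega> > X t \<omega> then 1 else 0 :: real) \<in> borel_measurable N"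
  proof (rule borel_measurable_sum)
    fix r assume "r \<in> {1..<t}"
    then have [measurable]: "X r \<in> borel_measurable N" "X t \<in> borel_measurable N" using assms by auto
    show "(\<lambda>\<omega>. if X r \<omega> > X t \<omega> then 1 else 0 :: real) \<in> borel_measurable N" by measurable
  qed
  note [measurable] = this assms(2)
  show ?thesis unfolding pvals_def by measurable
qed

lemma pvals_hist: "1 \<le> t \<Longrightarrow> t \<le> n \<Longrightarrow> (\<lambda>\<omega>. pvals X U \<omega> t) \<in> borel_measurable (hist n)"
  by (rule pvals_measurable) (auto intro: X_hist U_hist)

lemma pvals_borel: "1 \<le> t \<Longrightarrow> (\<lambda>\<omega>. pvals X U \<omega> t) \<in> borel_measurable M"
  by (rule pvals_measurable) (auto intro: X_measurable U_measurable)

lemma emp_deviation_borel: "(\<lambda>\<omega>. emp_deviation (\<lambda>t. X t \<omega>) (cdf F1) d) \<in> borel_measurable M"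
proof (rule borel_measurableI_le)
  fix c
  have "(\<lambda>\<omega>. \<Sum>l = 1..d. if X l \<omega> \<le> y then 1 else 0 :: real) \<in> borel_measurable M" for y
  proof (rule borel_measurable_sum)
    fix l assume "l \<in> {1..d}"
    then have [measurable]: "X l \<in> borel_measurable M" by (intro X_measurable) auto
    show "(\<lambda>\<omega>. if X l \<omega> \<le> y then 1 else 0 :: real) \<in> borel_measurable M" by measurable
  qed
  note [measurable] = this
  show "{\<omega> \<in> space M. emp_deviation (\<lambda>t. X t \<omega>) (cdf F1) d \<le> c} \<in> events"
    unfolding emp_deviation_le_iff[OF F1_distribution F1_continuous] by measurable
qed

end

section \<open>The delay bound\<close>

theorem theorem4p11:
  fixes M :: "'w measure"
    and X U :: "nat \<Rightarrow> 'w \<Rightarrow> real"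
    and F0 F1 :: "real measure"
    and \<tau> J :: nat
    and \<pi> B :: "nat \<Rightarrow> real"
    and \<alpha> \<eta> :: real
  defines "L \<equiv> \<lambda>t \<omega>. log_mix J \<pi> (pvals X U \<omega>) t"
    and "D\<^sub>C \<equiv> \<lambda>\<omega>. crossing_time \<tau> (restart_mix J \<pi> (pvals X U \<omega>)) B"
    and "D\<^sub>V \<equiv> \<lambda>\<omega>. crossing_time \<tau> (restart_mix J \<pi> (pvals X U \<omega>)) (\<lambda>_. 1 / \<alpha>)"
    and "b \<equiv> \<lambda>d \<omega>. emp_deviation (\<lambda>t. X t \<omega>) (cdf F1) d"
  defines "h \<equiv> \<lambda>d \<omega>. ln (1 / \<alpha>) - L d \<omega>"
    and "UR \<equiv> \<lambda>d m \<omega>. U_env J \<pi> (pvals X U \<omega>) d m (b d \<omega>) \<eta>"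
  defines "rR \<equiv> \<lambda>d \<omega>. safe_horizon (\<lambda>m. UR d m \<omega>) (h d \<omega>)"
  assumes "change_point_model M \<tau> F0 F1 X U"
    and "J \<ge> 2"
    and "\<And>s. \<pi> s \<ge> 0" and "\<pi> sums 1"
    and "0 < \<alpha>" and "\<alpha> < 1"
    and "\<And>t. t \<ge> 1 \<Longrightarrow> B t > 0"
    and "0 < \<eta>" and "\<eta> < 1"
  shows "\<forall>n \<ge> \<tau> + 1. AE \<omega> in M. D\<^sub>C \<omega> = enat n \<and> enat n < D\<^sub>V \<omega> \<longrightarrow>
      cond_prob_given M (history M X U n)
        {\<omega> \<in> space M. \<forall>m \<ge> 1. L (n + m) \<omega> - L n \<omega> \<le> UR n m \<omega>} \<omega> \<ge> 1 - \<eta>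
    \<and> cond_prob_given M (history M X U n)
        {\<omega> \<in> space M. D\<^sub>V \<omega> - D\<^sub>C \<omega> > rR n \<omega>} \<omega> \<ge> 1 - \<eta>"
proof (intro allI impI)
  fix n assume n: "\<tau> + 1 \<le> n"
  interpret change_point_model M \<tau> F0 F1 X U by (rule \<open>change_point_model M \<tau> F0 F1 X U\<close>)
  have J1: "J \<ge> 1" using \<open>J \<ge> 2\<close> by simp
  note prior = \<open>\<And>s. \<pi> s \<ge> 0\<close> \<open>\<pi> sums 1\<close>
  note \<eta> = \<open>0 < \<eta>\<close> \<open>\<eta> < 1\<close>
  define R where "R \<omega> = restart_mix J \<pi> (pvals X U \<omega>)" for \<omega>
  have R_pos: "R \<omega> t > 0" for \<omega> t unfolding R_def by (rule restart_mix_pos[OF J1 prior])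
  have L_R: "L t \<omega> = ln (R \<omega> t)" for t \<omega> by (simp add: L_def log_mix_def R_def)
  have D_R: "D\<^sub>C \<omega> = crossing_time \<tau> (R \<omega>) B" "D\<^sub>V \<omega> = crossing_time \<tau> (R \<omega>) (\<lambda>_. 1 / \<alpha>)" for \<omega>
    by (simp_all add: D\<^sub>C_def D\<^sub>V_def R_def)
  have Rm: "(\<lambda>\<omega>. R \<omega> t) \<in> borel_measurable M" for t
    unfolding R_def by (rule restart_mix_measurable) (auto intro: pvals_borel)
  have Rh: "(\<lambda>\<omega>. R \<omega> t) \<in> borel_measurable (hist n)" if "t \<le> n" for t
    unfolding R_def by (rule restart_mix_measurable) (use that in \<open>auto intro: pvals_hist\<close>)
  have b0: "0 \<le> b d \<omega>" for d \<omega> unfolding b_def by (rule real_distribution.emp_deviation_nonneg[OF F1_distribution])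
  have URm: "(\<lambda>\<omega>. UR n m \<omega>) \<in> borel_measurable M" if "m \<ge> 1" for m
    unfolding UR_def
    by (rule U_env_measurable[OF J1 \<eta> pvals_borel _ b0 that]) (auto simp: b_def intro: emp_deviation_borel)
  have Lm: "L t \<in> borel_measurable M" for t
    unfolding L_R[abs_def] using Rm by (rule borel_measurable_ln)

  define A1 where "A1 = {\<omega> \<in> space M. \<forall>m \<ge> 1. L (n + m) \<omega> - L n \<omega> \<le> UR n m \<omega>}"
  define A2 where "A2 = {\<omega> \<in> space M. D\<^sub>V \<omega> - D\<^sub>C \<omega> > rR n \<omega>}"
  define E where "E = {\<omega> \<in> space M. D\<^sub>C \<omega> = enat n \<and> enat n < D\<^sub>V \<omega>}"
  have A1m: "A1 \<in> events"
  proof -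
    have "{\<omega> \<in> space M. 1 \<le> m \<longrightarrow> L (n + m) \<omega> - L n \<omega> \<le> UR n m \<omega>} \<in> events" for m
      using URm[of m] Lm by (cases "1 \<le> m") (simp_all add: borel_measurable_le borel_measurable_diff)
    then show ?thesis unfolding A1_def by (rule sets.sets_Collect_countable_All)
  qed
  have A2m: "A2 \<in> events"
  proof -
    have "(\<lambda>\<omega>. rR n \<omega>) \<in> measurable M (count_space UNIV)"
      unfolding rR_def by (rule safe_horizon_measurable[OF URm]) (use Lm in \<open>simp_all add: h_def\<close>)
    then show ?thesis unfolding A2_def D_R
      by (intro sets_Collect_countable3 crossing_time_measurable Rm)
  qed
  have Em: "E \<in> sets (hist n)"
  proof -
    \<comment> \<open>\<open>D = enat n\<close> means no crossing by \<open>n - 1\<close> and a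
      crossing by \<open>n\<close>; \<open>crossing_time_gt_iff\<close> then makes \<open>E\<close>
      a finite combination of events in the history at \<open>n\<close>. Since
      \<open>n \<ge> 1\<close>, the subtraction is not truncated.\<close>
    have n0: "enat (n - 1) < D \<and> \<not> enat n < D \<longleftrightarrow> D = enat n" for D
      using n by (cases D) auto
    have E_eq: "E = {\<omega> \<in> space (hist n). (\<forall>t\<in>{\<tau>+1..n-1}. R \<omega> t \<le> B t) \<and> \<not> (\<forall>t\<in>{\<tau>+1..n}. R \<omega> t \<le> B t)
        \<and> (\<forall>t\<in>{\<tau>+1..n}. R \<omega> t \<le> 1 / \<alpha>)}"
      unfolding E_def D_R n0[symmetric] crossing_time_gt_iff by auto
    have "{\<omega> \<in> space (hist n). R \<omega> t \<le> c} \<in> sets (hist n)" if "t \<le> n" for t c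
      by (rule borel_measurable_le[OF Rh[OF that] borel_measurable_const])
    then show ?thesis
      unfolding E_eq
      by (intro sets.sets_Collect_conj sets.sets_Collect_neg sets.sets_Collect_finite_All) auto
  qed

  obtain Good where Good: "Good \<in> events"
    "\<And>\<omega> t. \<omega> \<in> Good \<Longrightarrow> 1 \<le> t \<Longrightarrow> 0 \<le> pvals X U \<omega> t \<and> pvals X U \<omega> t \<le> 1"
    "\<And>\<omega> r l j. \<omega> \<in> Good \<Longrightarrow> l \<ge> 1 \<Longrightarrow> j \<in> {1..J} \<Longrightarrow>
      \<bar>theta_hat J (pvals X U \<omega>) (n + r + l) (n + r) j - 1 / real J\<bar>
        \<le> a_R J n r l (emp_deviation (\<lambda>t. X t \<omega>) (cdf F1) n) \<eta>"
    "\<And>B. B \<in> sets (hist n) \<Longrightarrow> (1 - \<eta>) * prob B \<le> prob (Good \<inter> B)"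
    using exists_good_event[OF n \<open>J \<ge> 2\<close> \<eta>] by blast
  have Good_A1: "Good \<subseteq> A1"
  proof
    fix \<omega> assume \<omega>: "\<omega> \<in> Good"
    have "L (n + m) \<omega> - L n \<omega> \<le> UR n m \<omega>" if "m \<ge> 1" for m
      unfolding L_def UR_def b_def
      by (rule log_mix_increment_le[OF J1 prior that]) (use Good(2,3)[OF \<omega>] in auto)
    then show "\<omega> \<in> A1" using \<omega> sets.sets_into_space[OF Good(1)] by (auto simp: A1_def)
  qed
  \<comment> \<open>On the crossing event the envelope bound implies the delay bound pathwise, so
    the one event \<open>Good\<close> serves both claims.\<close>
  have A1_A2: "A1 \<inter> E \<subseteq> A2"
  proof
    fix \<omega> assume \<omega>: "\<omega> \<in> A1 \<inter> E"
    then have D: "D\<^sub>C \<omega> = enat n" "enat n < D\<^sub>V \<omega>" and le: "\<And>m. m \<ge> 1 \<Longrightarrow> L (n + m) \<omega> - L n \<omega> \<le> UR n m \<omega>"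
      by (auto simp: A1_def E_def)
    have "safe_horizon (\<lambda>m. UR n m \<omega>) (h n \<omega>) < D\<^sub>V \<omega> - enat n"
    proof (rule safe_horizon_less[OF D(2)])
      show "\<exists>m\<ge>1. h n \<omega> \<le> UR n m \<omega>"
        unfolding UR_def using U_env_unbounded[OF \<open>J \<ge> 2\<close> prior \<eta> b0, of "h n \<omega>" "pvals X U \<omega>" n] by metis
      fix r assume small: "\<And>m. 1 \<le> m \<Longrightarrow> m \<le> r \<Longrightarrow> UR n m \<omega> < h n \<omega>"
      have "R \<omega> t \<le> 1 / \<alpha>" if t: "\<tau> + 1 \<le> t" "t \<le> n + r" for t
      proof (cases "t \<le> n")
        case True
        then show ?thesis using D(2) t unfolding D_R crossing_time_gt_iff by blast
      next
        case False
        define m where "m = t - n"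
        have m: "t = n + m" "1 \<le> m" "m \<le> r" using False t by (auto simp: m_def)
        have "L t \<omega> < ln (1 / \<alpha>)" using le[OF m(2)] small[OF m(2,3)] by (simp add: h_def m(1))
        then show ?thesis using R_pos[of \<omega> t] \<open>0 < \<alpha>\<close> by (simp add: L_R)
      qed
      then show "enat (n + r) < D\<^sub>V \<omega>" unfolding D_R crossing_time_gt_iff by blast
    qed
    then show "\<omega> \<in> A2" using \<omega> D by (simp add: A1_def A2_def rR_def)
  qed

  have "AE \<omega> in M. \<omega> \<in> space (hist n) \<longrightarrow> 1 - \<eta> \<le> cond_prob_given M (hist n) A1 \<omega>"
  proof (rule cond_prob_given_ge[OF subalgebra_hist A1m sets.top])
    fix B assume B: "B \<in> sets (hist n)"
    then have "B \<in> events" using subalgebra_hist[of n] by (auto simp: subalgebra_def)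
    then have "prob (Good \<inter> B) \<le> prob (A1 \<inter> B)"
      using A1m Good_A1 by (intro finite_measure_mono) auto
    with Good(4)[OF B] show "(1 - \<eta>) * prob B \<le> prob (A1 \<inter> B)" by simp
  qed
  \<comment> \<open>Only history events inside \<open>E\<close> are tested, since the inclusion
    \<open>A1_A2\<close> is available there.\<close>
  moreover have "AE \<omega> in M. \<omega> \<in> E \<longrightarrow> 1 - \<eta> \<le> cond_prob_given M (hist n) A2 \<omega>"
  proof (rule cond_prob_given_ge[OF subalgebra_hist A2m Em])
    fix B assume B: "B \<in> sets (hist n)" "B \<subseteq> E"
    then have "B \<in> events" using subalgebra_hist[of n] by (auto simp: subalgebra_def)
    then have "prob (Good \<inter> B) \<le> prob (A2 \<inter> B)"
      using A2m Good_A1 A1_A2 B(2) by (intro finite_measure_mono) auto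
    with Good(4)[OF B(1)] show "(1 - \<eta>) * prob B \<le> prob (A2 \<inter> B)" by simp
  qed
  ultimately show "AE \<omega> in M. D\<^sub>C \<omega> = enat n \<and> enat n < D\<^sub>V \<omega> \<longrightarrow>
      cond_prob_given M (history M X U n)
        {\<omega> \<in> space M. \<forall>m \<ge> 1. L (n + m) \<omega> - L n \<omega> \<le> UR n m \<omega>} \<omega> \<ge> 1 - \<eta>
    \<and> cond_prob_given M (history M X U n)
        {\<omega> \<in> space M. D\<^sub>V \<omega> - D\<^sub>C \<omega> > rR n \<omega>} \<omega> \<ge> 1 - \<eta>"
    unfolding A1_def[symmetric] A2_def[symmetric] using AE_space
    by eventually_elim (auto simp: E_def)
qed

end
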